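(* Let $A$ be a commutative ring with identity, let $q,r$ be arbitrary integers and $G$ an abelian profinite group. Write $$D^{\rm pr}(q)\cap D^{\rm pr}(G)=\{p_1,\dots,p_k;c_1,\dots,c_s\},\qquad D^{\rm pr}(r)\cap D^{\rm pr}(G)=\{p_1,\dots,p_k;d_1,\dots,d_t\},$$ where the $p_i$ are the primes in $D^{\rm pr}(q)\cap D^{\rm pr}(r)\cap D^{\rm pr}(G)$. Then there exists a unique strict-isomorphism between $\mathbb W_G^q(A)$ and $\mathbb W_G^r(A)$ if and only if $A$ is a $\mathbb Z\left[\frac1{c_i},\frac1{d_j}:1\le i\le s,\,1\le j\le t\right]$-algebra.
   Context: For an integer $q$, $D^{\rm pr}(q)$ is the set of prime divisors of $q$, with $D^{\rm pr}(0)$ the set of all primes. $D^{\rm pr}(G)$ is the set of all primes dividing $(G:U)$ for some open subgroup $U$ of $G$. (The lists of $p_i,c_i,d_j$ may be infinite.) For $G$ abelian, $\mathcal O(G)$ is the set of open subgroups of $G$, and ${\rm Gh}(G,A)=A^{\mathcal O(G)}$ with componentwise operations. $\mathbb W_G^q$ is the unique functor from commutative rings with identity to commutative rings such that $\mathbb W_G^q(A)=A^{\mathcal O(G)}$ as a set, $\mathbb W_G^q(f)(\alpha)=f\circ\alpha$ for ring homomorphisms $f$, and for every $A$ the map $\Phi_G^q:\mathbb W_G^q(A)\to{\rm Gh}(G,A)$, $\Phi_G^q(\alpha)(U)=\sum_{U\subseteq V\subseteq G}(G:V)\,q^{(V:U)-1}\alpha(V)^{(V:U)}$ ($V$ ranging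 over open subgroups, $q^0=1$ always), is a ring homomorphism. A strict-isomorphism from $\mathbb W_G^q(A)$ to $\mathbb W_G^r(A)$ is a ring isomorphism $\tau_q^r:\mathbb W_G^q(A)\to\mathbb W_G^r(A)$ satisfying $\Phi_G^q=\Phi_G^r\circ\tau_q^r$.
   Formalization: Uniqueness fails for some A with torsion (q=r=0, G=Z/3, A=F_3); proved instead: a strict-isomorphism exists iff A is such an algebra, likewise a unique one natural in the ring, and the literal claim holds if A has no p-torsion for p in D^pr(G). *)

theory Defs
  imports
    "HOL-Analysis.Abstract_Topological_Spaces"
    "HOL-Algebra.Generated_Rings"
    "HOL-Algebra.Module"
    "HOL-Computational_Algebra.Primes"
    "HOL-Library.Infinite_Typeclass"
begin

section \<open>Abelian profinite groups\<close>

text \<open>Total disconnectedness says that connected subsets are subsingletons.\<close>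

locale abelian_profinite_group = comm_group G for G (structure) +
  fixes T :: "'a topology"
  assumes topspace_eq: "topspace T = carrier G"
    and continuous_mult: "continuous_map (prod_topology T T) T (\<lambda>(x, y). x \<otimes> y)"
    and continuous_inv: "continuous_map T T (\<lambda>x. inv x)"
    and compact: "compact_space T"
    and Hausdorff: "Hausdorff_space T"
    and totally_disconnected: "connectedin T S \<Longrightarrow> \<exists>x. S \<subseteq> {x}"

definition open_subgroups :: "'g monoid \<Rightarrow> 'g topology \<Rightarrow> 'g set set" where
  "open_subgroups G T = {U. subgroup U G \<and> openin T U}"

text \<open>The index \<open>(V:U)\<close> of \<open>U \<subseteq> V\<close>. It is finite for open subgroups of a compact group.\<close>

definition index :: "'g monoid \<Rightarrow> 'g set \<Rightarrow> 'g set \<Rightarrow> nat" where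
  "index G V U = card (rcosets\<^bsub>G\<lparr>carrier := V\<rparr>\<^esub> U)"


section \<open>Prime divisors\<close>

definition Dpr_int :: "int \<Rightarrow> nat set" where
  "Dpr_int q = {p. Factorial_Ring.prime p \<and> int p dvd q}"

definition Dpr_group :: "'g monoid \<Rightarrow> 'g topology \<Rightarrow> nat set" where
  "Dpr_group G T = {p. Factorial_Ring.prime p \<and> (\<exists>U\<in>open_subgroups G T. p dvd index G (carrier G) U)}"


section \<open>Commutative rings without identity\<close>

text \<open>
  In general \<open>W(A)\<close> has no identity: for \<open>q = 0\<close> the ghost map multiplies the component at \<open>U\<close>
  by \<open>(G:U)\<close>. The \<open>one\<close> field of the record is ignored in this section.
\<close>

locale comm_rng = abelian_group R for R (structure) +
  assumes mult_closed: "\<lbrakk>x \<in> carrier R; y \<in> carrier R\<rbrakk> \<Longrightarrow> x \<otimes> y \<in> carrier R"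
    and mult_assoc: "\<lbrakk>x \<in> carrier R; y \<in> carrier R; z \<in> carrier R\<rbrakk> \<Longrightarrow> (x \<otimes> y) \<otimes> z = x \<otimes> (y \<otimes> z)"
    and mult_comm: "\<lbrakk>x \<in> carrier R; y \<in> carrier R\<rbrakk> \<Longrightarrow> x \<otimes> y = y \<otimes> x"
    and distr: "\<lbrakk>x \<in> carrier R; y \<in> carrier R; z \<in> carrier R\<rbrakk> \<Longrightarrow> (x \<oplus> y) \<otimes> z = x \<otimes> z \<oplus> y \<otimes> z"

definition rng_hom :: "('a, 'm) ring_scheme \<Rightarrow> ('b, 'n) ring_scheme \<Rightarrow> ('a \<Rightarrow> 'b) set" where
  "rng_hom R S = hom R S \<inter> hom (add_monoid R) (add_monoid S)"

definition rng_iso :: "('a, 'm) ring_scheme \<Rightarrow> ('b, 'n) ring_scheme \<Rightarrow> ('a \<Rightarrow> 'b) set" where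
  "rng_iso R S = {h \<in> rng_hom R S. bij_betw h (carrier R) (carrier S)}"


section \<open>The ghost ring and the functor\<close>

definition ghost_ring :: "'g monoid \<Rightarrow> 'g topology \<Rightarrow> 'a ring \<Rightarrow> ('g set \<Rightarrow> 'a) ring" where
  "ghost_ring G T A =
    \<lparr>carrier = open_subgroups G T \<rightarrow>\<^sub>E carrier A,
     monoid.mult = (\<lambda>\<alpha> \<beta>. \<lambda>U\<in>open_subgroups G T. \<alpha> U \<otimes>\<^bsub>A\<^esub> \<beta> U),
     monoid.one = (\<lambda>U\<in>open_subgroups G T. \<one>\<^bsub>A\<^esub>),
     ring.zero = (\<lambda>U\<in>open_subgroups G T. \<zero>\<^bsub>A\<^esub>),
     ring.add = (\<lambda>\<alpha> \<beta>. \<lambda>U\<in>open_subgroups G T. \<alpha> U \<oplus>\<^bsub>A\<^esub> \<beta> U)\<rparr>"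

definition ghost_map ::
  "'g monoid \<Rightarrow> 'g topology \<Rightarrow> int \<Rightarrow> 'a ring \<Rightarrow> ('g set \<Rightarrow> 'a) \<Rightarrow> ('g set \<Rightarrow> 'a)" where
  "ghost_map G T q A \<alpha> =
    (\<lambda>U\<in>open_subgroups G T.
      \<Oplus>\<^bsub>A\<^esub>V\<in>{V \<in> open_subgroups G T. U \<subseteq> V}.
        add_pow A (int (index G (carrier G) V) * q ^ (index G V U - 1)) (\<alpha> V [^]\<^bsub>A\<^esub> index G V U))"

text \<open>
  The defining property of the functor, on the commutative rings whose carrier lies in the type
  \<open>'a\<close>, which plays the role of a universe. If \<open>'a\<close> is infinite, every commutative ring over \<open>'a\<close>
  is a quotient of a torsion-free one over \<open>'a\<close> (a polynomial ring over \<open>\<int>\<close>), so this property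
  determines the operations of each \<open>W A\<close> on its carrier. Over a finite type it need not do so.
\<close>

definition is_witt_burnside ::
  "'g monoid \<Rightarrow> 'g topology \<Rightarrow> int \<Rightarrow> ('a ring \<Rightarrow> ('g set \<Rightarrow> 'a) ring) \<Rightarrow> bool" where
  "is_witt_burnside G T q W \<longleftrightarrow>
    (\<forall>A. cring A \<longrightarrow>
      comm_rng (W A) \<and>
      carrier (W A) = open_subgroups G T \<rightarrow>\<^sub>E carrier A \<and>
      ghost_map G T q A \<in> rng_hom (W A) (ghost_ring G T A)) \<and>
    (\<forall>A B. cring A \<longrightarrow> cring B \<longrightarrow>
      (\<forall>f\<in>ring_hom A B. compose (open_subgroups G T) f \<in> rng_hom (W A) (W B)))"


section \<open>Strict isomorphisms\<close>

text \<open>The maps are \<open>extensional\<close> so that equality is equality on the carrier.\<close>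

definition strict_isos ::
  "'g monoid \<Rightarrow> 'g topology \<Rightarrow> int \<Rightarrow> int \<Rightarrow> ('a ring \<Rightarrow> ('g set \<Rightarrow> 'a) ring) \<Rightarrow>
   ('a ring \<Rightarrow> ('g set \<Rightarrow> 'a) ring) \<Rightarrow> 'a ring \<Rightarrow> (('g set \<Rightarrow> 'a) \<Rightarrow> ('g set \<Rightarrow> 'a)) set" where
  "strict_isos G T q r Wq Wr A =
    {\<tau> \<in> rng_iso (Wq A) (Wr A) \<inter> extensional (carrier (Wq A)).
      \<forall>\<alpha>\<in>carrier (Wq A). ghost_map G T q A \<alpha> = ghost_map G T r A (\<tau> \<alpha>)}"

text \<open>
  If \<open>A\<close> has torsion, the ghost map is not injective and a strict isomorphism for the single ring
  \<open>A\<close> need not be unique. For example, let \<open>q = r = 0\<close>, \<open>G = \<int>/3\<close>, \<open>A = \<int>/3\<close>. Then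
  \<open>W(A) = A \<times> A\<close> with componentwise addition, \<open>(a, b) (c, d) = (a c, 3 b d) = (a c, 0)\<close> and ghost
  map \<open>(a, b) \<mapsto> (a, 3 b) = (a, 0)\<close>, so \<open>(a, b) \<mapsto> (a, 2 b)\<close> is a strict automorphism different
  from the identity. What is unique is the strict isomorphism that is functorial in the ring.
  The components of natural families of strict isomorphisms are collected below, where a family is
  indexed by all the rings that admit a strict isomorphism.
\<close>

definition functorial_strict_isos ::
  "'g monoid \<Rightarrow> 'g topology \<Rightarrow> int \<Rightarrow> int \<Rightarrow> ('a ring \<Rightarrow> ('g set \<Rightarrow> 'a) ring) \<Rightarrow>
   ('a ring \<Rightarrow> ('g set \<Rightarrow> 'a) ring) \<Rightarrow> 'a ring \<Rightarrow> (('g set \<Rightarrow> 'a) \<Rightarrow> ('g set \<Rightarrow> 'a)) set" where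
  "functorial_strict_isos G T q r Wq Wr A =
    {\<tau> \<in> strict_isos G T q r Wq Wr A.
      \<exists>t. t A = \<tau> \<and>
        (let \<C> = {B. cring B \<and> strict_isos G T q r Wq Wr B \<noteq> {}} in
          (\<forall>B\<in>\<C>. t B \<in> strict_isos G T q r Wq Wr B) \<and>
          (\<forall>B\<in>\<C>. \<forall>C\<in>\<C>. \<forall>f\<in>ring_hom B C. \<forall>\<alpha>\<in>carrier (Wq B).
            compose (open_subgroups G T) f (t B \<alpha>) = t C (compose (open_subgroups G T) f \<alpha>)))}"


section \<open>Algebras over localizations of the integers\<close>

definition rat_ring :: "rat ring" where
  "rat_ring = \<lparr>carrier = UNIV, monoid.mult = (*), monoid.one = 1, ring.zero = 0, ring.add = (+)\<rparr>"

text \<open>The ring \<open>\<int>[1/p : p \<in> S]\<close>, as a subring of the rationals.\<close>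

definition int_localization :: "nat set \<Rightarrow> rat ring" where
  "int_localization S = rat_ring\<lparr>carrier := generate_ring rat_ring {1 / of_nat p | p. p \<in> S}\<rparr>"

definition is_algebra_over :: "('b, 'm) ring_scheme \<Rightarrow> 'a ring \<Rightarrow> bool" where
  "is_algebra_over R A \<longleftrightarrow> (\<exists>s. Module.algebra R (ring.extend A (module.fields s)))"

end

theory Submission
  imports
    Defs
    "HOL-Library.Poly_Mapping"
    "HOL-Algebra.Sylow"
    "HOL-Algebra.Multiplicative_Group"
    "HOL-Number_Theory.Residues"
begin

text \<open>
  Write \<open>\<Phi>\<^sup>q\<close> for the ghost map and let \<open>N = C \<union> D\<close>. Over the rationals there are unique polynomials
  \<open>y\<^sub>U\<close> in variables \<open>X\<^sub>V\<close> with \<open>\<Phi>\<^sup>r(y) = \<Phi>\<^sup>q(X)\<close>, and the point is that they are \<open>p\<close>-integral for every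
  prime \<open>p \<notin> N\<close>. If \<open>p\<close> divides no index this is clear, and if \<open>p\<close> divides both \<open>q\<close> and \<open>r\<close> every
  summand of \<open>\<Phi>\<^sup>q(X)(U)\<close> is divisible by the \<open>p\<close>-part of \<open>(G:U)\<close>. If \<open>p\<close> divides neither, one uses a
  congruence of Dress: with the Frobenius lift \<open>\<phi>\<close> given by \<open>X\<^sub>V \<mapsto> X\<^sub>V^p\<close>, the sum of
  \<open>\<phi>^j(\<Phi>\<^sup>q(x)(\<langle>g\<rangle>U))\<close> over the elements \<open>g\<close> of \<open>G/U\<close> of order \<open>p^j\<close>, for all \<open>j\<close>, vanishes modulo the
  \<open>p\<close>-part of \<open>(G:U)\<close>. For \<open>q = 1\<close> this reduces to the fact that the number of solutions of
  \<open>g^(p^j) = 1\<close> in a finite abelian group is divisible by \<open>p^j\<close> if its order is, and the general case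
  follows from \<open>q \<Phi>\<^sup>q(x) = \<Phi>\<^sup>1(q x)\<close>.

  Evaluating \<open>y\<close> gives a natural map over every ring in which the primes of \<open>N\<close> are units. It is a
  ring isomorphism over torsion-free rings, where the ghost maps are injective, hence over all rings,
  since each is a quotient of a torsion-free one (a polynomial ring over \<open>\<int>[1/p : p \<in> N]\<close>). The same
  quotients show that it is the only functorial one. Conversely, for \<open>p \<in> N\<close> there is an open subgroup
  \<open>V\<close> of index \<open>p\<close>, and comparing the values at \<open>V\<close> of the ghost maps of the constant function \<open>1\<close> and
  of its image shows that \<open>q^(p-1) - r^(p-1)\<close>, which is prime to \<open>p\<close>, is divisible by \<open>p\<close> in \<open>A\<close>.
\<close>

section \<open>Frobenius lifts\<close>

text \<open>In the application \<open>S\<close> consists of the \<open>p\<close>-integral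
  polynomials among all rational ones, and \<phi> substitutes \<open>X^p\<close> for each variable
  \<open>X\<close>. So \<phi> respects the operations of the whole type, while the congruence with
  the \<open>p\<close>-th power is asked only on \<open>S\<close>.\<close>

locale frobenius_lift =
  fixes S :: "'b::comm_ring_1 set" and p :: nat and \<phi> :: "'b \<Rightarrow> 'b"
  assumes prime_p: "Factorial_Ring.prime p"
    and one_S: "1 \<in> S"
    and diff_S: "x \<in> S \<Longrightarrow> y \<in> S \<Longrightarrow> x - y \<in> S"
    and mult_S: "x \<in> S \<Longrightarrow> y \<in> S \<Longrightarrow> x * y \<in> S"
    and lift_S: "x \<in> S \<Longrightarrow> \<phi> x \<in> S"
    and lift_one: "\<phi> 1 = 1"
    and lift_add: "\<phi> (x + y) = \<phi> x + \<phi> y"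
    and lift_mult: "\<phi> (x * y) = \<phi> x * \<phi> y"
    and lift_cong: "x \<in> S \<Longrightarrow> \<exists>s\<in>S. \<phi> x - x ^ p = of_nat p * s"
begin

text \<open>The quotient must lie in \<open>S\<close>: in the ambient ring \<open>p\<close> may be
  invertible, and divisibility there would say nothing.\<close>

definition pdvd :: "nat \<Rightarrow> 'b \<Rightarrow> bool" where
  "pdvd n x \<longleftrightarrow> (\<exists>s\<in>S. x = of_nat (p ^ n) * s)"

lemma zero_S: "0 \<in> S"
  using diff_S[OF one_S one_S] by simp

lemma minus_S: "x \<in> S \<Longrightarrow> - x \<in> S"
  using diff_S[OF zero_S, of x] by simp

lemma add_S: "x \<in> S \<Longrightarrow> y \<in> S \<Longrightarrow> x + y \<in> S"
  using diff_S[OF _ minus_S, of x y] by simp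

lemma power_S: "x \<in> S \<Longrightarrow> x ^ n \<in> S"
  by (induction n) (auto intro: one_S mult_S)

lemma of_nat_S: "of_nat n \<in> S"
  by (induction n) (auto intro: one_S zero_S add_S)

lemma of_int_S: "of_int k \<in> S"
  by (cases k rule: int_cases2) (auto intro: of_nat_S minus_S)

lemma sum_S: "(\<And>i. i \<in> I \<Longrightarrow> f i \<in> S) \<Longrightarrow> sum f I \<in> S"
  by (induction I rule: infinite_finite_induct) (auto intro: zero_S add_S)

lemma pdvd_0 [simp]: "pdvd 0 x \<longleftrightarrow> x \<in> S"
  by (auto simp: pdvd_def)

lemma pdvd_zero [simp]: "pdvd n 0"
  unfolding pdvd_def using zero_S by force

lemma pdvd_add: "pdvd n x \<Longrightarrow> pdvd n y \<Longrightarrow> pdvd n (x + y)"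
  unfolding pdvd_def by (metis add_S distrib_left)

lemma pdvd_diff: "pdvd n x \<Longrightarrow> pdvd n y \<Longrightarrow> pdvd n (x - y)"
  unfolding pdvd_def by (metis diff_S right_diff_distrib)

lemma pdvd_sum: "(\<And>i. i \<in> I \<Longrightarrow> pdvd n (f i)) \<Longrightarrow> pdvd n (sum f I)"
  by (induction I rule: infinite_finite_induct) (auto intro: pdvd_add)

lemma pdvd_mult: "pdvd m x \<Longrightarrow> pdvd n y \<Longrightarrow> pdvd (m + n) (x * y)"
proof -
  assume "pdvd m x" "pdvd n y"
  then obtain s t where *: "s \<in> S" "t \<in> S" "x = of_nat (p ^ m) * s" "y = of_nat (p ^ n) * t"
    unfolding pdvd_def by blast
  then have "x * y = of_nat (p ^ (m + n)) * (s * t)"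
    by (simp add: power_add ac_simps)
  with * show ?thesis
    unfolding pdvd_def using mult_S by blast
qed

lemma pdvd_mult_left: "x \<in> S \<Longrightarrow> pdvd n y \<Longrightarrow> pdvd n (x * y)"
  using pdvd_mult[of 0 x n y] by simp

lemma pdvd_le: "pdvd n x \<Longrightarrow> m \<le> n \<Longrightarrow> pdvd m x"
proof -
  assume "pdvd n x" "m \<le> n"
  then obtain s where *: "s \<in> S" "x = of_nat (p ^ n) * s"
    unfolding pdvd_def by blast
  then have "x = of_nat (p ^ m) * (of_nat (p ^ (n - m)) * s)"
    using \<open>m \<le> n\<close> by (metis le_add_diff_inverse mult.assoc of_nat_mult power_add)
  with * show ?thesis
    unfolding pdvd_def using mult_S of_nat_S by blast
qed

lemma pdvd_of_nat: "p ^ n dvd k \<Longrightarrow> pdvd n (of_nat k)"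
  unfolding pdvd_def dvd_def using of_nat_S by fastforce

lemma pdvd_of_int: "int p ^ n dvd k \<Longrightarrow> pdvd n (of_int k)"
  unfolding pdvd_def dvd_def using of_int_S by fastforce

lemma pdvd_diff_power:
  assumes "x \<in> S" "y \<in> S" "pdvd n (x - y)"
  shows "pdvd n (x ^ k - y ^ k)"
proof -
  have "x ^ k - y ^ k = (\<Sum>i<k. y ^ (k - Suc i) * x ^ i) * (x - y)"
    by (simp add: power_diff_sumr2 mult.commute)
  also have "pdvd n \<dots>"
    by (intro pdvd_mult_left sum_S mult_S power_S assms)
  finally show ?thesis .
qed

text \<open>The quotient of \<open>x^p - y^p\<close> by \<open>x - y\<close> is a sum of
  \<open>p\<close> terms, each congruent to \<open>y^(p-1)\<close> modulo \<open>p\<close> because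
  \<open>n > 0\<close>; this yields one further factor \<open>p\<close>.\<close>

lemma pdvd_diff_power_prime:
  assumes "x \<in> S" "y \<in> S" "pdvd n (x - y)" "n > 0"
  shows "pdvd (Suc n) (x ^ p - y ^ p)"
proof -
  have "pdvd 1 (\<Sum>i<p. y ^ (p - Suc i) * x ^ i)"
  proof -
    have "(\<Sum>i<p. y ^ (p - Suc i) * x ^ i) =
        (\<Sum>i<p. y ^ (p - Suc i) * (x ^ i - y ^ i)) + (\<Sum>i<p. y ^ (p - 1))"
      unfolding sum.distrib[symmetric]
      by (rule sum.cong) (auto simp: algebra_simps simp flip: power_add)
    also have "pdvd 1 \<dots>"
    proof (rule pdvd_add)
      have "pdvd 1 (x - y)"
        using assms pdvd_le[of n "x - y" 1] by simp
      then show "pdvd 1 (\<Sum>i<p. y ^ (p - Suc i) * (x ^ i - y ^ i))"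
        by (intro pdvd_sum pdvd_mult_left power_S assms pdvd_diff_power)
      show "pdvd 1 (\<Sum>i<p. y ^ (p - 1))"
        using pdvd_mult_left[OF power_S[OF assms(2), of "p - 1"] pdvd_of_nat[of 1 p]]
        by (simp add: mult.commute)
    qed
    finally show ?thesis .
  qed
  from pdvd_mult[OF assms(3) this] show ?thesis
    by (simp add: power_diff_sumr2)
qed

section \<open>Iterates and congruences of the Frobenius lift\<close>

lemma lift_power: "\<phi> (x ^ n) = \<phi> x ^ n"
  by (induction n) (auto simp: lift_one lift_mult)

lemma lift_zero: "\<phi> 0 = 0"
  using lift_add[of 0 0] by simp

lemma lift_minus: "\<phi> (- x) = - \<phi> x"
  using lift_add[of x "- x"] lift_zero by (simp add: eq_neg_iff_add_eq_0 add.commute)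

lemma lift_sum: "\<phi> (sum f I) = (\<Sum>i\<in>I. \<phi> (f i))"
  by (induction I rule: infinite_finite_induct) (auto simp: lift_add lift_zero)

lemma lift_of_nat: "\<phi> (of_nat n) = of_nat n"
  by (induction n) (auto simp: lift_add lift_zero lift_one)

lemma lift_of_int: "\<phi> (of_int k) = of_int k"
  by (cases k rule: int_cases2) (auto simp: lift_of_nat lift_minus)

lemma funpow_lift_S: "x \<in> S \<Longrightarrow> (\<phi> ^^ n) x \<in> S"
  by (induction n) (auto intro: lift_S)

lemma funpow_lift_sum: "(\<phi> ^^ n) (sum f I) = (\<Sum>i\<in>I. (\<phi> ^^ n) (f i))"
  by (induction n) (auto simp: lift_sum)

lemma funpow_lift_of_int_mult: "(\<phi> ^^ n) (of_int k * x) = of_int k * (\<phi> ^^ n) x"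
  by (induction n) (auto simp: lift_of_int lift_mult)

lemma funpow_lift_power: "(\<phi> ^^ n) (x ^ k) = (\<phi> ^^ n) x ^ k"
  by (induction n) (auto simp: lift_power)

text \<open>Start from the congruence of \<open>x^p\<close> and \<open>\<phi> x\<close> modulo
  \<open>p\<close>; each passage to \<open>p\<close>-th powers gains a factor
  \<open>p\<close>.\<close>

lemma pdvd_lift_power:
  assumes "x \<in> S"
  shows "pdvd (Suc n) (x ^ (p ^ Suc n) - \<phi> x ^ (p ^ n))"
proof (induction n)
  case 0
  obtain s where "s \<in> S" "\<phi> x - x ^ p = of_nat p * s"
    using lift_cong[OF assms] by blast
  then have "x ^ p - \<phi> x = of_nat p * (- s)"
    by (metis minus_diff_eq mult_minus_right)
  then show ?case
    unfolding pdvd_def using minus_S[OF \<open>s \<in> S\<close>] by (intro bexI[of _ "- s"]) auto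
next
  case (Suc n)
  from pdvd_diff_power_prime[OF _ _ this] show ?case
    using assms by (simp add: power_S lift_S mult.commute flip: power_mult)
qed

text \<open>The summand depends only on the order \<open>p^j\<close> of \<open>g\<close>, and the
  values for consecutive \<open>j\<close> are congruent by \<open>pdvd_lift_power\<close>. Abel
  summation pairs their differences with the numbers of elements killed by \<open>p^i\<close>, and
  the two divisibilities add up.\<close>

lemma pdvd_torsion_sum:
  fixes H (structure)
  assumes "comm_group H" "finite (carrier H)" "subgroup L H" "p ^ a dvd card L" "z \<in> S"
  shows "pdvd a (\<Sum>g\<in>{g \<in> L. \<exists>j. group.ord H g = p ^ j}.
    (\<phi> ^^ multiplicity p (group.ord H g)) z ^ (card L div group.ord H g))"
proof -
  interpret comm_group H by fact
  have "finite L"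
    using assms(2,3) subgroup.subset finite_subset by blast
  have group_L: "group (H\<lparr>carrier := L\<rparr>)"
    using assms(3) subgroup_imp_group by blast
  have L_sub: "x \<in> carrier H" if "x \<in> L" for x
    using that assms(3) subgroup.subset by blast
  have "card L > 0"
    using \<open>finite L\<close> assms(3) subgroup.one_closed card_gt_0_iff by blast
  \<comment> \<open>The claim is proved for the full power \<open>p^b\<close> dividing
    \<open>card L\<close>; then \<open>a \<le> b\<close> suffices.\<close>
  define b where "b = multiplicity p (card L)"
  have p1: "p > 1"
    using prime_p prime_gt_1_nat by blast
  have "a \<le> b"
    unfolding b_def using assms(4) p1 \<open>card L > 0\<close> by (simp add: power_dvd_iff_le_multiplicity)
  have b_dvd: "p ^ b dvd card L"
    unfolding b_def by (rule multiplicity_dvd)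
  have ord_dvd: "ord g dvd card L" if "g \<in> L" for g
  proof -
    have "g [^] card L = \<one>"
      using group.pow_order_eq_1[OF group_L, of g] that \<open>finite L\<close>
      by (simp add: order_def nat_pow_consistent[symmetric])
    then show ?thesis
      using L_sub[OF that] pow_eq_id by blast
  qed
  define Q where "Q = {g \<in> L. \<exists>j. ord g = p ^ j}"
  have "finite Q"
    unfolding Q_def using \<open>finite L\<close> by simp
  define e where "e g = multiplicity p (ord g)" for g
  have ord_e: "ord g = p ^ e g" "e g \<le> b" if "g \<in> Q" for g
  proof -
    from that obtain j where j: "ord g = p ^ j"
      unfolding Q_def by blast
    then show *: "ord g = p ^ e g"
      unfolding e_def using prime_p multiplicity_prime_power[of p j]
      by (metis multiplicity_same_power not_prime_0 prime_elem_iff_prime_abs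
          prime_imp_prime_elem prime_elem_not_unit)
    show "e g \<le> b"
      unfolding b_def using ord_dvd[of g] * that p1 \<open>card L > 0\<close>
      by (auto simp: Q_def power_dvd_iff_le_multiplicity)
  qed
  \<comment> \<open>These elements form the subgroup of \<open>L\<close> killed by
    \<open>p^i\<close>. It contains a subgroup of order \<open>p^i\<close> provided by Sylow, and
    Lagrange gives the divisibility.\<close>
  have dvd_torsion: "p ^ i dvd card {g \<in> Q. e g \<le> i}" if "i \<le> b" for i
  proof -
    have eq: "{g \<in> Q. e g \<le> i} = {g \<in> L. g [^] (p ^ i) = \<one>}"
    proof (intro equalityI subsetI; clarify)
      fix g assume "g \<in> Q" "e g \<le> i"
      then have "ord g dvd p ^ i"
        using ord_e(1) le_imp_power_dvd by metis
      then show "g \<in> L \<and> g [^] (p ^ i) = \<one>"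
        using \<open>g \<in> Q\<close> L_sub pow_eq_id unfolding Q_def by blast
    next
      fix g assume g: "g \<in> L" "g [^] (p ^ i) = \<one>"
      then have "ord g dvd p ^ i"
        using L_sub pow_eq_id by blast
      then obtain j where j: "j \<le> i" "ord g = p ^ j"
        using prime_p divides_primepow_nat by blast
      then have "g \<in> Q"
        using g unfolding Q_def by blast
      moreover from ord_e(1)[OF this] j p1 have "e g = j"
        by simp
      ultimately show "g \<in> Q \<and> e g \<le> i"
        using j by simp
    qed
    have sub: "subgroup {g \<in> L. g [^] (p ^ i) = \<one>} (H\<lparr>carrier := L\<rparr>)"
    proof (rule group.subgroupI[OF group_L])
      fix x y assume "x \<in> {g \<in> L. g [^] (p ^ i) = \<one>}" "y \<in> {g \<in> L. g [^] (p ^ i) = \<one>}"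
      then show "x \<otimes>\<^bsub>H\<lparr>carrier := L\<rparr>\<^esub> y \<in> {g \<in> L. g [^] (p ^ i) = \<one>}"
        using assms(3) by (auto simp: L_sub pow_mult_distrib m_comm subgroup.m_closed)
    next
      fix x assume "x \<in> {g \<in> L. g [^] (p ^ i) = \<one>}"
      then show "inv\<^bsub>H\<lparr>carrier := L\<rparr>\<^esub> x \<in> {g \<in> L. g [^] (p ^ i) = \<one>}"
        using assms(3) by (auto simp: L_sub m_inv_consistent subgroup.m_inv_closed nat_pow_inv)
    qed (use assms(3) subgroup.one_closed in \<open>auto intro!: exI[of _ \<one>]\<close>)
    obtain m where m: "card L = p ^ i * m"
      using b_dvd \<open>i \<le> b\<close> by (meson dvd_def dvd_trans le_imp_power_dvd)
    obtain K where K: "subgroup K (H\<lparr>carrier := L\<rparr>)" "card K = p ^ i"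
      using sylow_thm[OF prime_p group_L, of i m] m \<open>finite L\<close> by (auto simp: order_def)
    then have group_K: "group (H\<lparr>carrier := K\<rparr>)"
      using group.subgroup_imp_group[OF group_L K(1)] by simp
    have "K \<subseteq> L"
      using K(1) subgroup.subset by fastforce
    moreover have "x [^] (p ^ i) = \<one>" if "x \<in> K" for x
      using group.pow_order_eq_1[OF group_K, of x] that K(2) finite_subset[OF \<open>K \<subseteq> L\<close> \<open>finite L\<close>]
      by (simp add: order_def nat_pow_consistent[symmetric])
    ultimately have "K \<subseteq> {g \<in> L. g [^] (p ^ i) = \<one>}"
      by blast
    then have "subgroup K (H\<lparr>carrier := L, carrier := {g \<in> L. g [^] (p ^ i) = \<one>}\<rparr>)"
      by (rule group.subgroup_incl[OF group_L K(1) sub])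
    from group.lagrange[OF group.subgroup_imp_group[OF group_L sub] this]
    have "card K dvd order (H\<lparr>carrier := L, carrier := {g \<in> L. g [^] (p ^ i) = \<one>}\<rparr>)"
      by (rule dvdI[OF trans[OF sym mult.commute]])
    then have "card K dvd card {g \<in> L. g [^] (p ^ i) = \<one>}"
      by (simp add: order_def)
    then show ?thesis
      using eq K(2) by simp
  qed
  define w where "w j = (\<phi> ^^ j) z ^ (card L div p ^ j)" for j
  have w_S: "w j \<in> S" for j
    unfolding w_def by (intro power_S funpow_lift_S assms)
  \<comment> \<open>With \<open>card L = p^b * m\<close> and \<open>c + 1 = b - i\<close>, the two
    values are the \<open>m\<close>-th powers of \<open>u^(p^(c+1))\<close> and
    \<open>(\<phi> u)^(p^c)\<close>.\<close>
  have w_diff: "pdvd (b - i) (w i - w (Suc i))" if "i < b" for i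
  proof -
    define u where "u = (\<phi> ^^ i) z"
    obtain m where m: "card L = p ^ b * m"
      using b_dvd by blast
    define c where "c = b - Suc i"
    have b: "b = Suc (i + c)"
      using that unfolding c_def by simp
    have "w i = (u ^ (p ^ Suc c)) ^ m" "w (Suc i) = (\<phi> u ^ (p ^ c)) ^ m"
      using p1 unfolding w_def u_def m b
      by (simp_all add: power_add ac_simps flip: power_mult)
    moreover have "u \<in> S"
      unfolding u_def using funpow_lift_S[OF assms(5)] .
    ultimately have "pdvd (Suc c) (w i - w (Suc i))"
      by (auto simp del: power_Suc intro!: pdvd_diff_power pdvd_lift_power power_S lift_S)
    then show ?thesis
      using b by simp
  qed
  \<comment> \<open>Telescoping from \<open>e g\<close> up to \<open>b\<close>. After the sums are
    interchanged, the difference at \<open>i\<close> occurs once for each element with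
    \<open>e g \<le> i\<close>.\<close>
  have "(\<Sum>g\<in>Q. w (e g)) = (\<Sum>g\<in>Q. w b + (\<Sum>i<b. if e g \<le> i then w i - w (Suc i) else 0))"
  proof (rule sum.cong)
    fix g assume "g \<in> Q"
    have "(\<Sum>i<b. if e g \<le> i then w i - w (Suc i) else 0) = (\<Sum>i=e g..<b. w i - w (Suc i))"
      by (subst sum.inter_filter[symmetric]) (auto intro: sum.cong)
    also have "\<dots> = w (e g) - w b"
      using ord_e(2)[OF \<open>g \<in> Q\<close>] sum_Suc_diff'[of "e g" b "\<lambda>i. - w i"] by simp
    finally show "w (e g) = w b + (\<Sum>i<b. if e g \<le> i then w i - w (Suc i) else 0)"
      by simp
  qed simp
  also have "\<dots> = of_nat (card Q) * w b + (\<Sum>i<b. of_nat (card {g \<in> Q. e g \<le> i}) * (w i - w (Suc i)))"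
    unfolding sum.distrib by (subst sum.swap) (simp add: sum.inter_filter[symmetric] \<open>finite Q\<close>)
  also have "pdvd b \<dots>"
  proof (intro pdvd_add pdvd_sum)
    have "{g \<in> Q. e g \<le> b} = Q"
      using ord_e(2) by blast
    then show "pdvd b (of_nat (card Q) * w b)"
      using pdvd_mult[OF pdvd_of_nat[OF dvd_torsion[of b]], of 0 "w b"] w_S by simp
  next
    fix i assume "i \<in> {..<b}"
    then show "pdvd b (of_nat (card {g \<in> Q. e g \<le> i}) * (w i - w (Suc i)))"
      using pdvd_mult[OF pdvd_of_nat[OF dvd_torsion[of i]] w_diff[of i]] by simp
  qed
  also have "(\<Sum>g\<in>Q. w (e g)) = (\<Sum>g\<in>Q. (\<phi> ^^ multiplicity p (ord g)) z ^ (card L div ord g))"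
    unfolding w_def using ord_e(1) by (intro sum.cong) (auto simp: e_def)
  finally show ?thesis
    unfolding Q_def using \<open>a \<le> b\<close> pdvd_le by blast
qed

end

section \<open>Polynomials over localizations of the integers\<close>

text \<open>The ring \<open>\<int>[1/p : p \<in> N]\<close>, described by denominators. For
  \<open>N = - {p}\<close> it is the localization of the integers at \<open>p\<close>.\<close>

definition localized_rats :: "nat set \<Rightarrow> rat set" where
  "localized_rats N = {of_int a / of_nat b | a b.
     b > 0 \<and> (\<forall>p. Factorial_Ring.prime p \<longrightarrow> p dvd b \<longrightarrow> p \<in> N)}"

lemma localized_ratsI:
  assumes "b > 0" "\<And>p. Factorial_Ring.prime p \<Longrightarrow> p dvd b \<Longrightarrow> p \<in> N"
  shows "of_int a / of_nat b \<in> localized_rats N"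
  unfolding localized_rats_def using assms by blast

lemma localized_ratsE:
  assumes "c \<in> localized_rats N"
  obtains a b where "c = of_int a / of_nat b" "b > 0"
    "\<And>p. Factorial_Ring.prime p \<Longrightarrow> p dvd b \<Longrightarrow> p \<in> N"
  using assms unfolding localized_rats_def by blast

lemma localized_rats_of_int: "of_int a \<in> localized_rats N"
  using localized_ratsI[of 1 N a] by auto

lemma localized_rats_add:
  assumes "c \<in> localized_rats N" "d \<in> localized_rats N"
  shows "c + d \<in> localized_rats N"
proof -
  obtain a b where 1: "c = of_int a / of_nat b" "b > 0"
    "\<And>p. Factorial_Ring.prime p \<Longrightarrow> p dvd b \<Longrightarrow> p \<in> N"
    using localized_ratsE[OF assms(1)] by metis
  obtain a' b' where 2: "d = of_int a' / of_nat b'" "b' > 0"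
    "\<And>p. Factorial_Ring.prime p \<Longrightarrow> p dvd b' \<Longrightarrow> p \<in> N"
    using localized_ratsE[OF assms(2)] by metis
  have "c + d = of_int (a * int b' + a' * int b) / of_nat (b * b')"
    using 1 2 by (simp add: field_simps)
  then show ?thesis
    using localized_ratsI[of "b * b'" N] 1 2 by (metis nat_0_less_mult_iff prime_dvd_mult_iff)
qed

lemma localized_rats_mult:
  assumes "c \<in> localized_rats N" "d \<in> localized_rats N"
  shows "c * d \<in> localized_rats N"
proof -
  obtain a b where 1: "c = of_int a / of_nat b" "b > 0"
    "\<And>p. Factorial_Ring.prime p \<Longrightarrow> p dvd b \<Longrightarrow> p \<in> N"
    using localized_ratsE[OF assms(1)] by metis
  obtain a' b' where 2: "d = of_int a' / of_nat b'" "b' > 0"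
    "\<And>p. Factorial_Ring.prime p \<Longrightarrow> p dvd b' \<Longrightarrow> p \<in> N"
    using localized_ratsE[OF assms(2)] by metis
  have "c * d = of_int (a * a') / of_nat (b * b')"
    using 1(1) 2(1) by simp
  then show ?thesis
    using localized_ratsI[of "b * b'" N] 1 2 by (metis nat_0_less_mult_iff prime_dvd_mult_iff)
qed

lemma localized_rats_inverse:
  assumes "n > 0" "\<And>p. Factorial_Ring.prime p \<Longrightarrow> p dvd n \<Longrightarrow> p \<in> N"
  shows "1 / of_nat n \<in> localized_rats N"
  using localized_ratsI[OF assms, of 1] by simp

lemma localized_rats_uminus: "c \<in> localized_rats N \<Longrightarrow> - c \<in> localized_rats N"
  using localized_rats_mult[of "-1" N c] localized_rats_of_int[of "-1" N] by simp

lemma localized_rats_UNIV: "localized_rats UNIV = UNIV"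
proof -
  have "c \<in> localized_rats UNIV" for c
  proof (cases c rule: Rat_cases)
    case (Fract a b)
    then show ?thesis
      using localized_ratsI[of "nat b" UNIV a] by (simp add: Fract_of_int_quotient)
  qed
  then show ?thesis
    by blast
qed

text \<open>Local-global principle, which lets integrality be checked one prime at a time. If a
  prime outside \<open>N\<close> divided the denominator in lowest terms, integrality at that prime
  would force it to divide the numerator as well.\<close>

lemma localized_rats_Inter:
  assumes "\<And>p. Factorial_Ring.prime p \<Longrightarrow> p \<notin> N \<Longrightarrow> c \<in> localized_rats (- {p})"
  shows "c \<in> localized_rats N"
proof (cases c rule: Rat_cases)
  case (Fract a b)
  have c: "c = of_int a / of_nat (nat b)"
    using Fract by (simp add: Fract_of_int_quotient)
  have "p \<in> N" if p: "Factorial_Ring.prime p" "p dvd nat b" for p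
  proof (rule ccontr)
    assume "p \<notin> N"
    obtain a' b' where *: "c = of_int a' / of_nat b'" "b' > 0"
      "\<And>p'. Factorial_Ring.prime p' \<Longrightarrow> p' dvd b' \<Longrightarrow> p' \<in> - {p}"
      using localized_ratsE[OF assms[OF p(1) \<open>p \<notin> N\<close>]] by metis
    have "(of_int (a * int b') :: rat) = of_int (a' * b)"
      using * c Fract by (simp add: field_simps)
    then have "a * int b' = a' * b"
      by (simp only: of_int_eq_iff)
    moreover have pb: "int p dvd b"
      using p(2) Fract(2) by (metis dvd_nat_abs_iff int_dvd_int_iff nat_0_le less_imp_le)
    ultimately have "int p dvd a * int b'"
      by simp
    moreover have "\<not> int p dvd int b'"
      using * p by auto
    ultimately have "int p dvd a"
      using p(1) by (simp add: prime_dvd_mult_iff)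
    then have "int p dvd 1"
      using pb Fract(3) coprime_common_divisor by blast
    then show False
      using p(1) by simp
  qed
  then show ?thesis
    unfolding c using Fract by (intro localized_ratsI) auto
qed

section \<open>Polynomials over the localization, with multisets of variables as monomials\<close>

definition localized_polys :: "nat set \<Rightarrow> ('v multiset \<Rightarrow>\<^sub>0 rat) set" where
  "localized_polys N = {f. \<forall>m. poly_mapping.lookup f m \<in> localized_rats N}"

abbreviation pconst :: "rat \<Rightarrow> ('v multiset \<Rightarrow>\<^sub>0 rat)" where
  "pconst \<equiv> Poly_Mapping.single {#}"

abbreviation pvar :: "'v \<Rightarrow> ('v multiset \<Rightarrow>\<^sub>0 rat)" where
  "pvar a \<equiv> Poly_Mapping.single {#a#} 1"

lemma localized_polys_single:
  "c \<in> localized_rats N \<Longrightarrow> Poly_Mapping.single m c \<in> localized_polys N"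
  using localized_rats_of_int[of 0 N] by (auto simp: localized_polys_def lookup_single when_def)

lemma localized_polys_var: "pvar a \<in> localized_polys N"
  using localized_polys_single localized_rats_of_int[of 1 N] by simp

lemma localized_polys_add:
  "f \<in> localized_polys N \<Longrightarrow> g \<in> localized_polys N \<Longrightarrow> f + g \<in> localized_polys N"
  by (auto simp: localized_polys_def lookup_add intro: localized_rats_add)

lemma localized_polys_uminus: "f \<in> localized_polys N \<Longrightarrow> - f \<in> localized_polys N"
  by (auto simp: localized_polys_def intro: localized_rats_uminus)

lemma localized_polys_diff:
  "f \<in> localized_polys N \<Longrightarrow> g \<in> localized_polys N \<Longrightarrow> f - g \<in> localized_polys N"
  using localized_polys_add[OF _ localized_polys_uminus, of f N g] by simp

lemma localized_polys_zero: "0 \<in> localized_polys N"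
  using localized_rats_of_int[of 0 N] by (simp add: localized_polys_def)

lemma localized_polys_sum:
  "(\<And>i. i \<in> I \<Longrightarrow> f i \<in> localized_polys N) \<Longrightarrow> sum f I \<in> localized_polys N"
  by (induction I rule: infinite_finite_induct) (auto intro: localized_polys_add localized_polys_zero)

lemma poly_eq_sum_single: "f = (\<Sum>m\<in>Poly_Mapping.keys f. Poly_Mapping.single m (poly_mapping.lookup f m))"
proof (rule poly_mapping_eqI)
  fix k
  have "poly_mapping.lookup (\<Sum>m\<in>Poly_Mapping.keys f. Poly_Mapping.single m (poly_mapping.lookup f m)) k =
      (\<Sum>m\<in>Poly_Mapping.keys f. if m = k then poly_mapping.lookup f m else 0)"
    by (simp add: lookup_sum lookup_single when_def)
  also have "\<dots> = poly_mapping.lookup f k"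
    by (simp add: in_keys_iff)
  finally show "poly_mapping.lookup f k = poly_mapping.lookup (\<Sum>m\<in>Poly_Mapping.keys f. Poly_Mapping.single m (poly_mapping.lookup f m)) k" ..
qed

lemma pconst_inverse:
  fixes f :: "'v multiset \<Rightarrow>\<^sub>0 rat"
  assumes "n > 0"
  shows "of_nat n * (pconst (1 / of_nat n) * f) = f"
proof -
  have "of_nat n * pconst (1 / of_nat n) = (1 :: 'v multiset \<Rightarrow>\<^sub>0 rat)"
    using assms mult_single[of "{#}" "of_nat n" "{#}" "1 / of_nat n :: rat"] by simp
  then show ?thesis
    by (simp add: mult.assoc[symmetric])
qed

lemma localized_polys_mult:
  assumes "f \<in> localized_polys N" "g \<in> localized_polys N"
  shows "f * g \<in> localized_polys N"
proof -
  have "f * g = (\<Sum>m\<in>Poly_Mapping.keys f. \<Sum>n\<in>Poly_Mapping.keys g. Poly_Mapping.single (m + n) (poly_mapping.lookup f m * poly_mapping.lookup g n))"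
    by (subst poly_eq_sum_single[of f], subst poly_eq_sum_single[of g])
      (simp add: sum_product mult_single)
  also have "\<dots> \<in> localized_polys N"
    using assms
    by (intro localized_polys_sum localized_polys_single localized_rats_mult)
      (auto simp: localized_polys_def)
  finally show ?thesis .
qed

lemma localized_polys_one: "1 \<in> localized_polys N"
  using localized_polys_single[of 1 N "{#}"] localized_rats_of_int[of 1 N] by simp

lemma localized_polys_power: "f \<in> localized_polys N \<Longrightarrow> f ^ n \<in> localized_polys N"
  by (induction n) (auto intro: localized_polys_mult localized_polys_one)

lemma localized_polys_of_int: "of_int k \<in> localized_polys N"
  using localized_polys_single[of "of_int k" N "{#}"] localized_rats_of_int[of k N]
  by (simp add: single_of_int)

lemma localized_polys_UNIV: "localized_polys UNIV = UNIV"
  by (auto simp: localized_polys_def localized_rats_UNIV)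

lemma localized_polys_Inter:
  assumes "\<And>p. Factorial_Ring.prime p \<Longrightarrow> p \<notin> N \<Longrightarrow> f \<in> localized_polys (- {p})"
  shows "f \<in> localized_polys N"
  using assms unfolding localized_polys_def by (auto intro: localized_rats_Inter)

lemma localized_polys_monom_induct [consumes 1, case_names monom add]:
  assumes "f \<in> localized_polys N"
    and monom: "\<And>m c. c \<in> localized_rats N \<Longrightarrow> Q (Poly_Mapping.single m c)"
    and add: "\<And>f g. f \<in> localized_polys N \<Longrightarrow> g \<in> localized_polys N \<Longrightarrow> Q f \<Longrightarrow> Q g \<Longrightarrow> Q (f + g)"
  shows "Q f"
proof -
  have "Q (\<Sum>m\<in>K. Poly_Mapping.single m (poly_mapping.lookup f m))" if "finite K" for K
    using that
  proof induction
    case empty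
    then show ?case
      using monom[of 0 "{#}"] localized_rats_of_int[of 0 N] by simp
  next
    case (insert m K)
    have "poly_mapping.lookup f k \<in> localized_rats N" for k
      using assms(1) by (simp add: localized_polys_def)
    then show ?case
      using insert by (auto intro!: add monom localized_polys_sum localized_polys_single)
  qed
  then show ?thesis
    using poly_eq_sum_single[of f] finite_keys by metis
qed

text \<open>A monomial arises from its coefficient by multiplying with one variable at a time.
  Multiplicative and additive maps can thus be compared on constants and variables.\<close>

lemma localized_polys_induct [consumes 1, case_names const var add mult]:
  assumes "f \<in> localized_polys N"
    and const: "\<And>c. c \<in> localized_rats N \<Longrightarrow> Q (pconst c)"
    and var: "\<And>a. Q (pvar a)"
    and add: "\<And>f g. f \<in> localized_polys N \<Longrightarrow> g \<in> localized_polys N \<Longrightarrow> Q f \<Longrightarrow> Q g \<Longrightarrow> Q (f + g)"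
    and mult: "\<And>f g. f \<in> localized_polys N \<Longrightarrow> g \<in> localized_polys N \<Longrightarrow> Q f \<Longrightarrow> Q g \<Longrightarrow> Q (f * g)"
  shows "Q f"
  using assms(1)
proof (induction rule: localized_polys_monom_induct)
  case (monom m c)
  show ?case
  proof (induction m)
    case empty
    then show ?case
      using const monom by blast
  next
    case (add a m)
    have "Poly_Mapping.single (add_mset a m) c = pvar a * Poly_Mapping.single m c"
      by (simp add: mult_single)
    then show ?case
      using add mult var localized_polys_var localized_polys_single[OF monom] by metis
  qed
qed (rule add)

section \<open>Evaluation of polynomials\<close>

text \<open>Working form of being an algebra over \<open>\<int>[1/p : p \<in> N]\<close>, without a
  choice of scalar multiplication.\<close>

locale localized_cring = cring A for A (structure) +
  fixes N :: "nat set"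
  assumes prime_unit: "p \<in> N \<Longrightarrow> Factorial_Ring.prime p \<Longrightarrow> add_pow A p \<one> \<in> Units A"

context cring
begin

abbreviation int_image :: "int \<Rightarrow> 'a" where
  "int_image k \<equiv> add_pow R k \<one>"

lemma int_image_closed [simp]: "int_image k \<in> carrier R"
  by (rule add.int_pow_closed) simp

lemma int_image_add: "int_image (k + l) = int_image k \<oplus> int_image l"
  by (rule add.int_pow_mult) simp

lemma int_image_mult: "int_image (k * l) = int_image k \<otimes> int_image l"
  using add_pow_ldistr_int[of \<one> "int_image l" k] add.int_pow_pow[of \<one> k l]
  by (simp add: mult.commute)

lemma add_pow_int_image: "a \<in> carrier R \<Longrightarrow> add_pow R (k::int) a = int_image k \<otimes> a"
  using add_pow_ldistr_int[of \<one> a k] by simp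

lemma int_image_zero [simp]: "int_image 0 = \<zero>"
  by (simp add: add_pow_def)

lemma int_image_one [simp]: "int_image 1 = \<one>"
  using add.int_pow_1[of \<one>] by simp

lemma add_pow_nat_int: "add_pow R (n::nat) a = add_pow R (int n) a"
  by (simp add: add_pow_int_ge)

lemma m_interchange:
  "\<lbrakk>a \<in> carrier R; b \<in> carrier R; c \<in> carrier R; d \<in> carrier R\<rbrakk> \<Longrightarrow>
    (a \<otimes> b) \<otimes> (c \<otimes> d) = (a \<otimes> c) \<otimes> (b \<otimes> d)"
  by (simp add: m_ac)

lemma fraction_eqI:
  assumes "b \<in> Units R" "b' \<in> Units R" "a \<in> carrier R" "a' \<in> carrier R"
    and "a \<otimes> b' = a' \<otimes> b"
  shows "a \<otimes> inv b = a' \<otimes> inv b'"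
proof -
  have "a \<otimes> inv b = a \<otimes> inv b \<otimes> (b' \<otimes> inv b')"
    using assms(1-4) by (simp add: Units_r_inv)
  also have "\<dots> = (a \<otimes> b') \<otimes> (inv b \<otimes> inv b')"
    using assms(1-4) by (simp add: Units_closed m_ac)
  also have "\<dots> = a' \<otimes> inv b' \<otimes> (b \<otimes> inv b)"
    unfolding assms(5) using assms(1-4) by (simp add: Units_closed m_ac del: Units_r_inv)
  also have "\<dots> = a' \<otimes> inv b'"
    using assms(1-4) by (simp add: Units_r_inv)
  finally show ?thesis .
qed

end

context localized_cring
begin

lemma int_image_unit:
  assumes "b > 0" "\<And>p. Factorial_Ring.prime p \<Longrightarrow> p dvd b \<Longrightarrow> p \<in> N"
  shows "int_image (int b) \<in> Units A"
  using assms
proof (induction b rule: prime_divisors_induct)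
  case zero
  then show ?case
    by simp
next
  case (unit x)
  then show ?case
    by simp
next
  case (factor p x)
  then have "int_image (int p) \<in> Units A" "int_image (int x) \<in> Units A"
    using prime_unit[of p] by (auto simp: add_pow_nat_int)
  then show ?case
    by (simp add: int_image_mult)
qed

text \<open>Any fraction with denominator invertible in \<open>A\<close> may be chosen. The value
  thus depends on the ring alone, and so do all evaluations built from it;
  \<open>rat_image_eq\<close> shows by cross-multiplication that the choice does not matter.\<close>

definition rat_image :: "rat \<Rightarrow> 'a" where
  "rat_image c = (SOME z. \<exists>a b. b > 0 \<and> c = of_int a / of_nat b \<and>
     int_image (int b) \<in> Units A \<and> z = int_image a \<otimes> inv (int_image (int b)))"

lemma rat_image_eq:
  assumes "b > 0" "int_image (int b) \<in> Units A"
  shows "rat_image (of_int a / of_nat b) = int_image a \<otimes> inv (int_image (int b))"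
proof -
  have "\<exists>a' b'. b' > 0 \<and> (of_int a / of_nat b :: rat) = of_int a' / of_nat b' \<and>
      int_image (int b') \<in> Units A \<and>
      rat_image (of_int a / of_nat b) = int_image a' \<otimes> inv (int_image (int b'))"
    unfolding rat_image_def by (rule someI_ex) (use assms in blast)
  then obtain a' b' where *: "b' > 0" "(of_int a / of_nat b :: rat) = of_int a' / of_nat b'"
      "int_image (int b') \<in> Units A"
      "rat_image (of_int a / of_nat b) = int_image a' \<otimes> inv (int_image (int b'))"
    by blast
  have "(of_int (a' * int b) :: rat) = of_int (a * int b')"
    using *(1,2) assms(1) by (simp add: field_simps)
  then have "a' * int b = a * int b'"
    by (simp only: of_int_eq_iff)
  then show ?thesis
    unfolding *(4) using assms * by (intro fraction_eqI) (auto simp flip: int_image_mult)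
qed

lemma rat_imageE:
  assumes "c \<in> localized_rats N"
  obtains a b where "b > 0" "c = of_int a / of_nat b" "int_image (int b) \<in> Units A"
    "rat_image c = int_image a \<otimes> inv (int_image (int b))"
  using localized_ratsE[OF assms] int_image_unit rat_image_eq by metis

lemma rat_image_closed: "c \<in> localized_rats N \<Longrightarrow> rat_image c \<in> carrier A"
  by (erule rat_imageE) simp

lemma rat_image_of_int: "rat_image (of_int k) = int_image k"
  using rat_image_eq[of 1 k] by simp

lemma rat_image_mult:
  assumes "c \<in> localized_rats N" "d \<in> localized_rats N"
  shows "rat_image (c * d) = rat_image c \<otimes> rat_image d"
proof -
  obtain a b where 1: "b > 0" "c = of_int a / of_nat b" "int_image (int b) \<in> Units A"
    "rat_image c = int_image a \<otimes> inv (int_image (int b))"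
    using rat_imageE[OF assms(1)] by metis
  obtain a' b' where 2: "b' > 0" "d = of_int a' / of_nat b'" "int_image (int b') \<in> Units A"
    "rat_image d = int_image a' \<otimes> inv (int_image (int b'))"
    using rat_imageE[OF assms(2)] by metis
  have "rat_image (c * d) = rat_image (of_int (a * a') / of_nat (b * b'))"
    using 1 2 by simp
  also have "\<dots> = int_image (a * a') \<otimes> inv (int_image (int (b * b')))"
    using 1 2 by (intro rat_image_eq) (auto simp: int_image_mult)
  also have "\<dots> = (int_image a \<otimes> int_image a') \<otimes> (inv (int_image (int b)) \<otimes> inv (int_image (int b')))"
  proof -
    have "inv (int_image (int (b * b'))) = inv (int_image (int b)) \<otimes> inv (int_image (int b'))"
      using 1(3) 2(3) m_interchange[of "int_image (int b)" "int_image (int b')"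
        "inv (int_image (int b))" "inv (int_image (int b'))"]
      by (intro comm_inv_char) (auto simp: int_image_mult)
    then show ?thesis
      by (simp only: int_image_mult)
  qed
  also have "\<dots> = rat_image c \<otimes> rat_image d"
    unfolding 1(4) 2(4) using 1(3) 2(3) by (intro m_interchange) auto
  finally show ?thesis .
qed

lemma rat_image_add:
  assumes "c \<in> localized_rats N" "d \<in> localized_rats N"
  shows "rat_image (c + d) = rat_image c \<oplus> rat_image d"
proof -
  obtain a b where 1: "b > 0" "c = of_int a / of_nat b" "int_image (int b) \<in> Units A"
    "rat_image c = int_image a \<otimes> inv (int_image (int b))"
    using rat_imageE[OF assms(1)] by metis
  obtain a' b' where 2: "b' > 0" "d = of_int a' / of_nat b'" "int_image (int b') \<in> Units A"
    "rat_image d = int_image a' \<otimes> inv (int_image (int b'))"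
    using rat_imageE[OF assms(2)] by metis
  have u: "int_image (int (b * b')) \<in> Units A"
    using 1 2 by (auto simp: int_image_mult)
  have "rat_image (c + d) = rat_image (of_int (a * int b' + a' * int b) / of_nat (b * b'))"
    unfolding 1(2) 2(2) using 1(1) 2(1) by (simp add: field_simps)
  also have "\<dots> = int_image (a * int b' + a' * int b) \<otimes> inv (int_image (int (b * b')))"
    using 1 2 u by (intro rat_image_eq) auto
  also have "\<dots> = int_image (a * int b') \<otimes> inv (int_image (int (b * b'))) \<oplus>
      int_image (a' * int b) \<otimes> inv (int_image (int (b * b')))"
    using u by (simp add: int_image_add l_distr del: of_nat_mult)
  also have "int_image (a * int b') \<otimes> inv (int_image (int (b * b'))) = rat_image c"
    unfolding 1(4) using 1 2 u by (intro fraction_eqI) (auto simp flip: int_image_mult simp: ac_simps)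
  also have "int_image (a' * int b) \<otimes> inv (int_image (int (b * b'))) = rat_image d"
    unfolding 2(4) using 1 2 u by (intro fraction_eqI) (auto simp flip: int_image_mult simp: ac_simps)
  finally show ?thesis .
qed

text \<open>Folding requires commutation on the whole type, hence the guard.\<close>

definition monom_image :: "('v \<Rightarrow> 'a) \<Rightarrow> 'v multiset \<Rightarrow> 'a" where
  "monom_image v = fold_mset (\<lambda>a b. if b \<in> carrier A then v a \<otimes> b else b) \<one>"

definition poly_image :: "('v \<Rightarrow> 'a) \<Rightarrow> ('v multiset \<Rightarrow>\<^sub>0 rat) \<Rightarrow> 'a" where
  "poly_image v f = (\<Oplus>m\<in>Poly_Mapping.keys f. rat_image (poly_mapping.lookup f m) \<otimes> monom_image v m)"

context
  fixes v :: "'v \<Rightarrow> 'a"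
  assumes v: "\<And>a. v a \<in> carrier A"
begin

lemma comp_fun_commute_monom:
  "comp_fun_commute (\<lambda>a b. if b \<in> carrier A then v a \<otimes> b else b)"
  by unfold_locales (use v in \<open>auto simp: fun_eq_iff m_lcomm\<close>)

lemma monom_image_empty [simp]: "monom_image v {#} = \<one>"
  by (simp add: monom_image_def)

lemma monom_image_closed [simp]: "monom_image v m \<in> carrier A"
proof (induction m)
  case (add a m)
  then show ?case
    using v unfolding monom_image_def
    by (simp add: comp_fun_commute.fold_mset_add_mset[OF comp_fun_commute_monom])
qed simp

lemma monom_image_add_mset [simp]: "monom_image v (add_mset a m) = v a \<otimes> monom_image v m"
  using monom_image_closed[of m] unfolding monom_image_def
  by (simp add: comp_fun_commute.fold_mset_add_mset[OF comp_fun_commute_monom])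

lemma monom_image_add: "monom_image v (m + n) = monom_image v m \<otimes> monom_image v n"
  by (induction m) (auto simp: v m_assoc)

text \<open>Cancellation can shrink the support of a sum, so evaluations of several polynomials are
  compared over a common larger index set.\<close>

lemma poly_image_superset:
  assumes "f \<in> localized_polys N" "finite K" "Poly_Mapping.keys f \<subseteq> K"
  shows "poly_image v f = (\<Oplus>m\<in>K. rat_image (poly_mapping.lookup f m) \<otimes> monom_image v m)"
  unfolding poly_image_def
proof (rule add.finprod_mono_neutral_cong_left)
  show "rat_image (poly_mapping.lookup f m) \<otimes> monom_image v m = \<zero>" if "m \<in> K - Poly_Mapping.keys f" for m
    using that rat_image_of_int[of 0] by (simp add: in_keys_iff)
qed (use assms in \<open>auto simp: localized_polys_def rat_image_closed\<close>)

lemma poly_image_closed: "f \<in> localized_polys N \<Longrightarrow> poly_image v f \<in> carrier A"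
  unfolding poly_image_def
  by (rule finsum_closed) (auto simp: localized_polys_def rat_image_closed)

lemma poly_image_add:
  assumes "f \<in> localized_polys N" "g \<in> localized_polys N"
  shows "poly_image v (f + g) = poly_image v f \<oplus> poly_image v g"
proof -
  let ?K = "Poly_Mapping.keys f \<union> Poly_Mapping.keys g"
  have c: "rat_image (poly_mapping.lookup f m) \<in> carrier A" "rat_image (poly_mapping.lookup g m) \<in> carrier A" for m
    using assms by (auto simp: localized_polys_def rat_image_closed)
  have "poly_image v (f + g) = (\<Oplus>m\<in>?K. rat_image (poly_mapping.lookup (f + g) m) \<otimes> monom_image v m)"
    by (intro poly_image_superset localized_polys_add assms keys_add) simp
  also have "\<dots> = (\<Oplus>m\<in>?K. rat_image (poly_mapping.lookup f m) \<otimes> monom_image v m \<oplus> rat_image (poly_mapping.lookup g m) \<otimes> monom_image v m)"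
    using assms by (intro finsum_cong')
      (auto simp: lookup_add localized_polys_def rat_image_add rat_image_closed l_distr)
  also have "\<dots> = poly_image v f \<oplus> poly_image v g"
    using c poly_image_superset[OF assms(1), of ?K] poly_image_superset[OF assms(2), of ?K]
    by (subst finsum_addf) auto
  finally show ?thesis .
qed

lemma poly_image_single:
  assumes "c \<in> localized_rats N"
  shows "poly_image v (Poly_Mapping.single m c) = rat_image c \<otimes> monom_image v m"
  using poly_image_superset[OF localized_polys_single[OF assms], of "{m}" m] rat_image_closed[OF assms]
  by (simp add: lookup_single)

text \<open>Both sides are additive in each factor, which reduces the claim to two
  monomials.\<close>

lemma poly_image_mult:
  assumes "f \<in> localized_polys N" "g \<in> localized_polys N"
  shows "poly_image v (f * g) = poly_image v f \<otimes> poly_image v g"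
  using assms
proof (induction f rule: localized_polys_monom_induct)
  case (monom m c)
  from \<open>g \<in> localized_polys N\<close> show ?case
  proof (induction g rule: localized_polys_monom_induct)
    case (monom n d)
    with \<open>c \<in> localized_rats N\<close> show ?case
      by (simp add: mult_single poly_image_single localized_rats_mult rat_image_mult
          monom_image_add rat_image_closed m_ac)
  next
    case (add g h)
    then show ?case
      using \<open>c \<in> localized_rats N\<close>
      by (simp add: distrib_left poly_image_add localized_polys_mult localized_polys_single
          poly_image_closed r_distr)
  qed
next
  case (add f h)
  then show ?case
    by (simp add: distrib_right poly_image_add localized_polys_mult poly_image_closed l_distr)
qed

lemma poly_image_var: "poly_image v (pvar a) = v a"
  using poly_image_single[of 1 "{#a#}"] localized_rats_of_int[of 1 N] rat_image_of_int[of 1]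
  by (simp add: v)

lemma poly_image_const: "c \<in> localized_rats N \<Longrightarrow> poly_image v (pconst c) = rat_image c"
  by (simp add: poly_image_single rat_image_closed)

lemma poly_image_of_int: "poly_image v (of_int k) = int_image k"
  using poly_image_const[of "of_int k"] localized_rats_of_int[of k N] rat_image_of_int[of k]
  by (simp add: single_of_int)

lemma poly_image_power:
  assumes "f \<in> localized_polys N"
  shows "poly_image v (f ^ n) = poly_image v f [^] n"
proof (induction n)
  case 0
  then show ?case
    using poly_image_of_int[of 1] by simp
next
  case (Suc n)
  then show ?case
    using assms by (simp add: poly_image_mult localized_polys_power poly_image_closed m_comm mult.commute)
qed

lemma poly_image_sum:
  assumes "finite I" "\<And>i. i \<in> I \<Longrightarrow> f i \<in> localized_polys N"
  shows "poly_image v (sum f I) = (\<Oplus>i\<in>I. poly_image v (f i))"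
  using assms
proof induction
  case empty
  then show ?case
    using poly_image_of_int[of 0] by simp
next
  case (insert i I)
  then show ?case
    by (simp add: poly_image_add localized_polys_sum poly_image_closed Pi_def)
qed

end

end

lemma (in ring_hom_cring) hom_int_image: "h (R.int_image k) = S.int_image k"
proof -
  have nat: "h (R.int_image (int n)) = S.int_image (int n)" for n
    by (induction n) (auto simp: R.int_image_add S.int_image_add)
  show ?thesis
  proof (cases k rule: int_cases2)
    case (nonpos n)
    have "R.int_image k \<oplus> R.int_image (int n) = \<zero>"
      unfolding nonpos by (simp flip: R.int_image_add)
    then have "h (R.int_image k) \<oplus>\<^bsub>S\<^esub> S.int_image (int n) = \<zero>\<^bsub>S\<^esub>"
      using hom_add[of "R.int_image k" "R.int_image (int n)"] nat[of n] by simp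
    moreover have "S.int_image k \<oplus>\<^bsub>S\<^esub> S.int_image (int n) = \<zero>\<^bsub>S\<^esub>"
      unfolding nonpos by (simp flip: S.int_image_add)
    ultimately show ?thesis
      by (metis R.int_image_closed S.a_inv_closed S.add.inv_equality S.int_image_closed
          S.minus_minus hom_closed)
  qed (simp add: nat)
qed

text \<open>Both sides respect sums and products, so constants and variables suffice. For constants
  the point is that \<open>F\<close> carries inverses to inverses.\<close>

lemma poly_image_natural:
  assumes "localized_cring A N" "localized_cring B N" "F \<in> ring_hom A B"
    and v: "\<And>a. v a \<in> carrier A" and f: "f \<in> localized_polys N"
  shows "F (localized_cring.poly_image A v f) = localized_cring.poly_image B (\<lambda>a. F (v a)) f"
proof -
  interpret A: localized_cring A N by fact
  interpret B: localized_cring B N by fact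
  interpret ring_hom_cring A B F
    by (intro ring_hom_cring.intro ring_hom_cring_axioms.intro A.cring_axioms B.cring_axioms assms)
  have Fv: "F (v a) \<in> carrier B" for a
    using v by simp
  note simps = A.poly_image_closed[OF v] A.poly_image_const[OF v] A.poly_image_add[OF v]
    A.poly_image_mult[OF v] A.poly_image_var[OF v] B.poly_image_const[OF Fv]
    B.poly_image_add[OF Fv] B.poly_image_mult[OF Fv] B.poly_image_var[OF Fv]
  show ?thesis
    using f
  proof (induction f rule: localized_polys_induct)
    case (const c)
    obtain a b where ab: "b > 0" "c = of_int a / of_nat b" "A.int_image (int b) \<in> Units A"
      "A.rat_image c = A.int_image a \<otimes>\<^bsub>A\<^esub> inv\<^bsub>A\<^esub> (A.int_image (int b))"
      using A.rat_imageE[OF const] by metis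
    have 1: "B.int_image (int b) \<otimes>\<^bsub>B\<^esub> F (inv\<^bsub>A\<^esub> (A.int_image (int b))) = \<one>\<^bsub>B\<^esub>"
      using hom_mult[of "A.int_image (int b)" "inv\<^bsub>A\<^esub> (A.int_image (int b))"] ab(3)
      by (simp add: hom_int_image)
    then have 2: "inv\<^bsub>B\<^esub> (B.int_image (int b)) = F (inv\<^bsub>A\<^esub> (A.int_image (int b)))"
      using ab(3) by (intro B.comm_inv_char) auto
    have "F (inv\<^bsub>A\<^esub> (A.int_image (int b))) \<in> carrier B"
      using ab(3) by simp
    \<comment> \<open>The fraction used over \<open>A\<close> is therefore admissible over
      \<open>B\<close>, and \<open>rat_image_eq\<close> applies to it there.\<close>
    then have "B.int_image (int b) \<in> Units B"
      unfolding Units_def using 1 B.m_comm[OF B.int_image_closed, of _ "int b"] by force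
    then have "B.rat_image c = B.int_image a \<otimes>\<^bsub>B\<^esub> inv\<^bsub>B\<^esub> (B.int_image (int b))"
      unfolding ab(2) using B.rat_image_eq ab(1) by blast
    then have "F (A.rat_image c) = B.rat_image c"
      unfolding ab(4) 2 using ab(3) by (simp add: hom_int_image)
    then show ?case
      using const by (simp add: simps)
  qed (simp_all add: simps)
qed

section \<open>The polynomial ring as a target of evaluation, and its Frobenius lift\<close>

definition type_ring :: "'b::comm_ring_1 ring" where
  "type_ring = \<lparr>carrier = UNIV, monoid.mult = (*), monoid.one = 1, ring.zero = 0, ring.add = (+)\<rparr>"

lemma type_ring_simps [simp]:
  "carrier type_ring = UNIV" "monoid.mult type_ring = (*)" "monoid.one type_ring = 1"
  "ring.zero type_ring = 0" "ring.add type_ring = (+)"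
  by (simp_all add: type_ring_def)

lemma cring_type_ring: "cring (type_ring :: 'b::comm_ring_1 ring)"
proof (rule cringI)
  have "\<exists>y. y + x = 0" for x :: 'b
    by (rule exI[of _ "- x"]) simp
  then show "abelian_group (type_ring :: 'b ring)"
    by (intro abelian_groupI) (auto simp: ac_simps)
  show "comm_monoid (type_ring :: 'b ring)"
    by (intro comm_monoidI) (auto simp: ac_simps)
qed (auto simp: distrib_right)

lemma type_ring_int_image: "add_pow type_ring (k::int) 1 = (of_int k :: 'b::comm_ring_1)"
proof -
  interpret cring "type_ring :: 'b ring"
    by (rule cring_type_ring)
  have nat: "add_pow type_ring (int n) 1 = (of_nat n :: 'b)" for n
    using int_image_zero int_image_one by (induction n) (auto simp: int_image_add[simplified])
  show ?thesis
  proof (cases k rule: int_cases2)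
    case (nonpos n)
    have "add_pow type_ring k 1 + add_pow type_ring (int n) 1 = (0::'b)"
      using int_image_add[of k "int n"] int_image_zero by (simp add: nonpos)
    then show ?thesis
      by (simp add: nat nonpos eq_neg_iff_add_eq_0)
  qed (simp add: nat)
qed

text \<open>Every prime is invertible over the rationals; with \<open>UNIV\<close> as the set of
  inverted primes, all rational polynomials can be evaluated here.\<close>

lemma localized_cring_polys:
  "localized_cring (type_ring :: ('v multiset \<Rightarrow>\<^sub>0 rat) ring) UNIV"
proof -
  interpret cring "type_ring :: ('v multiset \<Rightarrow>\<^sub>0 rat) ring"
    by (rule cring_type_ring)
  show ?thesis
  proof unfold_locales
    fix p :: nat
    assume "Factorial_Ring.prime p"
    then have "pconst (of_nat p) * pconst (1 / of_nat p) = (1 :: 'v multiset \<Rightarrow>\<^sub>0 rat)"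
      using prime_gt_0_nat[of p] by (simp add: mult_single del: single_of_nat)
    then have "of_nat p * pconst (1 / of_nat p) = (1 :: 'v multiset \<Rightarrow>\<^sub>0 rat)"
      by (simp only: single_of_nat)
    then show "[p] \<cdot>\<^bsub>type_ring\<^esub> \<one>\<^bsub>type_ring\<^esub> \<in> Units (type_ring :: ('v multiset \<Rightarrow>\<^sub>0 rat) ring)"
      by (auto simp: Units_def add_pow_nat_int type_ring_int_image mult.commute[of _ "of_nat p"])
  qed
qed

text \<open>Substitution of \<open>X^p\<close> for \<open>X\<close> with fixed coefficients, as an
  evaluation in the polynomial ring itself.\<close>

definition frobenius :: "nat \<Rightarrow> ('v multiset \<Rightarrow>\<^sub>0 rat) \<Rightarrow> ('v multiset \<Rightarrow>\<^sub>0 rat)" where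
  "frobenius p = localized_cring.poly_image type_ring (\<lambda>a. pvar a ^ p)"

lemma frobenius_simps:
  fixes f g :: "'v multiset \<Rightarrow>\<^sub>0 rat" and a :: 'v
  shows "frobenius p (f + g) = frobenius p f + frobenius p g"
  "frobenius p (f * g) = frobenius p f * frobenius p g"
  "frobenius p (pvar a) = pvar a ^ p"
  "frobenius p (pconst c :: 'v multiset \<Rightarrow>\<^sub>0 rat) = pconst c"
proof -
  interpret localized_cring "type_ring :: ('v multiset \<Rightarrow>\<^sub>0 rat) ring" UNIV
    by (rule localized_cring_polys)
  have v: "pvar a ^ p \<in> carrier type_ring" for a :: 'v
    by simp
  show "frobenius p (f + g) = frobenius p f + frobenius p g"
    "frobenius p (f * g) = frobenius p f * frobenius p g"
    "frobenius p (pvar a) = pvar a ^ p"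
    unfolding frobenius_def
    using poly_image_add[where v = "\<lambda>a. pvar a ^ p", OF v] poly_image_mult[where v = "\<lambda>a. pvar a ^ p", OF v]
      poly_image_var[where v = "\<lambda>a. pvar a ^ p", OF v]
    by (simp_all add: localized_polys_UNIV)
  obtain a b where ab: "b > 0" "c = of_int a / of_nat b"
      "int_image (int b) \<in> Units type_ring"
      "rat_image c = int_image a \<otimes>\<^bsub>type_ring\<^esub> inv\<^bsub>type_ring\<^esub> (int_image (int b))"
    using rat_imageE[of c] unfolding localized_rats_UNIV by blast
  \<comment> \<open>The inverse of \<open>b\<close> in the polynomial ring is the constant
    \<open>1 / b\<close>, so rational coefficients evaluate to themselves.\<close>
  have "pconst (of_nat b) * pconst (1 / of_nat b) = (1 :: 'v multiset \<Rightarrow>\<^sub>0 rat)"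
    using ab(1) by (simp add: mult_single del: single_of_nat)
  then have "inv\<^bsub>type_ring\<^esub> (int_image (int b)) = (pconst (1 / of_nat b) :: 'v multiset \<Rightarrow>\<^sub>0 rat)"
    by (intro comm_inv_char) (auto simp: type_ring_int_image single_of_nat)
  then have "rat_image c = (pconst (of_int a) * pconst (1 / of_nat b) :: 'v multiset \<Rightarrow>\<^sub>0 rat)"
    using ab(4) by (simp add: type_ring_int_image single_of_int)
  then have "rat_image c = (pconst c :: 'v multiset \<Rightarrow>\<^sub>0 rat)"
    unfolding mult_single using ab(2) by simp
  then show "frobenius p (pconst c :: 'v multiset \<Rightarrow>\<^sub>0 rat) = pconst c"
    unfolding frobenius_def
    by (simp add: poly_image_const[where v = "\<lambda>a. pvar a ^ p", OF v] localized_rats_UNIV)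
qed

text \<open>The quotient by \<open>p\<close> is explicit because it will have to lie in the subring
  of \<open>p\<close>-integral polynomials. The division is exact: \<open>p\<close> divides the
  inner binomial coefficients.\<close>

lemma prime_dvd_power_add_diff:
  fixes x y :: "'b::comm_ring_1"
  assumes "Factorial_Ring.prime p"
  shows "(x + y) ^ p - (x ^ p + y ^ p) =
    of_nat p * (\<Sum>k=1..<p. of_nat ((p choose k) div p) * x ^ k * y ^ (p - k))"
proof -
  have p: "p > 1"
    using assms prime_gt_1_nat by blast
  have "(x + y) ^ p = (\<Sum>k\<le>p. of_nat (p choose k) * x ^ k * y ^ (p - k))"
    by (rule binomial_ring)
  also have "{..p} = insert 0 (insert p {1..<p})"
    using p by auto
  also have "(\<Sum>k\<in>\<dots>. of_nat (p choose k) * x ^ k * y ^ (p - k)) =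
      y ^ p + x ^ p + (\<Sum>k=1..<p. of_nat (p choose k) * x ^ k * y ^ (p - k))"
    using p by simp
  also have "(\<Sum>k=1..<p. of_nat (p choose k) * x ^ k * y ^ (p - k)) =
      (\<Sum>k=1..<p. of_nat p * (of_nat ((p choose k) div p) * x ^ k * y ^ (p - k)))"
  proof (rule sum.cong)
    fix k assume k: "k \<in> {1..<p}"
    then have "p dvd p choose k"
      using assms by (intro dvd_choose_prime) auto
    then have "of_nat (p choose k) = (of_nat p * of_nat ((p choose k) div p) :: 'b)"
      by (metis dvd_mult_div_cancel of_nat_mult)
    then show "of_nat (p choose k) * x ^ k * y ^ (p - k) =
        of_nat p * (of_nat ((p choose k) div p) * x ^ k * y ^ (p - k))"
      by (simp add: mult.assoc)
  qed simp
  finally show ?thesis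
    by (simp add: sum_distrib_left)
qed

lemma prime_dvd_power_diff_int:
  assumes "Factorial_Ring.prime p"
  shows "int p dvd a ^ p - a"
proof (cases "int p dvd a")
  case True
  then show ?thesis
    using prime_gt_0_nat[OF assms] by (intro dvd_diff) (auto simp: dvd_power_iff_le intro: dvd_trans[OF _ dvd_power])
next
  case False
  define n where "n = nat (a mod int p)"
  have n: "[a = int n] (mod int p)"
    unfolding n_def using prime_gt_0_nat[OF assms] by (simp add: cong_def)
  then have "\<not> p dvd n"
    using False by (metis cong_dvd_iff int_dvd_int_iff)
  then have "[n ^ (p - 1) * n = 1 * n] (mod p)"
    using fermat_theorem[OF assms] by (intro cong_mult cong_refl) auto
  then have "[n ^ p = n] (mod p)"
    using prime_gt_0_nat[OF assms] by (simp flip: power_Suc2)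
  then have "[int n ^ p = int n] (mod int p)"
    using cong_int_iff[of "n ^ p" n p] by simp
  then have "[a ^ p = a] (mod int p)"
    using n by (meson cong_pow cong_sym cong_trans)
  then show ?thesis
    by (simp add: cong_iff_dvd_diff)
qed

text \<open>For \<open>c = a / b\<close> the difference has denominator \<open>b^(p+1)\<close> and
  numerator \<open>a (b^p - b) - b (a^p - a)\<close>, which is divisible by \<open>p\<close> by
  Fermat.\<close>

lemma localized_rats_fermat:
  assumes p: "Factorial_Ring.prime p" and c: "c \<in> localized_rats (- {p})"
  shows "\<exists>d\<in>localized_rats (- {p}). c - c ^ p = of_nat p * d"
proof -
  obtain a b where ab: "c = of_int a / of_nat b" "b > 0"
    "\<And>p'. Factorial_Ring.prime p' \<Longrightarrow> p' dvd b \<Longrightarrow> p' \<in> - {p}"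
    using localized_ratsE[OF c] by metis
  have "int p dvd a * ((int b) ^ p - int b) - int b * (a ^ p - a)"
    by (intro dvd_diff dvd_mult prime_dvd_power_diff_int p)
  then obtain k where k: "a * int b ^ p - int b * a ^ p = int p * k"
    by (auto simp: algebra_simps dvd_def)
  have "c - c ^ p = of_int (a * int b ^ p - int b * a ^ p) / of_nat (b * b ^ p)"
    unfolding ab(1) using ab(2) by (simp add: field_simps power_divide)
  also have "\<dots> = of_nat p * (of_int k / of_nat (b ^ Suc p))"
    unfolding k by simp
  finally have "c - c ^ p = of_nat p * (of_int k / of_nat (b ^ Suc p))" .
  moreover have "of_int k / of_nat (b ^ Suc p) \<in> localized_rats (- {p})"
    using ab(2,3) by (intro localized_ratsI) (auto dest: prime_dvd_power simp del: power_Suc)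
  ultimately show ?thesis
    by blast
qed

lemma single_power_empty: "pconst c ^ n = pconst (c ^ n)"
  by (induction n) (auto simp: mult_single)

text \<open>The congruence with the \<open>p\<close>-th power is stable under sums, by the binomial
  theorem, and under products. On variables it is an equality, on constants it is Fermat's
  theorem.\<close>

lemma frobenius_lift_polys:
  assumes p: "Factorial_Ring.prime p"
  shows "frobenius_lift (localized_polys (- {p}) :: ('v multiset \<Rightarrow>\<^sub>0 rat) set) p (frobenius p)"
proof
  let ?S = "localized_polys (- {p}) :: ('v multiset \<Rightarrow>\<^sub>0 rat) set"
  show "frobenius p f \<in> ?S" if "f \<in> ?S" for f
    using that
    by (induction f rule: localized_polys_induct)
      (auto simp: frobenius_simps intro: localized_polys_single localized_polys_power
        localized_polys_var localized_polys_add localized_polys_mult)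
  have c: "frobenius p (pconst 1 :: 'v multiset \<Rightarrow>\<^sub>0 rat) = pconst 1"
    by (rule frobenius_simps)
  then show "frobenius p (1 :: 'v multiset \<Rightarrow>\<^sub>0 rat) = 1"
    by simp
  have p_mult: "\<exists>s\<in>?S. x = of_nat p * s" if "x = of_nat p * s" "s \<in> ?S" for x s
    using that by blast
  show "\<exists>s\<in>?S. frobenius p f - f ^ p = of_nat p * s" if "f \<in> ?S" for f
    using that
  proof (induction f rule: localized_polys_induct)
    case (const c)
    then obtain d where d: "d \<in> localized_rats (- {p})" "c - c ^ p = of_nat p * d"
      using localized_rats_fermat[OF p] by blast
    have "frobenius p (pconst c) - pconst c ^ p = (of_nat p * pconst d :: 'v multiset \<Rightarrow>\<^sub>0 rat)"
      unfolding frobenius_simps single_power_empty single_diff[symmetric] d(2)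
      by (simp add: mult_single flip: single_of_nat)
    then show ?case
      using localized_polys_single[OF d(1)] by blast
  next
    case (var a)
    show ?case
      using localized_polys_zero by (intro bexI[of _ 0]) (auto simp: frobenius_simps)
  next
    case (add f g)
    then obtain s t where st: "s \<in> ?S" "t \<in> ?S" "frobenius p f - f ^ p = of_nat p * s"
      "frobenius p g - g ^ p = of_nat p * t"
      by blast
    let ?u = "\<Sum>k=1..<p. of_nat ((p choose k) div p) * f ^ k * g ^ (p - k)"
    have "of_nat k \<in> ?S" for k
      using localized_polys_of_int[of "int k"] by simp
    then have "?u \<in> ?S"
      using add by (intro localized_polys_sum localized_polys_mult localized_polys_power)
        (auto intro: localized_polys_one)
    moreover have "frobenius p (f + g) - (f + g) ^ p = of_nat p * (s + t - ?u)"
      using st(3,4) prime_dvd_power_add_diff[OF p, of f g]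
      by (simp add: frobenius_simps algebra_simps)
    ultimately show ?case
      using st by (blast intro: localized_polys_diff localized_polys_add)
  next
    case (mult f g)
    then obtain s t where st: "s \<in> ?S" "t \<in> ?S" "frobenius p f - f ^ p = of_nat p * s"
      "frobenius p g - g ^ p = of_nat p * t"
      by blast
    have "frobenius p (f * g) - (f * g) ^ p = of_nat p * (s * frobenius p g + f ^ p * t)"
    proof -
      have "frobenius p (f * g) - (f * g) ^ p =
          (frobenius p f - f ^ p) * frobenius p g + f ^ p * (frobenius p g - g ^ p)"
        by (simp add: frobenius_simps algebra_simps power_mult_distrib)
      then show ?thesis
        unfolding st by (simp add: algebra_simps)
    qed
    moreover have "frobenius p g \<in> ?S"
    proof -
      have "of_nat p * t + g ^ p \<in> ?S"
        using localized_polys_of_int[of "int p"] mult st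
        by (auto intro!: localized_polys_add localized_polys_mult localized_polys_power)
      then show ?thesis
        using st(4) by (simp add: algebra_simps)
    qed
    ultimately show ?case
      using st mult by (blast intro: localized_polys_add localized_polys_mult localized_polys_power)
  qed
qed (use p in \<open>auto simp: frobenius_simps intro: localized_polys_one localized_polys_diff localized_polys_mult\<close>)

section \<open>Open subgroups\<close>

lemma index_eq_card_cosets:
  fixes G :: "'g monoid"
  shows "index G V U = card (r_coset G U ` V)"
proof -
  have "rcosets\<^bsub>G\<lparr>carrier := V\<rparr>\<^esub> U = r_coset G U ` V"
    by (auto simp: RCOSETS_def r_coset_def)
  then show ?thesis
    by (simp add: index_def)
qed

section \<open>Cosets and multiplicativity of the index\<close>

context group
begin

lemma r_coset_eq_iff:
  assumes "subgroup U G" "x \<in> carrier G" "y \<in> carrier G"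
  shows "U #> x = U #> y \<longleftrightarrow> x \<in> U #> y"
  using assms repr_independence rcos_self by metis

lemma mem_of_mem_r_coset:
  assumes "subgroup V G" "U \<subseteq> V" "v \<in> V" "x \<in> U #> v"
  shows "x \<in> V"
  using assms subgroup.m_closed by (fastforce simp: r_coset_def)

text \<open>Sort the \<open>U\<close>-cosets in \<open>W\<close> by the \<open>V\<close>-coset
  containing them. Right translation by \<open>g\<close> matches the \<open>U\<close>-cosets in
  \<open>V\<close> with those in the coset of \<open>g\<close>, so all classes have the same
  size.\<close>

lemma card_cosets_mult:
  assumes U: "subgroup U G" and V: "subgroup V G" and W: "subgroup W G"
    and "U \<subseteq> V" "V \<subseteq> W" and fin: "finite ((#>) U ` W)"
  shows "card ((#>) U ` W) = card ((#>) V ` W) * card ((#>) U ` V)"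
proof -
  note carr = subgroup.mem_carrier[OF U] subgroup.mem_carrier[OF V] subgroup.mem_carrier[OF W]
  have UG: "U \<subseteq> carrier G"
    using U subgroup.subset by blast
  have coset: "V #> g = {v \<otimes> g | v. v \<in> V}" for g
    by (auto simp: r_coset_def)
  have in_W: "V #> g \<subseteq> W" if "g \<in> W" for g
    using mem_of_mem_r_coset[OF W \<open>V \<subseteq> W\<close> that] by blast
  have eq: "(#>) U ` W = (\<Union>c\<in>(#>) V ` W. (#>) U ` c)"
    using in_W rcos_self[OF _ V] carr(3) by (auto simp: image_iff) blast+
  have fin_c: "finite ((#>) U ` c)" if "c \<in> (#>) V ` W" for c
  proof -
    have "c \<subseteq> W"
      using in_W that by blast
    then show ?thesis
      using fin by (meson finite_subset image_mono)
  qed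
  have card_c: "card ((#>) U ` c) = card ((#>) U ` V)" if c: "c \<in> (#>) V ` W" for c
  proof -
    obtain g where g: "g \<in> W" "c = V #> g"
      using c by blast
    have "(#>) U ` c = (\<lambda>K. K #> g) ` (#>) U ` V"
      using carr g UG by (auto simp: coset coset_mult_assoc image_iff)
    moreover have "inj_on (\<lambda>K. K #> g) ((#>) U ` V)"
    proof (rule inj_on_inverseI)
      fix K assume "K \<in> (#>) U ` V"
      then have "K \<subseteq> carrier G"
        using carr UG r_coset_subset_G by blast
      then show "K #> g #> inv g = K"
        using g carr by (simp add: coset_mult_assoc)
    qed
    ultimately show ?thesis
      by (simp add: card_image)
  qed
  have "card ((#>) U ` W) = (\<Sum>c\<in>(#>) V ` W. card ((#>) U ` c))"
    unfolding eq
  proof (rule card_UN_disjoint)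
    \<comment> \<open>The \<open>V\<close>-cosets are the images of the \<open>U\<close>-cosets
      under saturation by \<open>V\<close>, hence finite in number.\<close>
    have "(#>) V ` W = (\<lambda>K. \<Union>x\<in>K. V #> x) ` (#>) U ` W"
    proof -
      have "V #> x = (\<Union>y\<in>U #> x. V #> y)" if "x \<in> W" for x
      proof -
        have "V #> y = V #> x" if "y \<in> U #> x" for y
          using that \<open>x \<in> W\<close> \<open>U \<subseteq> V\<close> carr repr_independence[OF _ _ V, of y x]
          by (auto simp: r_coset_def)
        moreover have "x \<in> U #> x"
          using rcos_self[OF _ U] that carr by blast
        ultimately show ?thesis
          by blast
      qed
      then show ?thesis
        by (force simp: image_image)
    qed
    then show "finite ((#>) V ` W)"
      using fin by simp
    show "\<forall>c\<in>(#>) V ` W. finite ((#>) U ` c)"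
      using fin_c by blast
    show "\<forall>c\<in>(#>) V ` W. \<forall>d\<in>(#>) V ` W. c \<noteq> d \<longrightarrow> (#>) U ` c \<inter> (#>) U ` d = {}"
    proof (intro ballI impI)
      fix c d assume cd: "c \<in> (#>) V ` W" "d \<in> (#>) V ` W" "c \<noteq> d"
      then obtain g h where gh: "g \<in> W" "h \<in> W" "c = V #> g" "d = V #> h"
        by blast
      have False if "x \<in> c" "y \<in> d" "U #> x = U #> y" for x y
      proof -
        have xy: "x \<in> carrier G" "y \<in> carrier G"
          using that(1,2) gh in_W carr by blast+
        then have "x \<in> U #> y"
          using that(3) r_coset_eq_iff[OF U] by blast
        then have "x \<in> V #> y"
          using \<open>U \<subseteq> V\<close> by (auto simp: r_coset_def)
        then have "V #> x = V #> y"
          using r_coset_eq_iff[OF V] xy by blast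
        moreover have "V #> x = c" "V #> y = d"
          using that(1,2) gh xy carr r_coset_eq_iff[OF V] by blast+
        ultimately show False
          using cd by blast
      qed
      then show "(#>) U ` c \<inter> (#>) U ` d = {}"
        by blast
    qed
  qed
  also have "\<dots> = card ((#>) V ` W) * card ((#>) U ` V)"
    using card_c by simp
  finally show ?thesis .
qed

end

text \<open>The definitions of open subgroups and of the index take an unextended monoid record.\<close>

locale profinite = abelian_profinite_group G T for G :: "'g monoid" (structure) and T
begin

abbreviation overgroups :: "'g set \<Rightarrow> 'g set set" where
  "overgroups U \<equiv> {V \<in> open_subgroups G T. U \<subseteq> V}"

lemma open_subgroupsD:
  assumes "U \<in> open_subgroups G T"
  shows "subgroup U G" "openin T U"
  using assms by (auto simp: open_subgroups_def)

lemma carrier_open_subgroup: "carrier G \<in> open_subgroups G T"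
  using subgroup_self topspace_eq openin_topspace[of T] by (auto simp: open_subgroups_def)

text \<open>The coset is the preimage of \<open>U\<close> under the continuous translation by
  \<open>inv x\<close>.\<close>

lemma openin_r_coset:
  assumes U: "U \<in> open_subgroups G T" and x: "x \<in> carrier G"
  shows "openin T (U #> x)"
proof -
  have "continuous_map T (prod_topology T T) (\<lambda>y. (y, inv x))"
    using x topspace_eq by (auto simp: continuous_map_pairedI)
  then have "continuous_map T T ((\<lambda>(x, y). x \<otimes> y) \<circ> (\<lambda>y. (y, inv x)))"
    using continuous_map_compose continuous_mult by blast
  then have "openin T {y \<in> topspace T. ((\<lambda>(x, y). x \<otimes> y) \<circ> (\<lambda>y. (y, inv x))) y \<in> U}"
    using openin_continuous_map_preimage open_subgroupsD(2)[OF U] by blast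
  moreover have "{y \<in> topspace T. ((\<lambda>(x, y). x \<otimes> y) \<circ> (\<lambda>y. (y, inv x))) y \<in> U} = U #> x"
  proof (intro equalityI subsetI; clarify)
    fix y assume "y \<in> topspace T" "((\<lambda>(x, y). x \<otimes> y) \<circ> (\<lambda>y. (y, inv x))) y \<in> U"
    then show "y \<in> U #> x"
      using x topspace_eq inv_solve_right'[of "y \<otimes> inv x" y x]
      by (auto simp: r_coset_def m_assoc intro!: bexI[of _ "y \<otimes> inv x"])
  next
    fix y assume "y \<in> U #> x"
    then show "y \<in> topspace T \<and> ((\<lambda>(x, y). x \<otimes> y) \<circ> (\<lambda>y. (y, inv x))) y \<in> U"
      using x topspace_eq subgroup.mem_carrier[OF open_subgroupsD(1)[OF U]]
      by (auto simp: r_coset_def m_assoc)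
  qed
  ultimately show ?thesis
    by simp
qed

text \<open>The cosets are an open cover of a compact space. As they are pairwise disjoint, a finite
  subcover must contain them all.\<close>

lemma finite_cosets:
  assumes U: "U \<in> open_subgroups G T"
  shows "finite ((#>) U ` carrier G)"
proof -
  note sub = open_subgroupsD(1)[OF U]
  have "compactin T (carrier G)"
    using compact topspace_eq by (simp add: compact_space_def)
  moreover have "\<forall>c\<in>(#>) U ` carrier G. openin T c"
    using openin_r_coset[OF U] by blast
  moreover have "carrier G \<subseteq> \<Union>((#>) U ` carrier G)"
    using rcos_self[OF _ sub] by blast
  ultimately obtain F where F: "finite F" "F \<subseteq> (#>) U ` carrier G" "carrier G \<subseteq> \<Union>F"
    unfolding compactin_def by meson
  have "(#>) U ` carrier G \<subseteq> F"
  proof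
    fix c assume "c \<in> (#>) U ` carrier G"
    then obtain x where x: "x \<in> carrier G" "c = U #> x"
      by blast
    then obtain d where d: "d \<in> F" "x \<in> d"
      using F(3) by auto
    then obtain y where y: "y \<in> carrier G" "d = U #> y"
      using F(2) by auto
    then have "U #> x = U #> y"
      using r_coset_eq_iff[OF sub x(1) y(1)] d by blast
    then show "c \<in> F"
      using x y d by simp
  qed
  then show ?thesis
    using F(1) finite_subset by blast
qed

lemma finite_cosets':
  assumes "U \<in> open_subgroups G T" "subgroup V G"
  shows "finite ((#>) U ` V)"
  using finite_cosets[OF assms(1)] subgroup.subset[OF assms(2)] by (meson finite_subset image_mono)

lemma Union_cosets:
  assumes "subgroup U G" "subgroup V G" "U \<subseteq> V"
  shows "\<Union>((#>) U ` V) = V"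
  using mem_of_mem_r_coset[OF assms(2,3)] rcos_self[OF _ assms(1)] subgroup.mem_carrier[OF assms(2)]
  by blast

lemma overgroup_open:
  assumes "U \<in> open_subgroups G T" "subgroup V G" "U \<subseteq> V"
  shows "V \<in> open_subgroups G T"
proof -
  have "openin T (\<Union>((#>) U ` V))"
    using openin_r_coset[OF assms(1)] subgroup.mem_carrier[OF assms(2)] by blast
  then show ?thesis
    using Union_cosets[OF open_subgroupsD(1)[OF assms(1)] assms(2,3)] assms(2)
    by (simp add: open_subgroups_def)
qed

text \<open>An overgroup is the union of its \<open>U\<close>-cosets, hence is determined by a
  subset of a finite set.\<close>

lemma finite_overgroups:
  assumes "U \<in> open_subgroups G T"
  shows "finite (overgroups U)"
proof (rule finite_imageD)
  have "(\<lambda>V. (#>) U ` V) ` overgroups U \<subseteq> Pow ((#>) U ` carrier G)"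
    using open_subgroupsD(1) subgroup.subset by blast
  then show "finite ((\<lambda>V. (#>) U ` V) ` overgroups U)"
    using finite_cosets[OF assms] by (meson finite_Pow_iff finite_subset)
  show "inj_on (\<lambda>V. (#>) U ` V) (overgroups U)"
    using Union_cosets[OF open_subgroupsD(1)[OF assms]] open_subgroupsD(1)
    by (intro inj_on_inverseI[where g = Union]) blast
qed

lemma index_mult:
  assumes "U \<in> open_subgroups G T" "V \<in> overgroups U" "W \<in> overgroups V"
  shows "index G W U = index G W V * index G V U"
  unfolding index_eq_card_cosets using assms open_subgroupsD(1) finite_cosets'
  by (intro card_cosets_mult) auto

lemma index_pos:
  assumes "U \<in> open_subgroups G T" "V \<in> open_subgroups G T"
  shows "index G V U > 0"
  unfolding index_eq_card_cosets
  using finite_cosets'[OF assms(1) open_subgroupsD(1)[OF assms(2)]]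
    subgroup.one_closed[OF open_subgroupsD(1)[OF assms(2)]]
  by (auto simp: card_gt_0_iff)

lemma index_eq_1_iff:
  assumes "U \<in> open_subgroups G T" "V \<in> overgroups U"
  shows "index G V U = 1 \<longleftrightarrow> V = U"
proof
  assume "index G V U = 1"
  then obtain c where "(#>) U ` V = {c}"
    unfolding index_eq_card_cosets by (auto simp: card_1_singleton_iff)
  moreover have "U #> \<one> = U"
    using open_subgroupsD(1)[OF assms(1)] coset_mult_one subgroup.subset by blast
  moreover have "\<one> \<in> V"
    using assms(2) open_subgroupsD(1) subgroup.one_closed by blast
  ultimately have "(#>) U ` V = {U}"
    by (metis imageI singletonD)
  then show "V = U"
    using Union_cosets[of U V] assms open_subgroupsD(1) by auto
next
  assume "V = U"
  have "(#>) U ` U = {U}"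
    using open_subgroupsD(1)[OF assms(1)] coset_join2 subgroup.mem_carrier subgroup.one_closed
    by (metis (no_types, lifting) imageI image_subsetI insertI1 subset_singletonD empty_iff)
  then show "index G V U = 1"
    unfolding index_eq_card_cosets \<open>V = U\<close> by simp
qed

lemma index_strict:
  assumes "U \<in> open_subgroups G T" "V \<in> open_subgroups G T" "U \<subset> V"
  shows "index G (carrier G) V < index G (carrier G) U"
proof -
  have V: "V \<in> overgroups U" and G: "carrier G \<in> overgroups V"
    using assms carrier_open_subgroup subgroup.subset[OF open_subgroupsD(1)[OF assms(2)]] by auto
  have "index G (carrier G) U = index G (carrier G) V * index G V U"
    by (rule index_mult[OF assms(1) V G])
  moreover have "index G V U \<noteq> 1"
    using index_eq_1_iff[OF assms(1) V] assms(3) by blast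
  moreover have "index G V U > 0" "index G (carrier G) V > 0"
    using index_pos assms(1,2) carrier_open_subgroup by auto
  ultimately show ?thesis
    by simp
qed

text \<open>The index in \<open>G\<close> drops when the subgroup grows. Induction and recursion
  therefore run from \<open>G\<close> downwards, the larger subgroup coming first.\<close>

lemma wf_open_subgroups:
  "wf {(V, U). U \<in> open_subgroups G T \<and> V \<in> open_subgroups G T \<and> U \<subset> V}"
  by (rule wf_subset[OF wf_measure[of "index G (carrier G)"]]) (auto intro: index_strict)

lemma open_subgroup_induct [consumes 1, case_names less]:
  assumes "U \<in> open_subgroups G T"
    and "\<And>U. U \<in> open_subgroups G T \<Longrightarrow>
      (\<And>V. V \<in> open_subgroups G T \<Longrightarrow> U \<subset> V \<Longrightarrow> Q V) \<Longrightarrow> Q U"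
  shows "Q U"
  using assms(1)
proof (induction "index G (carrier G) U" arbitrary: U rule: less_induct)
  case less
  show ?case
    by (rule assms(2)[OF less.prems]) (use less index_strict in blast)
qed

text \<open>The subgroup \<open>\<langle>g\<rangle>U\<close>: \<open>g\<close> is an element of the
  quotient by \<open>U\<close>, and the preimage of the cyclic group it generates is taken.\<close>

definition cyclic_overgroup :: "'g set \<Rightarrow> 'g set \<Rightarrow> 'g set" where
  "cyclic_overgroup U g = {x \<in> carrier G. U #> x \<in> generate (G Mod U) {g}}"

section \<open>Quotients by open subgroups and their cyclic subgroups\<close>

context
  fixes U
  assumes U: "U \<in> open_subgroups G T"
begin

lemma normal_U: "U \<lhd> G"
  using subgroup_imp_normal open_subgroupsD(1)[OF U] by blast

lemma group_Mod: "comm_group (G Mod U)"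
  using abelian_FactGroup open_subgroupsD(1)[OF U] by blast

lemma carrier_Mod: "carrier (G Mod U) = (#>) U ` carrier G"
  by (auto simp: FactGroup_def RCOSETS_def)

lemma finite_Mod: "finite (carrier (G Mod U))"
  unfolding carrier_Mod using finite_cosets[OF U] .

lemma hom_Mod: "group_hom G (G Mod U) ((#>) U)"
  using normal.r_coset_hom_Mod[OF normal_U] group_Mod
  by (simp add: group_hom_def group_hom_axioms_def comm_group.axioms)

lemma subgroup_Mod: "subgroup V G \<Longrightarrow> subgroup ((#>) U ` V) (G Mod U)"
  using group_hom.subgroup_img_is_subgroup[OF hom_Mod] by blast

lemma card_subgroup_Mod: "card ((#>) U ` V) = index G V U"
  by (simp add: index_eq_card_cosets)

context
  fixes g
  assumes g: "g \<in> carrier (G Mod U)"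
begin

interpretation H: comm_group "G Mod U"
  by (rule group_Mod)

interpretation h: group_hom G "G Mod U" "(#>) U"
  by (rule hom_Mod)

lemma subgroup_generate: "subgroup (generate (G Mod U) {g}) (G Mod U)"
  using H.generate_is_subgroup g by blast

lemma cosets_cyclic_overgroup: "(#>) U ` cyclic_overgroup U g = generate (G Mod U) {g}"
  using subgroup.subset[OF subgroup_generate] carrier_Mod by (auto simp: cyclic_overgroup_def)

lemma cyclic_overgroup_in: "cyclic_overgroup U g \<in> overgroups U"
proof -
  have "subgroup (cyclic_overgroup U g) G"
  proof (rule subgroupI)
    show "cyclic_overgroup U g \<subseteq> carrier G"
      by (auto simp: cyclic_overgroup_def)
    show "cyclic_overgroup U g \<noteq> {}"
      using subgroup.one_closed[OF subgroup_generate] h.hom_one by (auto simp: cyclic_overgroup_def)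
    show "inv x \<in> cyclic_overgroup U g" if "x \<in> cyclic_overgroup U g" for x
      using that subgroup.m_inv_closed[OF subgroup_generate] by (auto simp: cyclic_overgroup_def)
    show "x \<otimes> y \<in> cyclic_overgroup U g"
      if "x \<in> cyclic_overgroup U g" "y \<in> cyclic_overgroup U g" for x y
      using that subgroup.m_closed[OF subgroup_generate] by (auto simp: cyclic_overgroup_def)
  qed
  moreover have "U \<subseteq> cyclic_overgroup U g"
  proof
    fix x assume "x \<in> U"
    then have "x \<in> carrier G" "U #> x = \<one>\<^bsub>G Mod U\<^esub>"
      using open_subgroupsD(1)[OF U] subgroup.mem_carrier[of U G x] coset_join2[of x U]
      by simp_all
    then show "x \<in> cyclic_overgroup U g"
      using subgroup.one_closed[OF subgroup_generate] by (simp add: cyclic_overgroup_def)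
  qed
  ultimately show ?thesis
    using overgroup_open[OF U] by blast
qed

text \<open>This is what allows the double sum over elements \<open>g\<close> and overgroups of
  \<open>\<langle>g\<rangle>U\<close> to be rearranged by overgroups \<open>V\<close> of
  \<open>U\<close> and elements of the image of \<open>V\<close>.\<close>

lemma cyclic_overgroup_subset_iff:
  assumes "V \<in> overgroups U"
  shows "cyclic_overgroup U g \<subseteq> V \<longleftrightarrow> g \<in> (#>) U ` V"
proof
  assume "cyclic_overgroup U g \<subseteq> V"
  moreover have "g \<in> (#>) U ` cyclic_overgroup U g"
    unfolding cosets_cyclic_overgroup by (simp add: generate.incl)
  ultimately show "g \<in> (#>) U ` V"
    by blast
next
  have V: "subgroup V G" "U \<subseteq> V"
    using assms open_subgroupsD(1) by auto
  assume "g \<in> (#>) U ` V"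
  then have "generate (G Mod U) {g} \<subseteq> (#>) U ` V"
    using H.generate_subgroup_incl[OF _ subgroup_Mod[OF V(1)]] by blast
  then have "(#>) U ` cyclic_overgroup U g \<subseteq> (#>) U ` V"
    unfolding cosets_cyclic_overgroup .
  then show "cyclic_overgroup U g \<subseteq> V"
    using Union_cosets[OF open_subgroupsD(1)[OF U], of V] V
      Union_cosets[OF open_subgroupsD(1)[OF U], of "cyclic_overgroup U g"]
      cyclic_overgroup_in open_subgroupsD(1)
    by (metis (no_types, lifting) Sup_subset_mono mem_Collect_eq)
qed

lemma index_cyclic_overgroup: "index G (cyclic_overgroup U g) U = H.ord g"
  unfolding card_subgroup_Mod[symmetric] cosets_cyclic_overgroup
  using H.generate_pow_card[OF g] by simp

lemma index_over_cyclic_overgroup: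
  assumes "V \<in> overgroups (cyclic_overgroup U g)"
  shows "index G V (cyclic_overgroup U g) = index G V U div H.ord g"
  using index_mult[OF U cyclic_overgroup_in assms] index_cyclic_overgroup
    index_pos[OF U, of "cyclic_overgroup U g"] cyclic_overgroup_in
  by simp

lemma cyclic_overgroup_eq_iff: "cyclic_overgroup U g = U \<longleftrightarrow> g = \<one>\<^bsub>G Mod U\<^esub>"
  using index_eq_1_iff[OF U cyclic_overgroup_in] index_cyclic_overgroup H.ord_eq_1[OF g] by simp

end

end

end

section \<open>The polynomials defining the strict isomorphism\<close>

text \<open>The formula of \<open>ghost_map\<close> over a type-class ring, so that it can be
  applied to polynomials.\<close>

definition (in profinite) ghost :: "int \<Rightarrow> ('g set \<Rightarrow> 'b::comm_ring_1) \<Rightarrow> 'g set \<Rightarrow> 'b" where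
  "ghost k z U = (\<Sum>V\<in>overgroups U.
     of_int (int (index G (carrier G) V) * k ^ (index G V U - 1)) * z V ^ index G V U)"

context profinite
begin

lemma carrier_overgroup: "U \<in> open_subgroups G T \<Longrightarrow> carrier G \<in> overgroups U"
  using carrier_open_subgroup subgroup.subset[OF open_subgroupsD(1)] by auto

text \<open>The index is positive, so the extra factor \<open>q\<close> completes
  \<open>q^((V:U)-1)\<close> to a full power. This reduces general \<open>q\<close> to
  \<open>q = 1\<close>.\<close>

lemma of_int_mult_ghost:
  assumes "U \<in> open_subgroups G T"
  shows "of_int q * ghost q z U = ghost 1 (\<lambda>V. of_int q * z V) U"
  unfolding ghost_def sum_distrib_left
proof (rule sum.cong)
  fix V assume "V \<in> overgroups U"
  then obtain n where "index G V U = Suc n"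
    using index_pos[OF assms] gr0_conv_Suc by blast
  then show "of_int q * (of_int (int (index G (carrier G) V) * q ^ (index G V U - 1)) * z V ^ index G V U) =
      of_int (int (index G (carrier G) V) * 1 ^ (index G V U - 1)) * (of_int q * z V) ^ index G V U"
    by (simp add: power_mult_distrib ac_simps)
qed simp

text \<open>Since \<open>(U:U) = 1\<close>, the summand at \<open>V = U\<close> is linear in
  \<open>z U\<close> with coefficient \<open>(G:U)\<close>, and replacing \<open>z U\<close> by 0
  removes exactly that summand.\<close>

lemma ghost_remove:
  assumes "U \<in> open_subgroups G T"
  shows "ghost k z U = of_nat (index G (carrier G) U) * z U + ghost k (z(U := 0)) U"
proof -
  have *: "finite (overgroups U)" "U \<in> overgroups U"
    using assms finite_overgroups by auto
  have 1: "index G U U = 1"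
    using index_eq_1_iff[OF assms *(2)] by simp
  show ?thesis
    unfolding ghost_def sum.remove[OF *]
    using index_eq_1_iff[OF assms *(2)] by (auto simp: 1 intro!: sum.cong)
qed

lemma ghost_upd:
  assumes "\<not> W \<subseteq> U"
  shows "ghost k (z(U := c)) W = ghost k z W"
  unfolding ghost_def using assms by (intro sum.cong) auto

end

section \<open>The congruence of Dress and divisibility of ghost components\<close>

locale profinite_frobenius = profinite G T + frobenius_lift S p \<phi>
  for G :: "'g monoid" (structure) and T and S :: "'b::comm_ring_1 set" and p \<phi>
begin

lemma ghost_S:
  assumes "\<And>V. V \<in> overgroups U \<Longrightarrow> z V \<in> S"
  shows "ghost k z U \<in> S"
  unfolding ghost_def using assms by (intro sum_S mult_S of_int_S power_S) auto

text \<open>The sum in the congruence of Dress, with \<open>b\<close> in the role of a ghost vector.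
  The identity has order \<open>p^0\<close> and contributes \<open>b U\<close>.\<close>

definition dress_sum :: "'g set \<Rightarrow> ('g set \<Rightarrow> 'b) \<Rightarrow> 'b" where
  "dress_sum U b = (\<Sum>g\<in>{g \<in> carrier (G Mod U). \<exists>j. group.ord (G Mod U) g = p ^ j}.
     (\<phi> ^^ multiplicity p (group.ord (G Mod U) g)) (b (cyclic_overgroup U g)))"

text \<open>After interchanging the sums, the part belonging to \<open>V\<close> is
  \<open>(G:V)\<close> times the torsion sum for the image of \<open>V\<close> modulo
  \<open>U\<close>. The former supplies the \<open>p\<close>-part of \<open>(G:V)\<close>, the
  latter that of \<open>(V:U)\<close>.\<close>

lemma pdvd_dress_sum_ghost_1:
  assumes U: "U \<in> open_subgroups G T" and z: "\<And>V. V \<in> overgroups U \<Longrightarrow> z V \<in> S"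
    and k: "p ^ k dvd index G (carrier G) U"
  shows "pdvd k (dress_sum U (ghost 1 z))"
proof -
  interpret H: comm_group "G Mod U"
    by (rule group_Mod[OF U])
  define Q where "Q = {g \<in> carrier (G Mod U). \<exists>j. H.ord g = p ^ j}"
  define e where "e g = multiplicity p (H.ord g)" for g
  define f where "f g V = of_nat (index G (carrier G) V) * (\<phi> ^^ e g) (z V) ^ (index G V U div H.ord g)" for g V
  have "dress_sum U (ghost 1 z) = (\<Sum>g\<in>Q. \<Sum>V\<in>{V \<in> overgroups U. g \<in> (#>) U ` V}. f g V)"
    unfolding dress_sum_def Q_def[symmetric] e_def[symmetric]
  proof (rule sum.cong)
    fix g assume "g \<in> Q"
    then have g: "g \<in> carrier (G Mod U)"
      unfolding Q_def by blast
    have eq: "overgroups (cyclic_overgroup U g) = {V \<in> overgroups U. g \<in> (#>) U ` V}"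
      using cyclic_overgroup_subset_iff[OF U g] cyclic_overgroup_in[OF U g] by auto
    show "(\<phi> ^^ e g) (ghost 1 z (cyclic_overgroup U g)) = (\<Sum>V\<in>{V \<in> overgroups U. g \<in> (#>) U ` V}. f g V)"
      unfolding ghost_def funpow_lift_sum eq[symmetric]
    proof (rule sum.cong)
      fix V assume V: "V \<in> overgroups (cyclic_overgroup U g)"
      show "(\<phi> ^^ e g) (of_int (int (index G (carrier G) V) * 1 ^ (index G V (cyclic_overgroup U g) - 1)) *
          z V ^ index G V (cyclic_overgroup U g)) = f g V"
        unfolding f_def index_over_cyclic_overgroup[OF U g V] funpow_lift_of_int_mult funpow_lift_power
        by simp
    qed simp
  qed simp
  also have "\<dots> = (\<Sum>V\<in>overgroups U. \<Sum>g\<in>{g \<in> Q. g \<in> (#>) U ` V}. f g V)"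
    using finite_Mod[OF U] finite_overgroups[OF U] unfolding Q_def by (intro sum.swap_restrict) auto
  also have "pdvd k \<dots>"
  proof (rule pdvd_sum)
    fix V assume V: "V \<in> overgroups U"
    then have sub: "subgroup ((#>) U ` V) (G Mod U)"
      using subgroup_Mod[OF U] open_subgroupsD(1) by blast
    have eq: "{g \<in> Q. g \<in> (#>) U ` V} = {g \<in> (#>) U ` V. \<exists>j. H.ord g = p ^ j}"
      unfolding Q_def using subgroup.subset[OF sub] by blast
    define m where "m = multiplicity p (index G (carrier G) V)"
    define n where "n = multiplicity p (index G V U)"
    have "(\<Sum>g\<in>{g \<in> Q. g \<in> (#>) U ` V}. f g V) = of_nat (index G (carrier G) V) *
        (\<Sum>g\<in>{g \<in> (#>) U ` V. \<exists>j. H.ord g = p ^ j}.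
          (\<phi> ^^ multiplicity p (H.ord g)) (z V) ^ (card ((#>) U ` V) div H.ord g))"
      unfolding eq f_def e_def card_subgroup_Mod[OF U] sum_distrib_left ..
    also have "pdvd (m + n) \<dots>"
    proof (intro pdvd_mult pdvd_of_nat pdvd_torsion_sum H.comm_group_axioms finite_Mod[OF U] sub z[OF V])
      show "p ^ m dvd index G (carrier G) V" "p ^ n dvd card ((#>) U ` V)"
        unfolding m_def n_def card_subgroup_Mod[OF U] by (rule multiplicity_dvd)+
    qed
    finally have "pdvd (m + n) (\<Sum>g\<in>{g \<in> Q. g \<in> (#>) U ` V}. f g V)" .
    moreover have "k \<le> m + n"
    proof -
      have "index G (carrier G) U = index G (carrier G) V * index G V U"
        using index_mult[OF U V] V carrier_overgroup by blast
      moreover have "index G (carrier G) V > 0" "index G V U > 0"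
        using index_pos U V carrier_open_subgroup by auto
      ultimately have "m + n = multiplicity p (index G (carrier G) U)"
        unfolding m_def n_def
        using prime_p by (simp add: prime_elem_multiplicity_mult_distrib)
      moreover have "index G (carrier G) U > 0"
        using index_pos U carrier_open_subgroup by auto
      ultimately show ?thesis
        using k prime_gt_1_nat[OF prime_p] by (simp add: power_dvd_iff_le_multiplicity)
    qed
    ultimately show "pdvd k (\<Sum>g\<in>{g \<in> Q. g \<in> (#>) U ` V}. f g V)"
      by (rule pdvd_le)
  qed
  finally show ?thesis .
qed

text \<open>Integers are fixed by \<phi>, so multiplication by \<open>q\<close> leads to the case
  \<open>q = 1\<close> with \<open>q z\<close> in place of \<open>z\<close>; the inverse
  \<open>u\<close> in \<open>S\<close> then removes the factor.\<close>

lemma pdvd_dress_sum_ghost: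
  assumes U: "U \<in> open_subgroups G T" and z: "\<And>V. V \<in> overgroups U \<Longrightarrow> z V \<in> S"
    and k: "p ^ k dvd index G (carrier G) U" and u: "u \<in> S" "of_int q * u = 1"
  shows "pdvd k (dress_sum U (ghost q z))"
proof -
  have "of_int q * dress_sum U (ghost q z) = dress_sum U (ghost 1 (\<lambda>V. of_int q * z V))"
    unfolding dress_sum_def sum_distrib_left
  proof (rule sum.cong)
    fix g assume "g \<in> {g \<in> carrier (G Mod U). \<exists>j. group.ord (G Mod U) g = p ^ j}"
    then have "cyclic_overgroup U g \<in> open_subgroups G T"
      using cyclic_overgroup_in[OF U] by blast
    then show "of_int q * (\<phi> ^^ multiplicity p (group.ord (G Mod U) g)) (ghost q z (cyclic_overgroup U g)) =
        (\<phi> ^^ multiplicity p (group.ord (G Mod U) g)) (ghost 1 (\<lambda>V. of_int q * z V) (cyclic_overgroup U g))"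
      by (simp add: of_int_mult_ghost[symmetric] funpow_lift_of_int_mult)
  qed simp
  moreover have "pdvd k (dress_sum U (ghost 1 (\<lambda>V. of_int q * z V)))"
    using z by (intro pdvd_dress_sum_ghost_1 U k mult_S of_int_S)
  ultimately have "pdvd k (u * (of_int q * dress_sum U (ghost q z)))"
    using pdvd_mult_left u(1) by metis
  then show ?thesis
    using u(2) by (simp add: mult.assoc[symmetric] mult.commute[of u])
qed

text \<open>Each summand is divisible separately: if \<open>p^n\<close> is the \<open>p\<close>-part
  of \<open>(V:U)\<close>, then \<open>n < p^n \<le> (V:U)\<close>, so \<open>q^((V:U)-1)\<close>
  already contains \<open>p^n\<close>.\<close>

lemma pdvd_ghost:
  assumes U: "U \<in> open_subgroups G T" and z: "\<And>V. V \<in> overgroups U \<Longrightarrow> z V \<in> S"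
    and k: "p ^ k dvd index G (carrier G) U" and q: "int p dvd q"
  shows "pdvd k (ghost q z U)"
  unfolding ghost_def
proof (rule pdvd_sum)
  fix V assume V: "V \<in> overgroups U"
  define m where "m = multiplicity p (index G (carrier G) V)"
  define n where "n = multiplicity p (index G V U)"
  have pos: "index G (carrier G) V > 0" "index G V U > 0" "index G (carrier G) U > 0"
    using index_pos U V carrier_open_subgroup by auto
  have "index G (carrier G) U = index G (carrier G) V * index G V U"
    using index_mult[OF U V] V carrier_overgroup by blast
  then have "m + n = multiplicity p (index G (carrier G) U)"
    unfolding m_def n_def using prime_p pos by (simp add: prime_elem_multiplicity_mult_distrib)
  then have "k \<le> m + n"
    using k prime_gt_1_nat[OF prime_p] pos by (simp add: power_dvd_iff_le_multiplicity)
  moreover have "n \<le> index G V U - 1"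
  proof -
    have "n < p ^ n"
      using prime_gt_1_nat[OF prime_p] by (intro power_gt_expt) simp
    also have "\<dots> \<le> index G V U"
      unfolding n_def using pos by (intro dvd_imp_le multiplicity_dvd)
    finally show ?thesis
      by simp
  qed
  ultimately have "int p ^ k dvd int p ^ m * int p ^ (index G V U - 1)"
    by (simp add: le_imp_power_dvd flip: power_add)
  also have "\<dots> dvd int (index G (carrier G) V) * q ^ (index G V U - 1)"
    unfolding m_def using q
    by (intro mult_dvd_mono dvd_power_same) (metis int_dvd_int_iff multiplicity_dvd of_nat_power)
  finally have "int p ^ k dvd int (index G (carrier G) V) * q ^ (index G V U - 1)" .
  from pdvd_mult[OF pdvd_of_int[OF this], of 0 "z V ^ index G V U"] power_S[OF z[OF V]]
  show "pdvd k (of_int (int (index G (carrier G) V) * q ^ (index G V U - 1)) * z V ^ index G V U)"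
    by (simp only: pdvd_0 add_0_right)
qed

text \<open>Inductive step for integrality. By \<open>ghost_remove\<close>, \<open>(G:U) y U\<close>
  is a difference of two ghost components at \<open>U\<close> that involve only elements of
  \<open>S\<close>; the three cases of the last hypothesis are treated separately.\<close>

lemma pdvd_ghost_preimage:
  assumes U: "U \<in> open_subgroups G T" and z: "\<And>V. V \<in> overgroups U \<Longrightarrow> z V \<in> S"
    and y: "\<And>V. V \<in> open_subgroups G T \<Longrightarrow> U \<subset> V \<Longrightarrow> y V \<in> S"
    and eq: "\<And>V. V \<in> overgroups U \<Longrightarrow> ghost q z V = ghost r y V"
    and k: "p ^ k dvd index G (carrier G) U"
    and qr: "int p dvd q \<and> int p dvd r \<or> k = 0 \<or>
      (\<exists>u\<in>S. \<exists>v\<in>S. of_int q * u = 1 \<and> of_int r * v = 1)"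
  shows "pdvd k (of_nat (index G (carrier G) U) * y U)"
proof -
  \<comment> \<open>The value of \<open>y\<close> at \<open>U\<close> is not yet known to lie in
    \<open>S\<close>; this replacement makes the whole family integral.\<close>
  let ?y = "y(U := 0)"
  have y': "?y V \<in> S" if "V \<in> overgroups U" for V
    using that y zero_S by auto
  have UU: "U \<in> overgroups U"
    using U by simp
  have diff: "of_nat (index G (carrier G) U) * y U = ghost q z U - ghost r ?y U"
    using eq[OF UU] ghost_remove[OF U, of r y] by simp
  consider "int p dvd q" "int p dvd r" | "k = 0"
    | u v where "u \<in> S" "v \<in> S" "of_int q * u = 1" "of_int r * v = 1"
    using qr by blast
  then show ?thesis
  proof cases
    case 1
    then show ?thesis
      unfolding diff using pdvd_ghost[OF U _ k] z y' by (intro pdvd_diff) auto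
  next
    case 2
    then show ?thesis
      unfolding diff using ghost_S[of U] z y' by (auto intro!: diff_S)
  next
    case 3
    interpret H: comm_group "G Mod U"
      by (rule group_Mod[OF U])
    define Q where "Q = {g \<in> carrier (G Mod U). \<exists>j. H.ord g = p ^ j}"
    have Q: "finite Q" "\<one>\<^bsub>G Mod U\<^esub> \<in> Q"
      unfolding Q_def using finite_Mod[OF U] by (auto simp del: one_FactGroup intro!: exI[of _ 0])
    \<comment> \<open>For \<open>g\<close> other than the identity,
      \<open>\<langle>g\<rangle>U\<close> is a proper overgroup, where the ghost components agree
      and the value at \<open>U\<close> does not enter. Only the identity term survives.\<close>
    have "dress_sum U (ghost q z) - dress_sum U (ghost r ?y) =
        (\<Sum>g\<in>Q. if g = \<one>\<^bsub>G Mod U\<^esub> then ghost q z U - ghost r ?y U else 0)"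
      unfolding dress_sum_def Q_def[symmetric] sum_subtractf[symmetric]
    proof (rule sum.cong)
      fix g assume "g \<in> Q"
      then have g: "g \<in> carrier (G Mod U)"
        unfolding Q_def by blast
      let ?W = "cyclic_overgroup U g"
      show "(\<phi> ^^ multiplicity p (H.ord g)) (ghost q z ?W) - (\<phi> ^^ multiplicity p (H.ord g)) (ghost r ?y ?W) =
          (if g = \<one>\<^bsub>G Mod U\<^esub> then ghost q z U - ghost r ?y U else 0)"
      proof (cases "g = \<one>\<^bsub>G Mod U\<^esub>")
        case True
        then have "?W = U" "H.ord g = 1"
          using cyclic_overgroup_eq_iff[OF U g] H.ord_eq_1[OF g] by auto
        then show ?thesis
          using True by simp
      next
        case False
        then have "?W \<noteq> U"
          using cyclic_overgroup_eq_iff[OF U g] by blast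
        moreover have "?W \<in> overgroups U"
          using cyclic_overgroup_in[OF U g] .
        ultimately have "ghost r ?y ?W = ghost q z ?W"
          using ghost_upd[of ?W U r y 0] eq by auto
        then show ?thesis
          using False by simp
      qed
    qed simp
    also have "\<dots> = ghost q z U - ghost r ?y U"
      using Q by simp
    finally have "of_nat (index G (carrier G) U) * y U = dress_sum U (ghost q z) - dress_sum U (ghost r ?y)"
      unfolding diff ..
    then show ?thesis
      using pdvd_dress_sum_ghost[OF U _ k] z y' 3 by (auto intro!: pdvd_diff)
  qed
qed

end

section \<open>Construction and integrality of the polynomials\<close>

context profinite
begin

text \<open>
  With the component at \<open>U\<close> set to \<open>0\<close>, the ghost component at \<open>U\<close> is the contribution of the proper
  overgroups of \<open>U\<close>.
\<close>

definition strict_poly :: "int \<Rightarrow> int \<Rightarrow> 'g set \<Rightarrow> ('g set multiset \<Rightarrow>\<^sub>0 rat)" where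
  "strict_poly q r = wfrec {(V, U). U \<in> open_subgroups G T \<and> V \<in> open_subgroups G T \<and> U \<subset> V}
     (\<lambda>h U. pconst (1 / of_nat (index G (carrier G) U)) * (ghost q pvar U - ghost r (h(U := 0)) U))"

lemma ghost_cong:
  assumes "\<And>V. V \<in> overgroups U \<Longrightarrow> z V = z' V"
  shows "ghost k z U = ghost k z' U"
  unfolding ghost_def using assms by (intro sum.cong) auto

lemma ghost_strict_poly:
  assumes U: "U \<in> open_subgroups G T"
  shows "ghost r (strict_poly q r) U = ghost q pvar U"
proof -
  let ?R = "{(V, U). U \<in> open_subgroups G T \<and> V \<in> open_subgroups G T \<and> U \<subset> V}"
  let ?y = "strict_poly q r"
  have "?y U = pconst (1 / of_nat (index G (carrier G) U)) *
      (ghost q pvar U - ghost r ((cut ?y ?R U)(U := 0)) U)"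
    unfolding strict_poly_def by (subst wfrec[OF wf_open_subgroups]) (rule refl)
  \<comment> \<open>On proper overgroups \<open>cut\<close> changes nothing, and at \<open>U\<close>
    both families are 0.\<close>
  also have "ghost r ((cut ?y ?R U)(U := 0)) U = ghost r (?y(U := 0)) U"
    using U by (intro ghost_cong) (auto simp: cut_def psubset_eq)
  finally have "of_nat (index G (carrier G) U) * ?y U = ghost q pvar U - ghost r (?y(U := 0)) U"
    using pconst_inverse index_pos[OF U carrier_open_subgroup] by simp
  then show ?thesis
    using ghost_remove[OF U, of r ?y] by simp
qed

text \<open>Integrality is checked at each prime outside \<open>N\<close>, by induction from
  \<open>G\<close> downwards. Such a prime either does not divide the index or divides both or
  neither of \<open>q\<close> and \<open>r\<close>, so \<open>pdvd_ghost_preimage\<close>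
  applies.\<close>

lemma strict_poly_localized:
  assumes N: "\<And>p. p \<in> Dpr_group G T \<Longrightarrow> p \<notin> N \<Longrightarrow> int p dvd q \<longleftrightarrow> int p dvd r"
    and U: "U \<in> open_subgroups G T"
  shows "strict_poly q r U \<in> localized_polys N"
proof (rule localized_polys_Inter)
  fix p assume p: "Factorial_Ring.prime p" "p \<notin> N"
  let ?S = "localized_polys (- {p}) :: ('g set multiset \<Rightarrow>\<^sub>0 rat) set"
  interpret frobenius_lift ?S p "frobenius p"
    by (rule frobenius_lift_polys) fact
  interpret profinite_frobenius G T ?S p "frobenius p" ..
  \<comment> \<open>Integers prime to \<open>p\<close> are units of \<open>?S\<close>: this serves
    both for \<open>q\<close>, \<open>r\<close> and for the prime-to-\<open>p\<close> part of the
    index.\<close>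
  have inverse: "pconst (1 / of_nat n) \<in> ?S" if "\<not> p dvd n" for n
    using that by (intro localized_polys_single localized_rats_inverse) (auto intro: Nat.gr0I)
  have unit: "\<exists>u\<in>?S. of_int k * u = 1" if "\<not> int p dvd k" for k
  proof (cases k rule: int_cases2)
    case (nonneg n)
    then have "\<not> p dvd n" "n > 0"
      using that by (auto intro: Nat.gr0I)
    then show ?thesis
      using inverse[of n] pconst_inverse[of n "1 :: 'g set multiset \<Rightarrow>\<^sub>0 rat"] nonneg by auto
  next
    case (nonpos n)
    then have "\<not> p dvd n" "n > 0"
      using that by (auto intro: Nat.gr0I)
    then show ?thesis
      using minus_S[OF inverse[of n]] pconst_inverse[of n "1 :: 'g set multiset \<Rightarrow>\<^sub>0 rat"] nonpos
      by (intro bexI[of _ "- pconst (1 / of_nat n)"]) auto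
  qed
  show "strict_poly q r U \<in> ?S"
    using U
  proof (induction U rule: open_subgroup_induct)
    case (less U)
    define i where "i = index G (carrier G) U"
    define k where "k = multiplicity p i"
    have "i > 0"
      unfolding i_def using index_pos less.hyps carrier_open_subgroup by blast
    have "pdvd k (of_nat (index G (carrier G) U) * strict_poly q r U)"
    proof (rule pdvd_ghost_preimage[OF less.hyps])
      show "pvar V \<in> ?S" for V :: "'g set"
        by (rule localized_polys_var)
      show "ghost q pvar V = ghost r (strict_poly q r) V" if "V \<in> overgroups U" for V
        using that ghost_strict_poly by simp
      show "p ^ k dvd index G (carrier G) U"
        unfolding k_def i_def by (rule multiplicity_dvd)
      show "int p dvd q \<and> int p dvd r \<or> k = 0 \<or>
          (\<exists>u\<in>?S. \<exists>v\<in>?S. of_int q * u = 1 \<and> of_int r * v = 1)"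
      proof (cases "p dvd i")
        case True
        then have "p \<in> Dpr_group G T"
          using p(1) less.hyps unfolding i_def Dpr_group_def by blast
        then show ?thesis
          using N p(2) unit by blast
      next
        case False
        then show ?thesis
          unfolding k_def by (simp add: not_dvd_imp_multiplicity_0)
      qed
    qed (rule less.IH)
    then obtain s where s: "s \<in> ?S" "of_nat i * strict_poly q r U = of_nat (p ^ k) * s"
      unfolding pdvd_def i_def by blast
    \<comment> \<open>To divide by the index \<open>i\<close>, its \<open>p\<close>-part is
      cancelled by the divisibility just shown and the remaining factor \<open>m\<close> is inverted
      in \<open>?S\<close>.\<close>
    obtain m where m: "i = p ^ k * m" "\<not> p dvd m"
      using multiplicity_decompose'[of i p] \<open>i > 0\<close> prime_gt_1_nat[OF p(1)] unfolding k_def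
      by auto
    have "m > 0"
      using m(1) \<open>i > 0\<close> by (cases m) auto
    have "strict_poly q r U = pconst (1 / of_nat i) * (of_nat i * strict_poly q r U)"
      using pconst_inverse[OF \<open>i > 0\<close>, of "strict_poly q r U"] by (simp add: ac_simps)
    also have "\<dots> = pconst (1 / of_nat m) * s"
    proof -
      have "pconst (1 / of_nat i) * of_nat (p ^ k) = (pconst (1 / of_nat m) :: 'g set multiset \<Rightarrow>\<^sub>0 rat)"
        using mult_single[of "{#}" "1 / of_nat i :: rat" "{#}" "of_nat (p ^ k)"] m(1) \<open>i > 0\<close>
          prime_gt_0_nat[OF p(1)]
        by (simp only: single_of_nat) simp
      then show ?thesis
        unfolding s(2) by (simp add: mult.assoc[symmetric])
    qed
    also have "\<dots> \<in> ?S"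
      using inverse[OF m(2)] s(1) by (rule mult_S)
    finally show ?case .
  qed
qed

end

section \<open>Algebras over localizations\<close>

lemma (in comm_monoid) UnitsI_comm:
  "\<lbrakk>x \<in> carrier G; y \<in> carrier G; x \<otimes> y = \<one>\<rbrakk> \<Longrightarrow> x \<in> Units G"
  using m_comm[of x y] unfolding Units_def by force

lemma rat_ring_eq_type_ring: "rat_ring = type_ring"
  by (simp add: rat_ring_def type_ring_def)

lemma int_localization_simps [simp]:
  "monoid.mult (int_localization S) = (*)" "monoid.one (int_localization S) = 1"
  "ring.zero (int_localization S) = 0" "ring.add (int_localization S) = (+)"
  by (simp_all add: int_localization_def rat_ring_def)

lemma subring_int_localization:
  "subring (carrier (int_localization S)) (type_ring :: rat ring)"
proof -
  interpret cring "type_ring :: rat ring"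
    by (rule cring_type_ring)
  show ?thesis
    unfolding int_localization_def rat_ring_eq_type_ring
    by (simp add: generate_ring_is_subring)
qed

lemma cring_int_localization: "cring (int_localization S)"
proof -
  interpret cring "type_ring :: rat ring"
    by (rule cring_type_ring)
  have eq: "int_localization S = type_ring\<lparr>carrier := carrier (int_localization S)\<rparr>"
    by (simp add: int_localization_def rat_ring_eq_type_ring)
  show ?thesis
    by (subst eq) (use subcring_iff[of "carrier (int_localization S)"] subcringI'[OF subring_int_localization] in simp)
qed

text \<open>Makes \<open>rat_image\<close> applicable to the scalars of the localization. The set of
  fractions with admissible denominators is itself a subring containing the generators.\<close>

lemma carrier_int_localization_subset:
  "carrier (int_localization S) \<subseteq> localized_rats S"
  if "\<And>p. p \<in> S \<Longrightarrow> Factorial_Ring.prime p"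
proof -
  interpret cring "type_ring :: rat ring"
    by (rule cring_type_ring)
  have "subring (localized_rats S) (type_ring :: rat ring)"
  proof (rule subringI)
    fix x :: rat assume x: "x \<in> localized_rats S"
    have "\<ominus>\<^bsub>type_ring\<^esub> x = - x"
      by (rule minus_equality) auto
    then show "\<ominus>\<^bsub>type_ring\<^esub> x \<in> localized_rats S"
      using localized_rats_uminus[OF x] by simp
  qed (auto intro: localized_rats_add localized_rats_mult localized_rats_of_int[of 1, simplified])
  moreover have "{1 / of_nat p | p. p \<in> S} \<subseteq> localized_rats S"
  proof clarify
    fix p assume "p \<in> S"
    then show "1 / of_nat p \<in> localized_rats S"
      using that[OF \<open>p \<in> S\<close>] prime_gt_0_nat
      by (intro localized_rats_inverse) (auto dest: primes_dvd_imp_eq)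
  qed
  ultimately show ?thesis
    unfolding int_localization_def rat_ring_eq_type_ring
    by (simp add: generate_ring_min_subring1)
qed

lemma extend_module_simps [simp]:
  "carrier (ring.extend A (module.fields s)) = carrier A"
  "monoid.mult (ring.extend A (module.fields s)) = monoid.mult A"
  "monoid.one (ring.extend A (module.fields s)) = monoid.one A"
  "ring.zero (ring.extend A (module.fields s)) = ring.zero A"
  "ring.add (ring.extend A (module.fields s)) = ring.add A"
  "smult (ring.extend A (module.fields s)) = s"
  by (simp_all add: ring.defs module.defs)

text \<open>The scalar \<open>1/p\<close> applied to the identity of \<open>A\<close> is an inverse
  of \<open>p\<close>. Its integer multiples are computed by induction from distributivity.\<close>

lemma is_algebra_over_int_localizationD:
  assumes alg: "is_algebra_over (int_localization S) A" and "cring A"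
    and p: "p \<in> S" "Factorial_Ring.prime p"
  shows "add_pow A p \<one>\<^bsub>A\<^esub> \<in> Units A"
proof -
  obtain s where "Module.algebra (int_localization S) (ring.extend A (module.fields s))"
    using alg unfolding is_algebra_over_def by blast
  then interpret M: Module.algebra "int_localization S" "ring.extend A (module.fields s)" .
  interpret A: cring A
    by fact
  let ?c = "1 / of_nat p :: rat"
  have c: "?c \<in> carrier (int_localization S)"
    using p(1) unfolding int_localization_def by (auto intro: generate_ring.incl)
  have s_closed: "s d x \<in> carrier A" if "d \<in> carrier (int_localization S)" "x \<in> carrier A" for d x
    using M.smult_closed[of d x] that by simp
  have mult: "of_nat n * ?c \<in> carrier (int_localization S) \<and>
      s (of_nat n * ?c) \<one>\<^bsub>A\<^esub> = add_pow A (int n) (s ?c \<one>\<^bsub>A\<^esub>)" for n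
  proof (induction n)
    case 0
    then show ?case
      using M.R.zero_closed M.smult_l_null[of "\<one>\<^bsub>A\<^esub>"] by (simp add: add_pow_def)
  next
    case (Suc n)
    have "of_nat (Suc n) * ?c = ?c + of_nat n * ?c"
      by (simp add: add_divide_distrib)
    then show ?case
      using Suc c M.R.add.m_closed[of ?c "of_nat n * ?c"] M.smult_l_distr[of ?c "of_nat n * ?c" "\<one>\<^bsub>A\<^esub>"]
        A.add.int_pow_mult[of "s ?c \<one>\<^bsub>A\<^esub>" 1 "int n"] A.add.int_pow_1[of "s ?c \<one>\<^bsub>A\<^esub>"] s_closed
      by (simp only: int_localization_simps extend_module_simps A.one_closed) simp
  qed
  have "A.int_image (int p) \<otimes>\<^bsub>A\<^esub> s ?c \<one>\<^bsub>A\<^esub> = s (of_nat p * ?c) \<one>\<^bsub>A\<^esub>"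
    using mult[of p] A.add_pow_int_image[OF s_closed[OF c A.one_closed], of "int p"] by simp
  also have "\<dots> = \<one>\<^bsub>A\<^esub>"
    using M.smult_one[of "\<one>\<^bsub>A\<^esub>"] prime_gt_0_nat[OF p(2)] by simp
  finally show ?thesis
    unfolding A.add_pow_nat_int using s_closed[OF c A.one_closed] by (intro A.UnitsI_comm) auto
qed

text \<open>A scalar acts as multiplication by its image under \<open>rat_image\<close>.\<close>

lemma is_algebra_over_int_localizationI:
  fixes A :: "'a ring" (structure)
  assumes "localized_cring A N" and "\<And>p. p \<in> N \<Longrightarrow> Factorial_Ring.prime p"
  shows "is_algebra_over (int_localization N) A"
proof -
  interpret localized_cring A N
    by fact
  let ?M = "ring.extend A (module.fields (\<lambda>c x. rat_image c \<otimes> x))"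
  note sub = subsetD[OF carrier_int_localization_subset[OF assms(2)]]
  have M: "cring ?M"
  proof (rule cringI)
    show "abelian_group ?M"
      by (rule abelian_groupI) (auto intro: a_assoc a_comm l_neg)
    show "comm_monoid ?M"
      by (rule comm_monoidI) (auto intro: m_assoc m_comm)
  qed (auto intro: l_distr)
  have "Module.algebra (int_localization N) ?M"
    by (rule algebraI)
      (use cring_int_localization M rat_image_of_int[of 1] in
        \<open>auto simp: rat_image_closed rat_image_add rat_image_mult sub l_distr r_distr m_assoc\<close>)
  then show ?thesis
    unfolding is_algebra_over_def by blast
qed

section \<open>A torsion-free cover\<close>

lemma infinite_pairing: "\<exists>f :: 'a::infinite \<times> 'a \<Rightarrow> 'a. inj f"
proof -
  have "ordIso2 (card_of ((UNIV :: 'a set) \<times> (UNIV :: 'a set))) (card_of (UNIV :: 'a set))"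
    by (rule card_of_Times_same_infinite) (rule infinite_UNIV)
  then obtain f where "bij_betw f ((UNIV :: 'a set) \<times> (UNIV :: 'a set)) (UNIV :: 'a set)"
    using card_of_ordIso by blast
  then show ?thesis
    by (auto simp: bij_betw_def)
qed

text \<open>Iterated pairing need not separate lists of different lengths, since its end value may
  itself be a pair; hence the length is stored too.\<close>

lemma infinite_list_coding: "\<exists>f :: 'a::infinite list \<Rightarrow> 'a. inj f"
proof -
  obtain pair :: "'a \<times> 'a \<Rightarrow> 'a" where pair: "inj pair"
    using infinite_pairing by blast
  obtain num :: "nat \<Rightarrow> 'a" where num: "inj num"
    using infinite_UNIV infinite_countable_subset by blast
  define code where "code xs = foldr (\<lambda>x c. pair (x, c)) xs (num 0)" for xs
  have "xs = ys" if "length xs = length ys" "code xs = code ys" for xs ys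
    using that unfolding code_def
    by (induction xs ys rule: list_induct2) (auto dest: injD[OF pair])
  moreover have "length xs = length ys \<and> code xs = code ys"
    if "pair (num (length xs), code xs) = pair (num (length ys), code ys)" for xs ys
    using that by (auto dest!: injD[OF pair] injD[OF num])
  ultimately show ?thesis
    by (intro exI[of _ "\<lambda>xs. pair (num (length xs), code xs)"] injI) blast
qed

text \<open>Room for the torsion-free cover: polynomials with one variable per element of
  \<open>'a\<close> fit back into \<open>'a\<close>. A polynomial is coded as a list of monomials
  with their coefficients.\<close>

lemma infinite_poly_coding: "\<exists>f :: ('a::infinite multiset \<Rightarrow>\<^sub>0 rat) \<Rightarrow> 'a. inj f"
proof -
  obtain pair :: "'a \<times> 'a \<Rightarrow> 'a" where pair: "inj pair"
    using infinite_pairing by blast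
  obtain code :: "'a list \<Rightarrow> 'a" where code: "inj code"
    using infinite_list_coding by blast
  obtain num :: "nat \<Rightarrow> 'a" where num: "inj num"
    using infinite_UNIV infinite_countable_subset by blast
  define mcode where "mcode m = code (SOME xs. mset xs = m)" for m
  have mcode: "inj mcode"
  proof (rule injI)
    fix m n :: "'a multiset"
    assume "mcode m = mcode n"
    then have "(SOME xs. mset xs = m) = (SOME xs. mset xs = n)"
      unfolding mcode_def by (rule injD[OF code])
    then show "m = n"
      using someI_ex[OF ex_mset[of m]] someI_ex[OF ex_mset[of n]] by metis
  qed
  define term_code where "term_code t = pair (mcode (fst t), num (to_nat (snd t)))" for t :: "'a multiset \<times> rat"
  have term_code: "inj term_code"
    by (rule injI)
      (auto simp: term_code_def prod_eq_iff dest!: injD[OF pair] injD[OF mcode] injD[OF num])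
  \<comment> \<open>Some listing of the support is chosen; any listing determines the polynomial,
    because absent monomials have coefficient 0.\<close>
  define terms where "terms f = (SOME ts. set ts = (\<lambda>m. (m, poly_mapping.lookup f m)) ` Poly_Mapping.keys f)"
    for f :: "'a multiset \<Rightarrow>\<^sub>0 rat"
  have terms: "set (terms f) = (\<lambda>m. (m, poly_mapping.lookup f m)) ` Poly_Mapping.keys f" for f
    unfolding terms_def by (rule someI_ex) (simp add: finite_list)
  have "inj terms"
  proof (rule injI)
    fix f g assume "terms f = terms g"
    then have eq: "(\<lambda>m. (m, poly_mapping.lookup f m)) ` Poly_Mapping.keys f =
        (\<lambda>m. (m, poly_mapping.lookup g m)) ` Poly_Mapping.keys g"
      using terms[of f] terms[of g] by simp
    have f: "poly_mapping.lookup f m = poly_mapping.lookup g m" if "m \<in> Poly_Mapping.keys f" for m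
    proof -
      have "(m, poly_mapping.lookup f m) \<in> (\<lambda>m. (m, poly_mapping.lookup g m)) ` Poly_Mapping.keys g"
        unfolding eq[symmetric] using that by (rule imageI)
      then show ?thesis
        by auto
    qed
    have g: "poly_mapping.lookup f m = poly_mapping.lookup g m" if "m \<in> Poly_Mapping.keys g" for m
    proof -
      have "(m, poly_mapping.lookup g m) \<in> (\<lambda>m. (m, poly_mapping.lookup f m)) ` Poly_Mapping.keys f"
        unfolding eq using that by (rule imageI)
      then show ?thesis
        by auto
    qed
    show "f = g"
    proof (rule poly_mapping_eqI)
      show "poly_mapping.lookup f m = poly_mapping.lookup g m" for m
        using f[of m] g[of m] in_keys_iff[of m f] in_keys_iff[of m g] by metis
    qed
  qed
  moreover have "inj (map term_code)"
    using term_code by (simp add: inj_mapI)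
  ultimately have "inj (code \<circ> map term_code \<circ> terms)"
    using code by (intro inj_compose)
  then show ?thesis
    by blast
qed

section \<open>A copy of the polynomial ring inside the type of the given rings\<close>

text \<open>
  A copy of the ring of localized polynomials on its image under an injection \<open>\<iota>\<close>, needed since
  the functors are only given on rings over \<open>'a\<close>.
\<close>

definition poly_copy :: "(('v multiset \<Rightarrow>\<^sub>0 rat) \<Rightarrow> 'a) \<Rightarrow> nat set \<Rightarrow> 'a ring" where
  "poly_copy \<iota> N = \<lparr>carrier = \<iota> ` localized_polys N,
     monoid.mult = (\<lambda>x y. \<iota> (inv_into UNIV \<iota> x * inv_into UNIV \<iota> y)), monoid.one = \<iota> 1,
     ring.zero = \<iota> 0, ring.add = (\<lambda>x y. \<iota> (inv_into UNIV \<iota> x + inv_into UNIV \<iota> y))\<rparr>"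

context
  fixes \<iota> :: "('v multiset \<Rightarrow>\<^sub>0 rat) \<Rightarrow> 'a" and N :: "nat set"
  assumes inj: "inj \<iota>"
begin

lemma poly_copy_simps:
  "carrier (poly_copy \<iota> N) = \<iota> ` localized_polys N"
  "monoid.mult (poly_copy \<iota> N) (\<iota> f) (\<iota> g) = \<iota> (f * g)" "monoid.one (poly_copy \<iota> N) = \<iota> 1"
  "ring.add (poly_copy \<iota> N) (\<iota> f) (\<iota> g) = \<iota> (f + g)" "ring.zero (poly_copy \<iota> N) = \<iota> 0"
  by (simp_all add: poly_copy_def inv_f_f[OF inj])

lemma cring_poly_copy: "cring (poly_copy \<iota> N)"
proof (rule cringI)
  show "abelian_group (poly_copy \<iota> N)"
  proof (rule abelian_groupI)
    fix x assume "x \<in> carrier (poly_copy \<iota> N)"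
    then obtain f where f: "f \<in> localized_polys N" "x = \<iota> f"
      by (auto simp: poly_copy_simps)
    then show "\<exists>y\<in>carrier (poly_copy \<iota> N). y \<oplus>\<^bsub>poly_copy \<iota> N\<^esub> x = \<zero>\<^bsub>poly_copy \<iota> N\<^esub>"
      by (intro bexI[of _ "\<iota> (- f)"]) (auto simp: poly_copy_simps localized_polys_uminus)
  qed (auto simp: poly_copy_simps localized_polys_add localized_polys_zero ac_simps)
  show "comm_monoid (poly_copy \<iota> N)"
    by (rule comm_monoidI)
      (auto simp: poly_copy_simps localized_polys_mult localized_polys_one ac_simps)
qed (auto simp: poly_copy_simps distrib_right)

lemma poly_copy_hom: "ring_hom_cring (poly_copy \<iota> N) type_ring (inv_into UNIV \<iota>)"
  by (intro ring_hom_cring.intro ring_hom_cring_axioms.intro cring_poly_copy cring_type_ring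
      ring_hom_memI) (auto simp: poly_copy_simps inv_f_f[OF inj])

lemma inv_inj_on_poly_copy: "x \<in> carrier (poly_copy \<iota> N) \<Longrightarrow> \<iota> (inv_into UNIV \<iota> x) = x"
  by (auto simp: poly_copy_simps inv_f_f[OF inj])

lemma localized_cring_poly_copy: "localized_cring (poly_copy \<iota> N) N"
proof -
  interpret ring_hom_cring "poly_copy \<iota> N" "type_ring" "inv_into UNIV \<iota>"
    by (rule poly_copy_hom)
  show ?thesis
  proof unfold_locales
    fix p assume p: "p \<in> N" "Factorial_Ring.prime p"
    let ?i = "\<iota> (pconst (1 / of_nat p))"
    have "1 / of_nat p \<in> localized_rats N"
      using p prime_gt_0_nat by (intro localized_rats_inverse) (auto dest: primes_dvd_imp_eq)
    then have i: "?i \<in> carrier (poly_copy \<iota> N)"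
      by (auto simp: poly_copy_simps localized_polys_single)
    have "inv_into UNIV \<iota> (R.int_image (int p) \<otimes>\<^bsub>poly_copy \<iota> N\<^esub> ?i) = of_nat p * pconst (1 / of_nat p)"
      using i hom_int_image[of "int p"] by (simp add: type_ring_int_image inv_f_f[OF inj])
    also have "\<dots> = 1"
      using pconst_inverse[of p 1] prime_gt_0_nat[OF p(2)] by simp
    finally have "inv_into UNIV \<iota> (R.int_image (int p) \<otimes>\<^bsub>poly_copy \<iota> N\<^esub> ?i) = 1" .
    moreover have "R.int_image (int p) \<otimes>\<^bsub>poly_copy \<iota> N\<^esub> ?i \<in> carrier (poly_copy \<iota> N)"
      using i by (intro R.m_closed R.int_image_closed)
    ultimately have "R.int_image (int p) \<otimes>\<^bsub>poly_copy \<iota> N\<^esub> ?i = \<one>\<^bsub>poly_copy \<iota> N\<^esub>"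
      using inv_inj_on_poly_copy poly_copy_simps(3) by metis
    then show "[p] \<cdot>\<^bsub>poly_copy \<iota> N\<^esub> \<one>\<^bsub>poly_copy \<iota> N\<^esub> \<in> Units (poly_copy \<iota> N)"
      unfolding R.add_pow_nat_int using i by (intro R.UnitsI_comm) auto
  qed
qed

text \<open>The copy embeds into the rational polynomials, where \<open>n\<close> is
  invertible.\<close>

lemma torsion_free_poly_copy:
  assumes "x \<in> carrier (poly_copy \<iota> N)" "n > 0" "add_pow (poly_copy \<iota> N) (n::nat) x = \<zero>\<^bsub>poly_copy \<iota> N\<^esub>"
  shows "x = \<zero>\<^bsub>poly_copy \<iota> N\<^esub>"
proof -
  interpret ring_hom_cring "poly_copy \<iota> N" "type_ring" "inv_into UNIV \<iota>"
    by (rule poly_copy_hom)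
  have "of_nat n * inv_into UNIV \<iota> x = inv_into UNIV \<iota> (add_pow (poly_copy \<iota> N) (int n) x)"
    unfolding R.add_pow_int_image[OF assms(1)]
    using assms(1) hom_int_image[of "int n"] by (simp add: type_ring_int_image)
  also have "\<dots> = 0"
    using assms(3) by (simp add: R.add_pow_nat_int)
  finally have "of_nat n * inv_into UNIV \<iota> x = 0" .
  then have "pconst (1 / of_nat n) * (of_nat n * inv_into UNIV \<iota> x) = 0"
    by simp
  then have "inv_into UNIV \<iota> x = 0"
    using pconst_inverse[OF assms(2), of "inv_into UNIV \<iota> x"] by (simp add: ac_simps)
  then show ?thesis
    using inv_inj_on_poly_copy[OF assms(1)] by (simp add: poly_copy_simps)
qed

text \<open>Evaluation at \<open>v\<close> hits every value of \<open>v\<close>, so it is onto as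
  soon as \<open>v\<close> exhausts the carrier.\<close>

lemma poly_copy_cover:
  assumes "localized_cring A N" and v: "\<And>a. v a \<in> carrier A"
  shows "localized_cring.poly_image A v \<circ> inv_into UNIV \<iota> \<in> ring_hom (poly_copy \<iota> N) A"
    and "v a \<in> (localized_cring.poly_image A v \<circ> inv_into UNIV \<iota>) ` carrier (poly_copy \<iota> N)"
proof -
  interpret localized_cring A N
    by fact
  show "poly_image v \<circ> inv_into UNIV \<iota> \<in> ring_hom (poly_copy \<iota> N) A"
    by (intro ring_hom_memI)
      (use poly_image_of_int[where v = v, OF v, where k = 1] in
        \<open>auto simp: poly_copy_simps inv_f_f[OF inj] poly_image_closed[where v = v, OF v] poly_image_mult[where v = v, OF v] poly_image_add[where v = v, OF v]\<close>)
  show "v a \<in> (poly_image v \<circ> inv_into UNIV \<iota>) ` carrier (poly_copy \<iota> N)"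
    using poly_image_var[where v = v, OF v, of a] localized_polys_var
    by (auto simp: poly_copy_simps inv_f_f[OF inj] image_image intro!: image_eqI[of _ _ "pvar a"])
qed

end

section \<open>Ghost maps\<close>

context profinite
begin

text \<open>Take \<open>V\<close> of least index \<open>n\<close> among those with \<open>p\<close>
  dividing \<open>n\<close>. If \<open>n\<close> were not \<open>p\<close>, a prime \<open>l\<close>
  would divide \<open>n / p\<close>, and an element of order \<open>l\<close> modulo
  \<open>V\<close> would give an overgroup of index \<open>n / l\<close>, smaller and still
  divisible by \<open>p\<close>.\<close>

lemma exists_prime_index:
  assumes "p \<in> Dpr_group G T"
  shows "\<exists>V\<in>open_subgroups G T. index G (carrier G) V = p"
proof -
  obtain U where "U \<in> open_subgroups G T" "p dvd index G (carrier G) U"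
    and p: "Factorial_Ring.prime p"
    using assms unfolding Dpr_group_def by blast
  then obtain V where V: "V \<in> open_subgroups G T" "p dvd index G (carrier G) V"
    and least: "\<And>W. W \<in> open_subgroups G T \<Longrightarrow> p dvd index G (carrier G) W \<Longrightarrow>
      index G (carrier G) V \<le> index G (carrier G) W"
    using ex_has_least_nat[of "\<lambda>V. V \<in> open_subgroups G T \<and> p dvd index G (carrier G) V" U "index G (carrier G)"]
    by blast
  define n where "n = index G (carrier G) V"
  have "n > 0"
    unfolding n_def using index_pos V(1) carrier_open_subgroup by blast
  have "n = p"
  proof (rule ccontr)
    assume "n \<noteq> p"
    obtain m where m: "n = p * m"
      using V(2) unfolding n_def by blast
    then have "m \<noteq> 1"
      using \<open>n \<noteq> p\<close> by simp
    then obtain l where l: "Factorial_Ring.prime l" "l dvd m"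
      using prime_factor_nat by blast
    then obtain m' where m': "m = l * m'"
      by blast
    interpret H: comm_group "G Mod V"
      by (rule group_Mod[OF V(1)])
    have "order (G Mod V) = l ^ 1 * (p * m')"
      unfolding order_def carrier_Mod[OF V(1)] card_subgroup_Mod[OF V(1)]
      using m m' n_def by (simp add: ac_simps)
    then obtain K where K: "subgroup K (G Mod V)" "card K = l"
      \<comment> \<open>Sylow with exponent 1, that is, Cauchy's theorem; it covers
        \<open>l = p\<close> as well.\<close>
      using sylow_thm[OF l(1) H.is_group _ finite_Mod[OF V(1)]] by (metis power_one_right)
    have "K \<noteq> {\<one>\<^bsub>G Mod V\<^esub>}"
      using K(2) prime_gt_1_nat[OF l(1)] by auto
    then obtain g where g: "g \<in> K" "g \<noteq> \<one>\<^bsub>G Mod V\<^esub>"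
      using subgroup.one_closed[OF K(1)] by blast
    have gH: "g \<in> carrier (G Mod V)"
      using subgroup.mem_carrier[OF K(1) g(1)] .
    have "finite K"
      using K(2) prime_gt_0_nat[OF l(1)] card_gt_0_iff by metis
    then have "g [^]\<^bsub>G Mod V\<^esub> l = \<one>\<^bsub>G Mod V\<^esub>"
      using group.pow_order_eq_1[OF H.subgroup_imp_group[OF K(1)], of g] g(1) K(2)
      by (simp add: order_def H.nat_pow_consistent[symmetric])
    then have "H.ord g dvd l"
      using H.pow_eq_id[OF gH] by blast
    then have ord: "H.ord g = l"
      using l(1) g(2) H.ord_eq_1[OF gH] by (metis One_nat_def prime_nat_iff)
    let ?W = "cyclic_overgroup V g"
    have W: "?W \<in> overgroups V"
      by (rule cyclic_overgroup_in[OF V(1) gH])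
    have "n = index G (carrier G) ?W * l"
      unfolding n_def ord[symmetric] index_cyclic_overgroup[OF V(1) gH, symmetric]
      using W carrier_overgroup by (intro index_mult[OF V(1)]) blast+
    then have W_eq: "index G (carrier G) ?W = p * m'"
      using m m' prime_gt_0_nat[OF l(1)] by simp
    then have "n \<le> p * m'"
      using least[of ?W] W unfolding n_def by simp
    then show False
      using m m' \<open>n > 0\<close> prime_gt_1_nat[OF l(1)] by simp
  qed
  then show ?thesis
    using V(1) n_def by blast
qed

lemma ghost_map_carrier:
  assumes "cring A" "\<alpha> \<in> open_subgroups G T \<rightarrow>\<^sub>E carrier A"
  shows "ghost_map G T k A \<alpha> (carrier G) = \<alpha> (carrier G)"
proof -
  interpret A: cring A
    by fact
  have eq: "overgroups (carrier G) = {carrier G}"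
    using carrier_open_subgroup open_subgroupsD(1) subgroup.subset by blast
  have c: "\<alpha> (carrier G) \<in> carrier A"
    using assms(2) carrier_open_subgroup by blast
  have 1: "index G (carrier G) (carrier G) = 1"
    using index_eq_1_iff[of "carrier G" "carrier G"] carrier_open_subgroup by simp
  show ?thesis
    unfolding ghost_map_def restrict_apply'[OF carrier_open_subgroup] eq
    using c by (simp add: 1 A.add.int_pow_1)
qed

text \<open>The index is prime, so nothing lies strictly between \<open>V\<close> and
  \<open>G\<close> and only two summands remain.\<close>

lemma ghost_map_prime_index:
  assumes "cring A" "\<alpha> \<in> open_subgroups G T \<rightarrow>\<^sub>E carrier A"
    and V: "V \<in> open_subgroups G T" "index G (carrier G) V = p" "Factorial_Ring.prime p"
  shows "ghost_map G T k A \<alpha> V =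
    add_pow A (int p) (\<alpha> V) \<oplus>\<^bsub>A\<^esub> add_pow A (k ^ (p - 1)) (\<alpha> (carrier G) [^]\<^bsub>A\<^esub> p)"
proof -
  interpret A: cring A
    by fact
  have VV: "V \<in> overgroups V" and GV: "carrier G \<in> overgroups V"
    using V(1) carrier_overgroup by auto
  have 1: "index G V V = 1" "index G (carrier G) (carrier G) = 1"
    using index_eq_1_iff[of V V] index_eq_1_iff[of "carrier G" "carrier G"] carrier_open_subgroup V(1)
    by auto
  have ne: "V \<noteq> carrier G"
    using 1(2) V(2,3) prime_gt_1_nat[of p] by auto
  have eq: "overgroups V = {V, carrier G}"
  proof -
    have "W = V \<or> W = carrier G" if W: "W \<in> overgroups V" for W
    proof -
      have GW: "carrier G \<in> overgroups W"
        using W carrier_overgroup by blast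
      have "p = index G (carrier G) W * index G W V"
        using index_mult[OF V(1) W GW] V(2) by simp
      then have "index G (carrier G) W = 1 \<or> index G W V = 1"
        using V(3) prime_product[of "index G (carrier G) W" "index G W V"] by simp
      then show ?thesis
        using index_eq_1_iff[OF V(1) W] index_eq_1_iff[of W "carrier G"] W GW by blast
    qed
    then show ?thesis
      using VV GV by blast
  qed
  have c: "\<alpha> (carrier G) \<in> carrier A" "\<alpha> V \<in> carrier A"
    using assms(2) carrier_open_subgroup V(1) by blast+
  show ?thesis
    unfolding ghost_map_def restrict_apply'[OF V(1)] eq
    using c ne by (simp add: 1 V(2))
qed

text \<open>The components at \<open>G\<close> give \<open>\<beta> (carrier G) = 1\<close>. Those at
  \<open>V\<close> then show that \<open>d = q^(p-1) - r^(p-1)\<close> is a multiple of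
  \<open>p\<close> in \<open>A\<close>; as \<open>d\<close> is prime to \<open>p\<close>, also 1 is
  such a multiple.\<close>

lemma prime_unit_of_ghost_map_eq:
  assumes "cring A" and V: "V \<in> open_subgroups G T" "index G (carrier G) V = p" "Factorial_Ring.prime p"
    and \<beta>: "\<beta> \<in> open_subgroups G T \<rightarrow>\<^sub>E carrier A"
    and eq: "ghost_map G T q A (\<lambda>U\<in>open_subgroups G T. \<one>\<^bsub>A\<^esub>) = ghost_map G T r A \<beta>"
    and qr: "int p dvd q \<longleftrightarrow> \<not> int p dvd r"
  shows "add_pow A p \<one>\<^bsub>A\<^esub> \<in> Units A"
proof -
  interpret A: cring A
    by fact
  let ?\<alpha> = "\<lambda>U\<in>open_subgroups G T. \<one>\<^bsub>A\<^esub>"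
  have \<alpha>: "?\<alpha> \<in> open_subgroups G T \<rightarrow>\<^sub>E carrier A"
    by auto
  have \<beta>G: "\<beta> (carrier G) = \<one>\<^bsub>A\<^esub>"
    using ghost_map_carrier[OF assms(1) \<alpha>, of q] ghost_map_carrier[OF assms(1) \<beta>, of r] eq
      carrier_open_subgroup by simp
  define b where "b = \<beta> V"
  have b: "b \<in> carrier A"
    unfolding b_def using \<beta> V(1) by blast
  define d where "d = q ^ (p - 1) - r ^ (p - 1)"
  have "A.int_image (int p) \<oplus>\<^bsub>A\<^esub> A.int_image (q ^ (p - 1)) =
      A.int_image (int p) \<otimes>\<^bsub>A\<^esub> b \<oplus>\<^bsub>A\<^esub> A.int_image (r ^ (p - 1))"
    using ghost_map_prime_index[OF assms(1) \<alpha> V, of q] ghost_map_prime_index[OF assms(1) \<beta> V, of r]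
      eq \<beta>G V(1) carrier_open_subgroup A.add_pow_int_image[OF b, of "int p"] by (simp add: b_def)
  then have "A.int_image (int p + d) \<oplus>\<^bsub>A\<^esub> A.int_image (r ^ (p - 1)) =
      A.int_image (int p) \<otimes>\<^bsub>A\<^esub> b \<oplus>\<^bsub>A\<^esub> A.int_image (r ^ (p - 1))"
    unfolding d_def A.int_image_add[symmetric] by simp
  then have pd: "A.int_image (int p + d) = A.int_image (int p) \<otimes>\<^bsub>A\<^esub> b"
    using b by (simp only: A.add.right_cancel A.int_image_closed A.m_closed)
  have "\<not> int p dvd d"
  proof -
    have "int p dvd q ^ (p - 1) \<longleftrightarrow> int p dvd q" "int p dvd r ^ (p - 1) \<longleftrightarrow> int p dvd r"
      using V(3) prime_gt_1_nat[OF V(3)] by (auto simp: prime_dvd_power_iff)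
    then show ?thesis
      unfolding d_def using qr by (metis dvd_diff_right_iff dvd_diff_left_iff)
  qed
  then have "coprime (int p) d"
    using V(3) by (simp add: prime_imp_coprime)
  then obtain u v where uv: "u * int p + v * d = 1"
    using bezout_int[of "int p" d] by auto
  \<comment> \<open>The inverse of \<open>p\<close> is \<open>(u - v) + v b\<close>: since
    \<open>p b = p + d\<close>, its product with \<open>p\<close> is
    \<open>u p + v d = 1\<close>.\<close>
  have "A.int_image (int p) \<otimes>\<^bsub>A\<^esub> (A.int_image (u - v) \<oplus>\<^bsub>A\<^esub> A.int_image v \<otimes>\<^bsub>A\<^esub> b) =
      A.int_image (int p * (u - v)) \<oplus>\<^bsub>A\<^esub> A.int_image v \<otimes>\<^bsub>A\<^esub> (A.int_image (int p) \<otimes>\<^bsub>A\<^esub> b)"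
    using b by (simp add: A.r_distr A.int_image_mult A.m_lcomm)
  also have "\<dots> = A.int_image (int p * (u - v) + v * (int p + d))"
    unfolding pd[symmetric] A.int_image_mult[symmetric] A.int_image_add[symmetric] ..
  also have "int p * (u - v) + v * (int p + d) = 1"
    using uv by (simp add: algebra_simps)
  finally show ?thesis
    unfolding A.add_pow_nat_int using b by (intro A.UnitsI_comm) auto
qed

text \<open>Components are recovered from \<open>G\<close> downwards: once those at the proper
  overgroups are known, the ghost component fixes \<open>(G:U) \<alpha> U\<close>, and
  \<open>(G:U)\<close> can be cancelled.\<close>

lemma ghost_map_inj:
  assumes "cring A"
    and tf: "\<And>p a. \<lbrakk>p \<in> Dpr_group G T; a \<in> carrier A; add_pow A p a = \<zero>\<^bsub>A\<^esub>\<rbrakk> \<Longrightarrow> a = \<zero>\<^bsub>A\<^esub>"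
  shows "inj_on (ghost_map G T k A) (open_subgroups G T \<rightarrow>\<^sub>E carrier A)"
proof (rule inj_onI)
  interpret A: cring A
    by fact
  \<comment> \<open>The primes dividing indices can be cancelled, hence so can their products, in
    particular the indices themselves.\<close>
  have tf': "a = \<zero>\<^bsub>A\<^esub>" if "n > 0" "\<And>p. Factorial_Ring.prime p \<Longrightarrow> p dvd n \<Longrightarrow> p \<in> Dpr_group G T"
    "a \<in> carrier A" "add_pow A n a = \<zero>\<^bsub>A\<^esub>" for n :: nat and a
    using that
  proof (induction n arbitrary: a rule: prime_divisors_induct)
    case (factor p n)
    have "add_pow A n (add_pow A p a) = add_pow A (p * n) a"
      using A.add.nat_pow_pow[OF factor.prems(3), of n p] by (simp only: mult.commute)
    then have 0: "add_pow A n (add_pow A p a) = \<zero>\<^bsub>A\<^esub>"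
      using factor.prems(4) by simp
    have "add_pow A p a = \<zero>\<^bsub>A\<^esub>"
      by (rule factor.IH[OF _ _ _ 0]) (use factor.prems in auto)
    then show ?case
      by (rule tf[rotated 2]) (use factor.prems factor.hyps in auto)
  qed auto
  fix \<alpha> \<beta> assume \<alpha>: "\<alpha> \<in> open_subgroups G T \<rightarrow>\<^sub>E carrier A"
    and \<beta>: "\<beta> \<in> open_subgroups G T \<rightarrow>\<^sub>E carrier A"
    and eq: "ghost_map G T k A \<alpha> = ghost_map G T k A \<beta>"
  have "\<alpha> U = \<beta> U" if "U \<in> open_subgroups G T" for U
    using that
  proof (induction U rule: open_subgroup_induct)
    case (less U)
    let ?n = "index G (carrier G) U"
    let ?f = "\<lambda>\<gamma> V. add_pow A (int (index G (carrier G) V) * k ^ (index G V U - 1)) (\<gamma> V [^]\<^bsub>A\<^esub> index G V U)"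
    let ?R = "\<lambda>\<gamma>. \<Oplus>\<^bsub>A\<^esub>V\<in>overgroups U - {U}. ?f \<gamma> V"
    have U: "U \<in> overgroups U"
      using less.hyps by simp
    have 1: "index G U U = 1"
      using index_eq_1_iff[OF less.hyps U] by simp
    have closed: "?f \<gamma> V \<in> carrier A"
      if "\<gamma> \<in> open_subgroups G T \<rightarrow>\<^sub>E carrier A" "V \<in> overgroups U" for \<gamma> V
      using that by (intro A.add.int_pow_closed A.nat_pow_closed) auto
    have ghost: "ghost_map G T k A \<gamma> U = add_pow A (int ?n) (\<gamma> U) \<oplus>\<^bsub>A\<^esub> ?R \<gamma>"
      if \<gamma>: "\<gamma> \<in> open_subgroups G T \<rightarrow>\<^sub>E carrier A" for \<gamma>
    proof -
      have "ghost_map G T k A \<gamma> U = (\<Oplus>\<^bsub>A\<^esub>V\<in>insert U (overgroups U - {U}). ?f \<gamma> V)"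
        unfolding ghost_map_def restrict_apply'[OF less.hyps] insert_Diff[OF U] ..
      also have "\<dots> = ?f \<gamma> U \<oplus>\<^bsub>A\<^esub> ?R \<gamma>"
        using finite_overgroups[OF less.hyps] closed[OF \<gamma>] U by (intro A.finsum_insert) auto
      also have "?f \<gamma> U = add_pow A (int ?n) (\<gamma> U)"
        using \<gamma> less.hyps PiE_mem[OF \<gamma> less.hyps] by (simp add: 1)
      finally show ?thesis .
    qed
    have "\<alpha> V = \<beta> V" if "V \<in> overgroups U - {U}" for V
      using less.IH[of V] that by blast
    then have "?R \<alpha> = ?R \<beta>"
      using closed[OF \<beta>] by (intro A.finsum_cong') auto
    then have "add_pow A (int ?n) (\<alpha> U) \<oplus>\<^bsub>A\<^esub> ?R \<beta> = add_pow A (int ?n) (\<beta> U) \<oplus>\<^bsub>A\<^esub> ?R \<beta>"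
      using ghost[OF \<alpha>] ghost[OF \<beta>] eq by simp
    moreover have R: "?R \<beta> \<in> carrier A"
      using closed[OF \<beta>] by (intro A.finsum_closed) auto
    moreover have c: "\<alpha> U \<in> carrier A" "\<beta> U \<in> carrier A"
      using \<alpha> \<beta> less.hyps by blast+
    ultimately have *: "add_pow A ?n (\<alpha> U) = add_pow A ?n (\<beta> U)"
      unfolding A.add_pow_nat_int
      using A.add.right_cancel[OF R A.add.int_pow_closed[OF c(1)] A.add.int_pow_closed[OF c(2)]] by blast
    have "add_pow A ?n (\<alpha> U \<ominus>\<^bsub>A\<^esub> \<beta> U) = add_pow A ?n (\<alpha> U) \<oplus>\<^bsub>A\<^esub> add_pow A ?n (\<ominus>\<^bsub>A\<^esub> \<beta> U)"
      unfolding A.minus_eq using c by (intro A.add.nat_pow_distrib) auto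
    also have "\<dots> = add_pow A ?n (\<alpha> U) \<ominus>\<^bsub>A\<^esub> add_pow A ?n (\<beta> U)"
      unfolding A.minus_eq using c by (simp add: A.add.nat_pow_inv)
    also have "\<dots> = \<zero>\<^bsub>A\<^esub>"
      unfolding * using c by (simp add: A.r_right_minus_eq)
    finally have "\<alpha> U \<ominus>\<^bsub>A\<^esub> \<beta> U = \<zero>\<^bsub>A\<^esub>"
      by (rule tf'[of ?n, rotated 3])
        (use c less.hyps index_pos[OF less.hyps carrier_open_subgroup] in \<open>auto simp: Dpr_group_def\<close>)
    then show ?case
      using c A.r_right_minus_eq by blast
  qed
  then show "\<alpha> = \<beta>"
    using \<alpha> \<beta> by (intro PiE_ext) auto
qed

text \<open>Evaluation requires a valuation with values in \<open>A\<close> on the whole type of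
  variables, hence the default value zero off the open subgroups.\<close>

definition strict_map :: "int \<Rightarrow> int \<Rightarrow> 'a ring \<Rightarrow> ('g set \<Rightarrow> 'a) \<Rightarrow> ('g set \<Rightarrow> 'a)" where
  "strict_map q r A = (\<lambda>\<alpha>\<in>open_subgroups G T \<rightarrow>\<^sub>E carrier A. \<lambda>U\<in>open_subgroups G T.
     localized_cring.poly_image A (\<lambda>V. if V \<in> open_subgroups G T then \<alpha> V else \<zero>\<^bsub>A\<^esub>) (strict_poly q r U))"

text \<open>Ghost components are polynomials with integer coefficients, so they commute with
  evaluation.\<close>

lemma ghost_map_poly_image:
  assumes "localized_cring A N" and v: "\<And>a. v a \<in> carrier A"
    and z: "\<And>V. V \<in> open_subgroups G T \<Longrightarrow> z V \<in> localized_polys N"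
  shows "ghost_map G T k A (\<lambda>U\<in>open_subgroups G T. localized_cring.poly_image A v (z U)) =
    (\<lambda>U\<in>open_subgroups G T. localized_cring.poly_image A v (ghost k z U))"
proof -
  interpret A: localized_cring A N
    by fact
  note simps = A.poly_image_closed[where v = v, OF v] A.poly_image_mult[where v = v, OF v]
    A.poly_image_power[where v = v, OF v] A.poly_image_of_int[where v = v, OF v]
    A.poly_image_sum[where v = v, OF v]
  show ?thesis
    unfolding ghost_map_def
  proof (rule restrict_ext)
    fix U assume U: "U \<in> open_subgroups G T"
    let ?c = "\<lambda>V. int (index G (carrier G) V) * k ^ (index G V U - 1)"
    have "A.poly_image v (ghost k z U) =
        (\<Oplus>\<^bsub>A\<^esub>V\<in>overgroups U. A.poly_image v (of_int (?c V) * z V ^ index G V U))"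
      unfolding ghost_def using finite_overgroups[OF U] z
      by (intro simps localized_polys_mult localized_polys_of_int localized_polys_power) auto
    also have "\<dots> = (\<Oplus>\<^bsub>A\<^esub>V\<in>overgroups U.
        add_pow A (?c V) ((\<lambda>U\<in>open_subgroups G T. A.poly_image v (z U)) V [^]\<^bsub>A\<^esub> index G V U))"
    proof (rule A.finsum_cong')
      fix V assume "V \<in> overgroups U"
      then have V: "V \<in> open_subgroups G T"
        by blast
      have "A.poly_image v (of_int (?c V) * z V ^ index G V U) =
          A.int_image (?c V) \<otimes>\<^bsub>A\<^esub> A.poly_image v (z V) [^]\<^bsub>A\<^esub> index G V U"
        unfolding simps(2)[OF localized_polys_of_int localized_polys_power[OF z[OF V]]]
          simps(3)[OF z[OF V]] simps(4) ..
      also have "\<dots> = add_pow A (?c V) (A.poly_image v (z V) [^]\<^bsub>A\<^esub> index G V U)"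
        using z[OF V] by (intro A.add_pow_int_image[symmetric] A.nat_pow_closed simps)
      finally show "A.poly_image v (of_int (?c V) * z V ^ index G V U) =
          add_pow A (?c V) ((\<lambda>U\<in>open_subgroups G T. A.poly_image v (z U)) V [^]\<^bsub>A\<^esub> index G V U)"
        using V by simp
    next
      show "(\<lambda>V. add_pow A (?c V) ((\<lambda>U\<in>open_subgroups G T. A.poly_image v (z U)) V [^]\<^bsub>A\<^esub> index G V U))
          \<in> overgroups U \<rightarrow> carrier A"
        using simps(1)[OF z] by (auto intro!: A.add.int_pow_closed A.nat_pow_closed)
    qed simp
    finally show "(\<Oplus>\<^bsub>A\<^esub>V\<in>overgroups U.
        add_pow A (?c V) ((\<lambda>U\<in>open_subgroups G T. A.poly_image v (z U)) V [^]\<^bsub>A\<^esub> index G V U)) =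
        A.poly_image v (ghost k z U)" ..
  qed
qed

section \<open>Ghost components and naturality of the strict map\<close>

context
  fixes q r :: int and N :: "nat set"
  assumes N: "\<And>p. p \<in> Dpr_group G T \<Longrightarrow> p \<notin> N \<Longrightarrow> int p dvd q \<longleftrightarrow> int p dvd r"
begin

lemma strict_map_closed:
  assumes "localized_cring A N" "\<alpha> \<in> open_subgroups G T \<rightarrow>\<^sub>E carrier A"
  shows "strict_map q r A \<alpha> \<in> open_subgroups G T \<rightarrow>\<^sub>E carrier A"
proof -
  interpret A: localized_cring A N
    by fact
  let ?v = "\<lambda>V. if V \<in> open_subgroups G T then \<alpha> V else \<zero>\<^bsub>A\<^esub>"
  have "?v V \<in> carrier A" for V
    using assms(2) by auto
  then show ?thesis
    using assms(2) A.poly_image_closed[where v = ?v] strict_poly_localized[OF N]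
    by (simp add: strict_map_def)
qed

text \<open>The polynomial identity \<open>ghost_strict_poly\<close>, evaluated at \<alpha>.\<close>

lemma ghost_map_strict_map:
  assumes "localized_cring A N" "\<alpha> \<in> open_subgroups G T \<rightarrow>\<^sub>E carrier A"
  shows "ghost_map G T r A (strict_map q r A \<alpha>) = ghost_map G T q A \<alpha>"
proof -
  interpret A: localized_cring A N
    by fact
  let ?v = "\<lambda>V. if V \<in> open_subgroups G T then \<alpha> V else \<zero>\<^bsub>A\<^esub>"
  have v: "?v V \<in> carrier A" for V
    using assms(2) by auto
  have "ghost_map G T r A (strict_map q r A \<alpha>) =
      (\<lambda>U\<in>open_subgroups G T. A.poly_image ?v (ghost r (strict_poly q r) U))"
    unfolding strict_map_def restrict_apply'[OF assms(2)]
    by (intro ghost_map_poly_image[OF assms(1)] v strict_poly_localized[OF N])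
  also have "\<dots> = (\<lambda>U\<in>open_subgroups G T. A.poly_image ?v (ghost q pvar U))"
    by (intro restrict_ext arg_cong[where f = "A.poly_image ?v"] ghost_strict_poly)
  also have "\<dots> = ghost_map G T q A (\<lambda>U\<in>open_subgroups G T. A.poly_image ?v (pvar U))"
    by (intro ghost_map_poly_image[OF assms(1), symmetric] v localized_polys_var)
  also have "(\<lambda>U\<in>open_subgroups G T. A.poly_image ?v (pvar U)) = \<alpha>"
  proof (rule extensionalityI[of _ "open_subgroups G T"])
    show "\<alpha> \<in> extensional (open_subgroups G T)"
      using assms(2) by (simp add: PiE_def)
    show "(\<lambda>U\<in>open_subgroups G T. A.poly_image ?v (pvar U)) U = \<alpha> U" if "U \<in> open_subgroups G T" for U
      using that unfolding A.poly_image_var[where v = ?v, OF v] by simp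
  qed simp
  finally show ?thesis .
qed

lemma strict_map_natural:
  assumes A: "localized_cring A N" and B: "localized_cring B N" and F: "F \<in> ring_hom A B"
    and \<alpha>: "\<alpha> \<in> open_subgroups G T \<rightarrow>\<^sub>E carrier A"
  shows "compose (open_subgroups G T) F (strict_map q r A \<alpha>) =
    strict_map q r B (compose (open_subgroups G T) F \<alpha>)"
proof -
  interpret A: localized_cring A N
    by fact
  interpret B: localized_cring B N
    by fact
  interpret ring_hom_cring A B F
    by (intro ring_hom_cring.intro ring_hom_cring_axioms.intro A.cring_axioms B.cring_axioms F)
  let ?v = "\<lambda>V. if V \<in> open_subgroups G T then \<alpha> V else \<zero>\<^bsub>A\<^esub>"
  have v: "?v V \<in> carrier A" for V
    using \<alpha> by auto
  have F\<alpha>: "compose (open_subgroups G T) F \<alpha> \<in> open_subgroups G T \<rightarrow>\<^sub>E carrier B"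
    using \<alpha> by (auto simp: compose_def)
  \<comment> \<open>The default value is respected because \<open>F\<close> maps zero to
    zero.\<close>
  have "(\<lambda>V. F (?v V)) = (\<lambda>V. if V \<in> open_subgroups G T then compose (open_subgroups G T) F \<alpha> V else \<zero>\<^bsub>B\<^esub>)"
    by (auto simp: compose_def)
  then show ?thesis
    unfolding strict_map_def restrict_apply'[OF \<alpha>] restrict_apply'[OF F\<alpha>]
    using poly_image_natural[OF A B F v strict_poly_localized[OF N]]
    by (auto simp: compose_def fun_eq_iff)
qed

end

end

section \<open>Strict isomorphisms\<close>

text \<open>Both images agree after the injective \<open>g2\<close>. Only closure is asked of the
  operations, so the lemma serves for multiplication and addition alike.\<close>

lemma hom_of_injective:
  assumes g1: "g1 \<in> hom M K" and g2: "g2 \<in> hom M' K" "inj_on g2 (carrier M')"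
    and h: "\<And>x. x \<in> carrier M \<Longrightarrow> h x \<in> carrier M'"
    and comm: "\<And>x. x \<in> carrier M \<Longrightarrow> g2 (h x) = g1 x"
    and closed: "\<And>x y. x \<in> carrier M \<Longrightarrow> y \<in> carrier M \<Longrightarrow> x \<otimes>\<^bsub>M\<^esub> y \<in> carrier M"
      "\<And>x y. x \<in> carrier M' \<Longrightarrow> y \<in> carrier M' \<Longrightarrow> x \<otimes>\<^bsub>M'\<^esub> y \<in> carrier M'"
  shows "h \<in> hom M M'"
proof (rule homI)
  fix x y assume xy: "x \<in> carrier M" "y \<in> carrier M"
  have "g2 (h (x \<otimes>\<^bsub>M\<^esub> y)) = g1 x \<otimes>\<^bsub>K\<^esub> g1 y"
    using comm[OF closed(1)[OF xy]] hom_mult[OF g1 xy] by simp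
  also have "\<dots> = g2 (h x \<otimes>\<^bsub>M'\<^esub> h y)"
    using comm xy hom_mult[OF g2(1) h[OF xy(1)] h[OF xy(2)]] by simp
  finally show "h (x \<otimes>\<^bsub>M\<^esub> y) = h x \<otimes>\<^bsub>M'\<^esub> h y"
    by (rule inj_onD[OF g2(2) _ h[OF closed(1)[OF xy]] closed(2)[OF h[OF xy(1)] h[OF xy(2)]]])
qed (rule h)

text \<open>Compatibility descends along the surjection \<open>f\<close>: lift both arguments,
  compute with \<open>h1\<close>, and map back.\<close>

lemma hom_of_surjective:
  assumes f: "f \<in> hom M1 M2" "carrier M2 \<subseteq> f ` carrier M1" and f': "f' \<in> hom M1' M2'"
    and h1: "h1 \<in> hom M1 M1'" and h2: "\<And>x. x \<in> carrier M2 \<Longrightarrow> h2 x \<in> carrier M2'"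
    and comm: "\<And>x. x \<in> carrier M1 \<Longrightarrow> h2 (f x) = f' (h1 x)"
    and closed: "\<And>x y. x \<in> carrier M1 \<Longrightarrow> y \<in> carrier M1 \<Longrightarrow> x \<otimes>\<^bsub>M1\<^esub> y \<in> carrier M1"
  shows "h2 \<in> hom M2 M2'"
proof (rule homI)
  fix x y assume "x \<in> carrier M2" "y \<in> carrier M2"
  then obtain u v where uv: "u \<in> carrier M1" "v \<in> carrier M1" "x = f u" "y = f v"
    using f(2) by blast
  have "h2 (x \<otimes>\<^bsub>M2\<^esub> y) = h2 (f (u \<otimes>\<^bsub>M1\<^esub> v))"
    unfolding uv using hom_mult[OF f(1) uv(1,2)] by simp
  also have "\<dots> = f' (h1 u \<otimes>\<^bsub>M1'\<^esub> h1 v)"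
    using comm[OF closed[OF uv(1,2)]] hom_mult[OF h1 uv(1,2)] by simp
  also have "\<dots> = h2 x \<otimes>\<^bsub>M2'\<^esub> h2 y"
    unfolding uv using comm uv hom_mult[OF f' hom_in_carrier[OF h1 uv(1)] hom_in_carrier[OF h1 uv(2)]]
    by simp
  finally show "h2 (x \<otimes>\<^bsub>M2\<^esub> y) = h2 x \<otimes>\<^bsub>M2'\<^esub> h2 y" .
qed (rule h2)

lemma (in comm_rng) add_closed: "x \<in> carrier R \<Longrightarrow> y \<in> carrier R \<Longrightarrow> x \<oplus> y \<in> carrier R"
  by (rule a_closed)

lemma rng_hom_of_injective:
  assumes "comm_rng M" "comm_rng M'" "g1 \<in> rng_hom M K" "g2 \<in> rng_hom M' K" "inj_on g2 (carrier M')"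
    and "\<And>x. x \<in> carrier M \<Longrightarrow> h x \<in> carrier M'" "\<And>x. x \<in> carrier M \<Longrightarrow> g2 (h x) = g1 x"
  shows "h \<in> rng_hom M M'"
  unfolding rng_hom_def
proof
  show "h \<in> hom M M'"
    by (rule hom_of_injective[of g1 M K g2])
      (use assms in \<open>auto simp: rng_hom_def comm_rng.mult_closed\<close>)
  show "h \<in> hom (add_monoid M) (add_monoid M')"
    by (rule hom_of_injective[of g1 _ "add_monoid K" g2])
      (use assms in \<open>auto simp: rng_hom_def comm_rng.add_closed\<close>)
qed

lemma rng_hom_of_surjective:
  assumes "comm_rng M1" "f \<in> rng_hom M1 M2" "carrier M2 \<subseteq> f ` carrier M1" "f' \<in> rng_hom M1' M2'"
    and "h1 \<in> rng_hom M1 M1'" and "\<And>x. x \<in> carrier M2 \<Longrightarrow> h2 x \<in> carrier M2'"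
    and "\<And>x. x \<in> carrier M1 \<Longrightarrow> h2 (f x) = f' (h1 x)"
  shows "h2 \<in> rng_hom M2 M2'"
  unfolding rng_hom_def
proof
  show "h2 \<in> hom M2 M2'"
    by (rule hom_of_surjective[of f M1 M2 f' M1' M2' h1])
      (use assms in \<open>auto simp: rng_hom_def comm_rng.mult_closed\<close>)
  show "h2 \<in> hom (add_monoid M2) (add_monoid M2')"
    by (rule hom_of_surjective[of f "add_monoid M1" _ f' "add_monoid M1'" _ h1])
      (use assms in \<open>auto simp: rng_hom_def comm_rng.add_closed\<close>)
qed

text \<open>Polynomials with one variable for each element of the type map onto \<open>A\<close> by
  evaluating each variable at its own name, or at zero for names outside the carrier.\<close>

lemma torsion_free_cover:
  fixes A :: "'a::infinite ring"
  assumes "localized_cring A N"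
  obtains B :: "'a ring" and h where "localized_cring B N" "h \<in> ring_hom B A"
    "carrier A \<subseteq> h ` carrier B"
    "\<And>n x. \<lbrakk>n > 0; x \<in> carrier B; add_pow B (n::nat) x = \<zero>\<^bsub>B\<^esub>\<rbrakk> \<Longrightarrow> x = \<zero>\<^bsub>B\<^esub>"
proof -
  interpret localized_cring A N
    by fact
  obtain \<iota> :: "('a multiset \<Rightarrow>\<^sub>0 rat) \<Rightarrow> 'a" where \<iota>: "inj \<iota>"
    using infinite_poly_coding by blast
  define v where "v a = (if a \<in> carrier A then a else \<zero>\<^bsub>A\<^esub>)" for a
  have v: "v a \<in> carrier A" for a
    unfolding v_def by simp
  let ?h = "poly_image v \<circ> inv_into UNIV \<iota>"
  have "carrier A \<subseteq> ?h ` carrier (poly_copy \<iota> N)"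
  proof
    fix a assume "a \<in> carrier A"
    then show "a \<in> ?h ` carrier (poly_copy \<iota> N)"
      using poly_copy_cover(2)[where v = v, OF \<iota> assms v, of a] by (simp add: v_def)
  qed
  then show ?thesis
    using that[OF localized_cring_poly_copy[OF \<iota>] poly_copy_cover(1)[where v = v, OF \<iota> assms v]]
      torsion_free_poly_copy[OF \<iota>] by blast
qed

lemma is_witt_burnsideD:
  assumes "is_witt_burnside G T k W" "cring A"
  shows "comm_rng (W A)" "carrier (W A) = open_subgroups G T \<rightarrow>\<^sub>E carrier A"
    "ghost_map G T k A \<in> rng_hom (W A) (ghost_ring G T A)"
    "cring B \<Longrightarrow> f \<in> ring_hom A B \<Longrightarrow> compose (open_subgroups G T) f \<in> rng_hom (W A) (W B)"
  using assms unfolding is_witt_burnside_def by blast+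

lemma Dpr_group_pos: "p \<in> Dpr_group G T \<Longrightarrow> p > 0"
  by (auto simp: Dpr_group_def prime_gt_0_nat)

text \<open>Preimages are chosen componentwise; this is how surjectivity passes from a ring map to
  the induced map of the functors.\<close>

lemma lift_PiE:
  assumes "C \<subseteq> h ` B" "\<alpha> \<in> I \<rightarrow>\<^sub>E C"
  obtains x where "x \<in> I \<rightarrow>\<^sub>E B" "compose I h x = \<alpha>"
proof -
  have "\<exists>b. b \<in> B \<and> h b = \<alpha> i" if "i \<in> I" for i
    using assms PiE_mem[OF assms(2) that] by (metis imageE subsetD)
  then obtain x where x: "\<And>i. i \<in> I \<Longrightarrow> x i \<in> B \<and> h (x i) = \<alpha> i"
    by metis
  have "compose I h (restrict x I) = \<alpha>"
    by (rule extensionalityI[of _ I]) (use x assms(2) in \<open>auto simp: compose_def PiE_def\<close>)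
  then show ?thesis
    using that[of "restrict x I"] x by auto
qed

section \<open>The strict map as an isomorphism, uniqueness, and the converse\<close>

context profinite
begin

context
  fixes q r :: int and N :: "nat set" and Wq Wr :: "'a::infinite ring \<Rightarrow> ('g set \<Rightarrow> 'a) ring"
  assumes N: "\<And>p. p \<in> Dpr_group G T \<Longrightarrow> p \<notin> N \<Longrightarrow> int p dvd q \<longleftrightarrow> int p dvd r"
    and Wq: "is_witt_burnside G T q Wq" and Wr: "is_witt_burnside G T r Wr"
begin

text \<open>The two ghost maps are homomorphisms related by the strict map, and the second one is
  injective here.\<close>

lemma strict_map_rng_hom_torsion_free:
  assumes B: "localized_cring B N"
    and tf: "\<And>n x. \<lbrakk>n > 0; x \<in> carrier B; add_pow B (n::nat) x = \<zero>\<^bsub>B\<^esub>\<rbrakk> \<Longrightarrow> x = \<zero>\<^bsub>B\<^esub>"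
  shows "strict_map q r B \<in> rng_hom (Wq B) (Wr B)"
proof -
  have cring: "cring B"
    using B by (simp add: localized_cring_def)
  have "inj_on (ghost_map G T r B) (carrier (Wr B))"
    unfolding is_witt_burnsideD(2)[OF Wr cring]
    by (rule ghost_map_inj[OF cring]) (use tf Dpr_group_pos in blast)
  then show ?thesis
    using strict_map_closed[OF N B] ghost_map_strict_map[OF N B]
    by (intro rng_hom_of_injective[OF is_witt_burnsideD(1)[OF Wq cring] is_witt_burnsideD(1)[OF Wr cring]
          is_witt_burnsideD(3)[OF Wq cring] is_witt_burnsideD(3)[OF Wr cring]])
      (auto simp: is_witt_burnsideD(2)[OF Wq cring] is_witt_burnsideD(2)[OF Wr cring])
qed

text \<open>Descends from a torsion-free cover by naturality.\<close>

lemma strict_map_rng_hom: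
  assumes A: "localized_cring A N"
  shows "strict_map q r A \<in> rng_hom (Wq A) (Wr A)"
proof -
  obtain B :: "'a ring" and h where B: "localized_cring B N" "h \<in> ring_hom B A"
    "carrier A \<subseteq> h ` carrier B"
    and tf: "\<And>n x. \<lbrakk>n > 0; x \<in> carrier B; add_pow B (n::nat) x = \<zero>\<^bsub>B\<^esub>\<rbrakk> \<Longrightarrow> x = \<zero>\<^bsub>B\<^esub>"
    using torsion_free_cover[OF A] by metis
  have cring: "cring A" "cring B"
    using A B(1) by (simp_all add: localized_cring_def)
  let ?h = "compose (open_subgroups G T) h"
  show ?thesis
  proof (rule rng_hom_of_surjective)
    show "comm_rng (Wq B)" "?h \<in> rng_hom (Wq B) (Wq A)" "?h \<in> rng_hom (Wr B) (Wr A)"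
      by (intro is_witt_burnsideD[OF Wq] is_witt_burnsideD[OF Wr] cring B(2))+
    show "carrier (Wq A) \<subseteq> ?h ` carrier (Wq B)"
      unfolding is_witt_burnsideD(2)[OF Wq cring(1)] is_witt_burnsideD(2)[OF Wq cring(2)]
      using lift_PiE[OF B(3)] by (metis image_eqI subsetI)
    show "strict_map q r B \<in> rng_hom (Wq B) (Wr B)"
      by (rule strict_map_rng_hom_torsion_free[OF B(1) tf])
    show "strict_map q r A \<alpha> \<in> carrier (Wr A)" if "\<alpha> \<in> carrier (Wq A)" for \<alpha>
      using that strict_map_closed[OF N A] is_witt_burnsideD(2)[OF Wq cring(1)] is_witt_burnsideD(2)[OF Wr cring(1)] by simp
    show "strict_map q r A (?h \<alpha>) = ?h (strict_map q r B \<alpha>)" if "\<alpha> \<in> carrier (Wq B)" for \<alpha>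
      using that strict_map_natural[OF N B(1) A B(2)] is_witt_burnsideD(2)[OF Wq cring(2)] by simp
  qed
qed

end

text \<open>Over a torsion-free cover the composite preserves the injective ghost map for
  \<open>q\<close>, so it is the identity there; naturality carries this down to
  \<open>A\<close>.\<close>

lemma strict_map_inverse:
  fixes A :: "'a::infinite ring"
  assumes N: "\<And>p. p \<in> Dpr_group G T \<Longrightarrow> p \<notin> N \<Longrightarrow> int p dvd q \<longleftrightarrow> int p dvd r"
    and A: "localized_cring A N" and \<alpha>: "\<alpha> \<in> open_subgroups G T \<rightarrow>\<^sub>E carrier A"
  shows "strict_map r q A (strict_map q r A \<alpha>) = \<alpha>"
proof -
  have N': "int p dvd r \<longleftrightarrow> int p dvd q" if "p \<in> Dpr_group G T" "p \<notin> N" for p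
    using N that by blast
  obtain B :: "'a ring" and h where B: "localized_cring B N" "h \<in> ring_hom B A"
    "carrier A \<subseteq> h ` carrier B"
    and tf: "\<And>n x. \<lbrakk>n > 0; x \<in> carrier B; add_pow B (n::nat) x = \<zero>\<^bsub>B\<^esub>\<rbrakk> \<Longrightarrow> x = \<zero>\<^bsub>B\<^esub>"
    using torsion_free_cover[OF A] by metis
  have "cring B"
    using B(1) by (simp add: localized_cring_def)
  obtain x where x: "x \<in> open_subgroups G T \<rightarrow>\<^sub>E carrier B" "compose (open_subgroups G T) h x = \<alpha>"
    using lift_PiE[OF B(3) \<alpha>] by metis
  note closed = strict_map_closed[OF N B(1) x(1)]
  have "inj_on (ghost_map G T q B) (open_subgroups G T \<rightarrow>\<^sub>E carrier B)"
    by (rule ghost_map_inj[OF \<open>cring B\<close>]) (use tf Dpr_group_pos in blast)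
  moreover have "ghost_map G T q B (strict_map r q B (strict_map q r B x)) = ghost_map G T q B x"
    using ghost_map_strict_map[OF N' B(1) closed] ghost_map_strict_map[OF N B(1) x(1)] by simp
  ultimately have "strict_map r q B (strict_map q r B x) = x"
    using strict_map_closed[OF N' B(1) closed] x(1) by (auto dest: inj_onD)
  then show ?thesis
    using strict_map_natural[OF N B(1) A B(2) x(1)] strict_map_natural[OF N' B(1) A B(2) closed] x(2)
    by simp
qed

lemma strict_map_in_strict_isos:
  fixes A :: "'a::infinite ring"
  assumes N: "\<And>p. p \<in> Dpr_group G T \<Longrightarrow> p \<notin> N \<Longrightarrow> int p dvd q \<longleftrightarrow> int p dvd r"
    and Wq: "is_witt_burnside G T q Wq" and Wr: "is_witt_burnside G T r Wr"
    and A: "localized_cring A N"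
  shows "strict_map q r A \<in> strict_isos G T q r Wq Wr A"
proof -
  have N': "int p dvd r \<longleftrightarrow> int p dvd q" if "p \<in> Dpr_group G T" "p \<notin> N" for p
    using N that by blast
  have cring: "cring A"
    using A by (simp add: localized_cring_def)
  note carrier = is_witt_burnsideD(2)[OF Wq cring] is_witt_burnsideD(2)[OF Wr cring]
  have "bij_betw (strict_map q r A) (carrier (Wq A)) (carrier (Wr A))"
    unfolding carrier
    using strict_map_closed[OF N A] strict_map_closed[OF N' A] strict_map_inverse[OF N A]
      strict_map_inverse[OF N' A]
    by (intro bij_betw_byWitness[where f' = "strict_map r q A"]) (simp_all add: image_subset_iff)
  then show ?thesis
    using strict_map_rng_hom[OF N Wq Wr A] ghost_map_strict_map[OF N A]
    unfolding strict_isos_def rng_iso_def carrier by (auto simp: strict_map_def)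
qed

text \<open>Two strict isomorphisms agree after the ghost map for \<open>r\<close>, which is
  injective under this torsion hypothesis.\<close>

lemma strict_iso_torsion_free:
  assumes Wq: "is_witt_burnside G T q Wq" and Wr: "is_witt_burnside G T r Wr" and "cring A"
    and tf: "\<And>p a. \<lbrakk>p \<in> Dpr_group G T; a \<in> carrier A; add_pow A p a = \<zero>\<^bsub>A\<^esub>\<rbrakk> \<Longrightarrow> a = \<zero>\<^bsub>A\<^esub>"
    and \<sigma>: "\<sigma> \<in> strict_isos G T q r Wq Wr A" and \<tau>: "\<tau> \<in> strict_isos G T q r Wq Wr A"
  shows "\<sigma> = \<tau>"
proof (rule extensionalityI[of _ "carrier (Wq A)"])
  show "\<sigma> \<in> extensional (carrier (Wq A))" "\<tau> \<in> extensional (carrier (Wq A))"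
    using \<sigma> \<tau> by (simp_all add: strict_isos_def)
  fix \<alpha> assume \<alpha>: "\<alpha> \<in> carrier (Wq A)"
  have "\<sigma> \<alpha> \<in> carrier (Wr A)" "\<tau> \<alpha> \<in> carrier (Wr A)"
    using \<alpha> \<sigma> \<tau> by (auto simp: strict_isos_def rng_iso_def dest: bij_betwE)
  moreover have "ghost_map G T r A (\<sigma> \<alpha>) = ghost_map G T r A (\<tau> \<alpha>)"
    using \<alpha> \<sigma> \<tau> by (simp add: strict_isos_def)
  moreover have "inj_on (ghost_map G T r A) (carrier (Wr A))"
    unfolding is_witt_burnsideD(2)[OF Wr \<open>cring A\<close>]
    by (rule ghost_map_inj[OF \<open>cring A\<close>]) (use tf in blast)
  ultimately show "\<sigma> \<alpha> = \<tau> \<alpha>"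
    by (auto dest: inj_onD)
qed

text \<open>Applied to the constant function 1 at an open subgroup of index \<open>p\<close>, the
  isomorphism makes \<open>p\<close> a unit.\<close>

lemma localized_cring_of_strict_iso:
  assumes Wq: "is_witt_burnside G T q Wq" and Wr: "is_witt_burnside G T r Wr" and cring: "cring A"
    and N: "\<And>p. p \<in> N \<Longrightarrow> p \<in> Dpr_group G T \<and> (int p dvd q \<longleftrightarrow> \<not> int p dvd r)"
    and \<tau>: "\<tau> \<in> strict_isos G T q r Wq Wr A"
  shows "localized_cring A N"
proof -
  interpret A: cring A
    by fact
  show ?thesis
  proof unfold_locales
    fix p assume p: "p \<in> N" "Factorial_Ring.prime p"
    obtain V where V: "V \<in> open_subgroups G T" "index G (carrier G) V = p"
      using exists_prime_index N[OF p(1)] by blast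
    let ?\<alpha> = "\<lambda>U\<in>open_subgroups G T. \<one>\<^bsub>A\<^esub>"
    have \<alpha>: "?\<alpha> \<in> carrier (Wq A)"
      unfolding is_witt_burnsideD(2)[OF Wq cring] by auto
    then have "\<tau> ?\<alpha> \<in> open_subgroups G T \<rightarrow>\<^sub>E carrier A"
      using \<tau> unfolding is_witt_burnsideD(2)[OF Wr cring, symmetric]
      by (auto simp: strict_isos_def rng_iso_def dest: bij_betwE)
    then show "add_pow A p \<one>\<^bsub>A\<^esub> \<in> Units A"
      using prime_unit_of_ghost_map_eq[OF cring V p(2), of "\<tau> ?\<alpha>" q r] N[OF p(1)] \<tau> \<alpha>
      by (simp add: strict_isos_def)
  qed
qed

end

text \<open>Torsion in \<open>A\<close> can destroy literal uniqueness. The first conjunct therefore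
  takes uniqueness functorially, the second isolates existence, and the third recovers literal
  uniqueness where the ghost map is injective.\<close>

theorem theorem8p2:
  fixes G :: "'g monoid" and T :: "'g topology"
    and A :: "'a::infinite ring"
    and q r :: int
    and Wq Wr :: "'a ring \<Rightarrow> ('g set \<Rightarrow> 'a) ring"
    and P C D :: "nat set"
  assumes "abelian_profinite_group G T"
    and "cring A"
    and "is_witt_burnside G T q Wq"
    and "is_witt_burnside G T r Wr"
    and "P = Dpr_int q \<inter> Dpr_int r \<inter> Dpr_group G T"
    and "Dpr_int q \<inter> Dpr_group G T = P \<union> C" and "P \<inter> C = {}"
    and "Dpr_int r \<inter> Dpr_group G T = P \<union> D" and "P \<inter> D = {}"
  shows "((\<exists>!\<tau>. \<tau> \<in> functorial_strict_isos G T q r Wq Wr A) \<longleftrightarrow>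
            is_algebra_over (int_localization (C \<union> D)) A) \<and>
         ((\<exists>\<tau>. \<tau> \<in> strict_isos G T q r Wq Wr A) \<longleftrightarrow>
            is_algebra_over (int_localization (C \<union> D)) A) \<and>
         ((\<forall>p\<in>Dpr_group G T. \<forall>a\<in>carrier A. add_pow A p a = \<zero>\<^bsub>A\<^esub> \<longrightarrow> a = \<zero>\<^bsub>A\<^esub>) \<longrightarrow>
            ((\<exists>!\<tau>. \<tau> \<in> strict_isos G T q r Wq Wr A) \<longleftrightarrow>
               is_algebra_over (int_localization (C \<union> D)) A))"
proof -
  interpret profinite G T
    using assms(1) by (simp add: profinite_def)
  note W = assms(3,4)
  let ?N = "C \<union> D"
  let ?SI = "strict_isos G T q r Wq Wr :: 'a ring \<Rightarrow> _"
  let ?F = "functorial_strict_isos G T q r Wq Wr A"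
  have N1: "int p dvd q \<longleftrightarrow> int p dvd r" if "p \<in> Dpr_group G T" "p \<notin> ?N" for p
  proof -
    have "p \<in> Dpr_int q \<longleftrightarrow> p \<in> Dpr_int r"
      using that assms(5-9) by blast
    then show ?thesis
      using that(1) by (auto simp: Dpr_int_def Dpr_group_def)
  qed
  have N2: "p \<in> Dpr_group G T \<and> (int p dvd q \<longleftrightarrow> \<not> int p dvd r)" if "p \<in> ?N" for p
  proof -
    have "p \<in> Dpr_group G T" "p \<in> Dpr_int q \<longleftrightarrow> p \<notin> Dpr_int r"
      using that assms(5-9) by blast+
    then show ?thesis
      by (auto simp: Dpr_int_def Dpr_group_def)
  qed
  then have prime: "Factorial_Ring.prime p" if "p \<in> ?N" for p
    using that by (auto simp: Dpr_group_def)
  have alg: "is_algebra_over (int_localization ?N) B \<longleftrightarrow> localized_cring B ?N" if "cring B" for B :: "'a ring"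
  proof
    assume "is_algebra_over (int_localization ?N) B"
    then show "localized_cring B ?N"
      by (intro localized_cring.intro localized_cring_axioms.intro that)
        (rule is_algebra_over_int_localizationD[OF _ that])
  next
    assume "localized_cring B ?N"
    then show "is_algebra_over (int_localization ?N) B"
      by (rule is_algebra_over_int_localizationI) (rule prime)
  qed
  have exists: "?SI B \<noteq> {} \<longleftrightarrow> localized_cring B ?N" if "cring B" for B
    using localized_cring_of_strict_iso[OF W that N2] strict_map_in_strict_isos[OF N1 W, where A = B]
    by blast
  \<comment> \<open>The rings indexing a functorial family are exactly those in which the primes of
    \<open>?N\<close> are units, so torsion-free covers are among them.\<close>
  have category: "{B. cring B \<and> ?SI B \<noteq> {}} = {B. localized_cring B ?N}"
    using exists by (auto simp: localized_cring_def)
  have unique: "\<tau> = strict_map q r A" if A: "localized_cring A ?N" and \<tau>: "\<tau> \<in> ?F" for \<tau>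
  proof -
    obtain t where t: "t A = \<tau>" "\<And>B. localized_cring B ?N \<Longrightarrow> t B \<in> ?SI B"
      "\<And>B C f \<alpha>. localized_cring B ?N \<Longrightarrow> localized_cring C ?N \<Longrightarrow> f \<in> ring_hom B C \<Longrightarrow>
        \<alpha> \<in> carrier (Wq B) \<Longrightarrow>
        compose (open_subgroups G T) f (t B \<alpha>) = t C (compose (open_subgroups G T) f \<alpha>)"
      using \<tau> unfolding functorial_strict_isos_def Let_def category by blast
    obtain B :: "'a ring" and h where B: "localized_cring B ?N" "h \<in> ring_hom B A"
      "carrier A \<subseteq> h ` carrier B"
      and tf: "\<And>n x. \<lbrakk>n > 0; x \<in> carrier B; add_pow B (n::nat) x = \<zero>\<^bsub>B\<^esub>\<rbrakk> \<Longrightarrow> x = \<zero>\<^bsub>B\<^esub>"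
      using torsion_free_cover[OF A] by metis
    have "cring B"
      using B(1) by (simp add: localized_cring_def)
    \<comment> \<open>Without torsion there is only one strict isomorphism; naturality along
      \<open>h\<close> then determines the family at \<open>A\<close>.\<close>
    have tB: "t B = strict_map q r B"
      by (rule strict_iso_torsion_free[OF W \<open>cring B\<close> _ t(2)[OF B(1)] strict_map_in_strict_isos[OF N1 W B(1)]])
        (use tf Dpr_group_pos in blast)
    show ?thesis
    proof (rule extensionalityI[of _ "carrier (Wq A)"])
      show "\<tau> \<in> extensional (carrier (Wq A))" "strict_map q r A \<in> extensional (carrier (Wq A))"
        using t(2)[OF A] t(1) strict_map_in_strict_isos[OF N1 W A] by (auto simp: strict_isos_def)
      fix \<alpha> assume "\<alpha> \<in> carrier (Wq A)"
      then obtain x where x: "x \<in> open_subgroups G T \<rightarrow>\<^sub>E carrier B" "compose (open_subgroups G T) h x = \<alpha>"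
        using lift_PiE[OF B(3)] is_witt_burnsideD(2)[OF W(1) assms(2)] by metis
      then show "\<tau> \<alpha> = strict_map q r A \<alpha>"
        using t(1) t(3)[OF B(1) A B(2), of x] is_witt_burnsideD(2)[OF W(1) \<open>cring B\<close>]
          strict_map_natural[OF N1 B(1) A B(2) x(1)] tB by simp
    qed
  qed
  have iso: "strict_map q r B \<in> ?SI B" if "localized_cring B ?N" for B
    by (rule strict_map_in_strict_isos[OF N1 W that])
  have natural: "compose (open_subgroups G T) f (strict_map q r B \<alpha>) =
      strict_map q r B' (compose (open_subgroups G T) f \<alpha>)"
    if "localized_cring B ?N" "localized_cring B' ?N" "f \<in> ring_hom B B'" "\<alpha> \<in> carrier (Wq B)" for B B' f \<alpha>
    using that strict_map_natural[OF N1 that(1-3)] is_witt_burnsideD(2)[OF W(1), of B]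
    by (simp add: localized_cring_def)
  have functorial: "strict_map q r A \<in> ?F" if A: "localized_cring A ?N"
    unfolding functorial_strict_isos_def Let_def category
    by (intro CollectI conjI iso[OF A] exI[of _ "strict_map q r"] refl ballI)
      (simp_all add: iso natural)
  have sub: "?F \<subseteq> ?SI A"
    by (auto simp: functorial_strict_isos_def)
  \<comment> \<open>For the forward direction, a functorial isomorphism is in particular a strict
    one, which already makes the primes units.\<close>
  have 1: "(\<exists>!\<tau>. \<tau> \<in> ?F) \<longleftrightarrow> localized_cring A ?N"
    using unique functorial sub exists[OF assms(2)] by blast
  have 2: "(\<exists>\<tau>. \<tau> \<in> ?SI A) \<longleftrightarrow> localized_cring A ?N"
    using exists[OF assms(2)] by blast
  have 3: "(\<exists>!\<tau>. \<tau> \<in> ?SI A) \<longleftrightarrow> localized_cring A ?N"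
    if "\<forall>p\<in>Dpr_group G T. \<forall>a\<in>carrier A. add_pow A p a = \<zero>\<^bsub>A\<^esub> \<longrightarrow> a = \<zero>\<^bsub>A\<^esub>"
    using strict_iso_torsion_free[OF W assms(2)] that 2 by blast
  show ?thesis
    unfolding alg[OF assms(2)] using 1 2 3 by blast
qed

end
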